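(* Let $\mathcal A^*$ be an $(r-1)$-connected Poincar\'e DGCA over $\mathbb R$ of degree $n=4r-1$, where $r\ge2$, and suppose that $b^r=\dim H^r(\mathcal A)\le3$. Set $H^*=H^*(\mathcal A)$. If there exists an element $\varphi\in H^{2r-1}$ such that multiplication by $\varphi$, $$\varphi\cdot-\colon H^r\longrightarrow H^{3r-1},$$ is an isomorphism, then $\mathcal A^*$ is intrinsically formal.
   Context: A Poincar\'e DGCA of degree $n$ over a field $\mathbb F$ of characteristic zero is a unital differential graded commutative algebra $\mathcal A^*=\bigoplus_{k=0}^n\mathcal A^k$ whose cohomology $H^*(\mathcal A)$ is finite-dimensional and equipped with a linear functional $\int\colon H^n(\mathcal A)\to\mathbb F$ such that the pairing $\langle\alpha,\beta\rangle=\int\alpha\cdot\beta$ if $|\alpha|+|\beta|=n$, and $0$ otherwise, is nondegenerate on $H^*(\mathcal A)$. It is $(r-1)$-connected if $H^0(\mathcal A)=\mathbb F$ and $H^i(\mathcal A)=0$ for $0<i<r$. A DGCA is formal if it is connected by a zigzag of quasi-isomorphisms of DGCAs to its cohomology algebra with zero differential; $\mathcal A^*$ (equivalently $H^*(\mathcal A)$) is intrinsically formal if every DGCA whose cohomology algebra is isomorphic to $H^*(\mathcal A)$ is formal. *)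

theory Defs
  imports "HOL-Algebra.QuotRing" "Jordan_Normal_Form.VS_Connect"
begin

record ('k, 'a) dgca = "('k, 'a) module" +
  grade :: "nat \<Rightarrow> 'a set"
  diff :: "'a \<Rightarrow> 'a"

text \<open>A family \<open>f\<close> with \<open>f i\<close> homogeneous of degree \<open>i\<close>, almost all zero, with sum \<open>x\<close>.\<close>

definition is_decomposition :: "('k, 'a, 'e) dgca_scheme \<Rightarrow> (nat \<Rightarrow> 'a) \<Rightarrow> 'a \<Rightarrow> bool" where
  "is_decomposition A f x \<longleftrightarrow>
     (\<forall>i. f i \<in> grade A i) \<and> finite {i. f i \<noteq> \<zero>\<^bsub>A\<^esub>} \<and>
     x = (\<Oplus>\<^bsub>A\<^esub>i\<in>{i. f i \<noteq> \<zero>\<^bsub>A\<^esub>}. f i)"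

definition component :: "('k, 'a, 'e) dgca_scheme \<Rightarrow> nat \<Rightarrow> 'a \<Rightarrow> 'a" where
  "component A i x = (THE f. is_decomposition A f x) i"

text \<open>The Koszul sign: multiplication by \<open>(-1)\<^sup>m\<close>.\<close>

definition ksign :: "('a, 'e) ring_scheme \<Rightarrow> nat \<Rightarrow> 'a \<Rightarrow> 'a" where
  "ksign A m x = (if even m then x else \<ominus>\<^bsub>A\<^esub> x)"

locale dgca = vectorspace K A + A: ring A
  for K :: "('k, 'm) ring_scheme" and A :: "('k, 'a, 'e) dgca_scheme" +
  assumes char_zero: "0 < (m::nat) \<Longrightarrow> [m] \<cdot>\<^bsub>K\<^esub> \<one>\<^bsub>K\<^esub> \<noteq> \<zero>\<^bsub>K\<^esub>"
    and smult_mult_left: "\<lbrakk>c \<in> carrier K; x \<in> carrier A; y \<in> carrier A\<rbrakk> \<Longrightarrow>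
      (c \<odot>\<^bsub>A\<^esub> x) \<otimes>\<^bsub>A\<^esub> y = c \<odot>\<^bsub>A\<^esub> (x \<otimes>\<^bsub>A\<^esub> y)"
    and smult_mult_right: "\<lbrakk>c \<in> carrier K; x \<in> carrier A; y \<in> carrier A\<rbrakk> \<Longrightarrow>
      x \<otimes>\<^bsub>A\<^esub> (c \<odot>\<^bsub>A\<^esub> y) = c \<odot>\<^bsub>A\<^esub> (x \<otimes>\<^bsub>A\<^esub> y)"
    and grade_subspace: "VectorSpace.subspace K (grade A i) A"
    and direct_sum: "x \<in> carrier A \<Longrightarrow> \<exists>!f. is_decomposition A f x"
    and one_grade: "\<one>\<^bsub>A\<^esub> \<in> grade A 0"
    and mult_grade: "\<lbrakk>x \<in> grade A i; y \<in> grade A j\<rbrakk> \<Longrightarrow> x \<otimes>\<^bsub>A\<^esub> y \<in> grade A (i + j)"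
    and graded_comm: "\<lbrakk>x \<in> grade A i; y \<in> grade A j\<rbrakk> \<Longrightarrow>
      x \<otimes>\<^bsub>A\<^esub> y = ksign A (i * j) (y \<otimes>\<^bsub>A\<^esub> x)"
    and diff_linear: "diff A \<in> LinearCombinations.module_hom K A A"
    and diff_grade: "x \<in> grade A i \<Longrightarrow> diff A x \<in> grade A (Suc i)"
    and diff_diff: "x \<in> carrier A \<Longrightarrow> diff A (diff A x) = \<zero>\<^bsub>A\<^esub>"
    and leibniz: "\<lbrakk>x \<in> grade A i; y \<in> grade A j\<rbrakk> \<Longrightarrow>
      diff A (x \<otimes>\<^bsub>A\<^esub> y) = (diff A x \<otimes>\<^bsub>A\<^esub> y) \<oplus>\<^bsub>A\<^esub> ksign A i (x \<otimes>\<^bsub>A\<^esub> diff A y)"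

definition dgca_hom ::
  "('k, 'm) ring_scheme \<Rightarrow> ('k, 'a, 'e) dgca_scheme \<Rightarrow> ('k, 'b, 'f) dgca_scheme \<Rightarrow> ('a \<Rightarrow> 'b) set" where
  "dgca_hom K A B = {f \<in> Ring.ring_hom A B \<inter> LinearCombinations.module_hom K A B.
     (\<forall>i. f ` grade A i \<subseteq> grade B i) \<and> (\<forall>x\<in>carrier A. f (diff A x) = diff B (f x))}"

definition cocycles :: "('k, 'a, 'e) dgca_scheme \<Rightarrow> 'a set" where
  "cocycles A = {x \<in> carrier A. diff A x = \<zero>\<^bsub>A\<^esub>}"

definition coboundaries :: "('k, 'a, 'e) dgca_scheme \<Rightarrow> 'a set" where
  "coboundaries A = diff A ` carrier A"

definition cohomology_ring :: "('k, 'a, 'e) dgca_scheme \<Rightarrow> 'a set ring" where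
  "cohomology_ring A = A\<lparr>carrier := cocycles A\<rparr> Quot coboundaries A"

text \<open>The cohomology algebra, regarded as a DGCA with zero differential; its elements are
  cosets of the space of coboundaries.\<close>

definition cohomology :: "('k, 'a, 'e) dgca_scheme \<Rightarrow> ('k, 'a set) dgca" where
  "cohomology A = \<lparr>
     carrier = carrier (cohomology_ring A),
     mult = mult (cohomology_ring A),
     one = one (cohomology_ring A),
     zero = zero (cohomology_ring A),
     add = add (cohomology_ring A),
     smult = (\<lambda>c X. \<Union>x\<in>X. coboundaries A +>\<^bsub>A\<^esub> (c \<odot>\<^bsub>A\<^esub> x)),
     grade = (\<lambda>i. (\<lambda>x. coboundaries A +>\<^bsub>A\<^esub> x) ` (cocycles A \<inter> grade A i)),
     diff = (\<lambda>_. zero (cohomology_ring A))\<rparr>"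

definition cohomology_map ::
  "('k, 'b, 'f) dgca_scheme \<Rightarrow> ('a \<Rightarrow> 'b) \<Rightarrow> 'a set \<Rightarrow> 'b set" where
  "cohomology_map B f X = (\<Union>x\<in>X. coboundaries B +>\<^bsub>B\<^esub> f x)"

definition betti :: "('k, 'm) ring_scheme \<Rightarrow> ('k, 'a, 'e) dgca_scheme \<Rightarrow> nat \<Rightarrow> nat" where
  "betti K A i = vectorspace.dim K ((cohomology A)\<lparr>carrier := grade (cohomology A) i\<rparr>)"

definition quasi_iso ::
  "('k, 'm) ring_scheme \<Rightarrow> ('k, 'a, 'e) dgca_scheme \<Rightarrow> ('k, 'b, 'f) dgca_scheme \<Rightarrow> ('a \<Rightarrow> 'b) \<Rightarrow> bool" where
  "quasi_iso K A B f \<longleftrightarrow> dgca K A \<and> dgca K B \<and> f \<in> dgca_hom K A B \<and>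
     bij_betw (cohomology_map B f) (carrier (cohomology A)) (carrier (cohomology B))"

definition qi_linked ::
  "('k, 'm) ring_scheme \<Rightarrow> ('k, 'a, 'e) dgca_scheme \<Rightarrow> ('k, 'b, 'f) dgca_scheme \<Rightarrow> bool" where
  "qi_linked K A B \<longleftrightarrow> (\<exists>f. quasi_iso K A B f) \<or> (\<exists>f. quasi_iso K B A f)"

text \<open>
  HOL cannot quantify over types, so the intermediate DGCAs of the zigzag are taken with underlying
  set in the type \<open>'a set\<close>, in which the cohomology of \<open>A\<close> lives anyway. This is no restriction:
  if \<open>A\<close> is not the zero algebra, its carrier has at least the cardinality of the infinite field
  \<open>K\<close>, and by a closing-off (Loewenheim-Skolem) argument every zigzag from \<open>A\<close> to its cohomology,
  in whatever universe, can be cut down to a zigzag of DGCAs of cardinality at most that of the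
  carrier of \<open>A\<close>; these have isomorphic copies in \<open>'a set\<close>.
\<close>

definition formal :: "('k, 'm) ring_scheme \<Rightarrow> ('k, 'a) dgca \<Rightarrow> bool" where
  "formal K A \<longleftrightarrow>
     (\<exists>C :: ('k, 'a set) dgca. qi_linked K A C \<and> (qi_linked K)\<^sup>*\<^sup>* C (cohomology A))"

text \<open>Isomorphism of the cohomology algebras as graded algebras.\<close>

definition cohomology_isomorphic ::
  "('k, 'm) ring_scheme \<Rightarrow> ('k, 'b, 'f) dgca_scheme \<Rightarrow> ('k, 'a, 'e) dgca_scheme \<Rightarrow> bool" where
  "cohomology_isomorphic K B A \<longleftrightarrow>
     (\<exists>h \<in> dgca_hom K (cohomology B) (cohomology A).
        bij_betw h (carrier (cohomology B)) (carrier (cohomology A)))"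

text \<open>
  The type argument is the type over which the competing DGCAs range. In a theorem it has to be a
  type variable of its own, not occurring in the type of \<open>A\<close>, so that all DGCAs are covered.
\<close>

definition intrinsically_formal ::
  "'b itself \<Rightarrow> ('k, 'm) ring_scheme \<Rightarrow> ('k, 'a, 'e) dgca_scheme \<Rightarrow> bool" where
  "intrinsically_formal T K A \<longleftrightarrow>
     (\<forall>B :: ('k, 'b) dgca. dgca K B \<and> cohomology_isomorphic K B A \<longrightarrow> formal K B)"

text \<open>The bilinear extension of the pairing on homogeneous elements that is \<open>\<integral> \<alpha> \<cdot> \<beta>\<close> if the degrees
  of \<open>\<alpha>\<close> and \<open>\<beta>\<close> add up to \<open>n\<close>, and zero otherwise; the algebra \<open>H\<close> lives in degrees up to \<open>n\<close>.\<close>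

definition poincare_pairing ::
  "('k, 'm) ring_scheme \<Rightarrow> ('k, 'h, 'e) dgca_scheme \<Rightarrow> nat \<Rightarrow> ('h \<Rightarrow> 'k) \<Rightarrow> 'h \<Rightarrow> 'h \<Rightarrow> 'k" where
  "poincare_pairing K H n intg \<alpha> \<beta> =
     (\<Oplus>\<^bsub>K\<^esub>i\<in>{..n}. \<Oplus>\<^bsub>K\<^esub>j\<in>{..n}.
        if i + j = n then intg (component H i \<alpha> \<otimes>\<^bsub>H\<^esub> component H j \<beta>) else \<zero>\<^bsub>K\<^esub>)"

locale poincare_dgca = dgca K A
  for K :: "('k, 'm) ring_scheme" and A :: "('k, 'a, 'e) dgca_scheme" +
  fixes n :: nat and intg :: "'a set \<Rightarrow> 'k"
  assumes degree_bound: "n < i \<Longrightarrow> grade A i = {\<zero>\<^bsub>A\<^esub>}"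
    and cohomology_fin_dim: "vectorspace.fin_dim K (cohomology A)"
    and intg_closed: "\<alpha> \<in> grade (cohomology A) n \<Longrightarrow> intg \<alpha> \<in> carrier K"
    and intg_add: "\<lbrakk>\<alpha> \<in> grade (cohomology A) n; \<beta> \<in> grade (cohomology A) n\<rbrakk> \<Longrightarrow>
      intg (\<alpha> \<oplus>\<^bsub>cohomology A\<^esub> \<beta>) = intg \<alpha> \<oplus>\<^bsub>K\<^esub> intg \<beta>"
    and intg_smult: "\<lbrakk>c \<in> carrier K; \<alpha> \<in> grade (cohomology A) n\<rbrakk> \<Longrightarrow>
      intg (c \<odot>\<^bsub>cohomology A\<^esub> \<alpha>) = c \<otimes>\<^bsub>K\<^esub> intg \<alpha>"
    and nondegenerate_left: "\<lbrakk>\<alpha> \<in> carrier (cohomology A);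
        \<And>\<beta>. \<beta> \<in> carrier (cohomology A) \<Longrightarrow>
          poincare_pairing K (cohomology A) n intg \<alpha> \<beta> = \<zero>\<^bsub>K\<^esub>\<rbrakk> \<Longrightarrow> \<alpha> = \<zero>\<^bsub>cohomology A\<^esub>"
    and nondegenerate_right: "\<lbrakk>\<beta> \<in> carrier (cohomology A);
        \<And>\<alpha>. \<alpha> \<in> carrier (cohomology A) \<Longrightarrow>
          poincare_pairing K (cohomology A) n intg \<alpha> \<beta> = \<zero>\<^bsub>K\<^esub>\<rbrakk> \<Longrightarrow> \<beta> = \<zero>\<^bsub>cohomology A\<^esub>"

text \<open>\<open>m\<close>-connectedness; \<open>H\<^sup>0 = K\<close> means that the unit map \<open>K \<rightarrow> H\<^sup>0\<close> is bijective.\<close>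

definition cohomologically_connected ::
  "('k, 'm) ring_scheme \<Rightarrow> nat \<Rightarrow> ('k, 'a, 'e) dgca_scheme \<Rightarrow> bool" where
  "cohomologically_connected K m A \<longleftrightarrow>
     bij_betw (\<lambda>c. c \<odot>\<^bsub>cohomology A\<^esub> \<one>\<^bsub>cohomology A\<^esub>) (carrier K) (grade (cohomology A) 0) \<and>
     (\<forall>i. 0 < i \<and> i \<le> m \<longrightarrow> grade (cohomology A) i = {\<zero>\<^bsub>cohomology A\<^esub>})"

end

theory Submission
  imports Defs "HOL-Analysis.Finite_Function_Topology" "HOL-Analysis.Linear_Algebra"
    "HOL-Computational_Algebra.Formal_Power_Series"
begin

text \<open>
  Let \<open>B\<close> be a DGCA whose cohomology \<open>H\<close> is isomorphic to that of \<open>A\<close>. Formality of \<open>B\<close> is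
  shown by a zigzag \<open>B \<leftarrow> M \<rightarrow> H\<close> with a single intermediate algebra \<open>M\<close>. By connectedness and
  Poincare duality \<open>H\<close> lives in the degrees \<open>0\<close>, \<open>r, \<dots>, 3 r - 1\<close> and \<open>4 r - 1\<close>. Choose spaces of
  cocycles representing \<open>H\<close> (``harmonic'' elements). Products of harmonic elements need not be
  harmonic, and the first place where this obstructs formality is degree \<open>2 r\<close>: a relation
  \<open>s = \<Sum> c\<^sub>i\<^sub>j a\<^sub>i a\<^sub>j\<close> between elements \<open>a\<^sub>i\<close> of \<open>H\<^sup>r\<close> that is exact has a primitive \<open>w s\<close>, and
  \<open>(s, t) \<mapsto> \<integral> (w s) t\<close> is a symmetric bilinear form on the space \<open>E\<close> of such relations, a Massey
  product in top degree.

  The case of even \<open>r\<close> is decided by the following piece of linear algebra. Regard relations as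
  quadratic polynomials. The Massey form is harmless if its value on \<open>(s, t)\<close> is a linear functional
  \<open>\<Gamma>\<close> of the quartic \<open>s t\<close>. A symmetric bilinear form on quadratic polynomials fails to have this
  property by a tensor with the symmetries of a curvature tensor. On \<open>E\<close>, however, the linear form
  \<open>s \<mapsto> \<integral> \<phi> s\<close> vanishes; it comes from the symmetric form \<open>q (a, b) = \<integral> \<phi> a b\<close> on \<open>H\<^sup>r\<close>, which
  is nondegenerate because multiplication by \<open>\<phi>\<close> is an isomorphism. So the form may be changed by
  products of this linear form with arbitrary linear forms without changing it on \<open>E\<close>, and this
  changes the curvature tensor by Kulkarni-Nomizu products with \<open>q\<close>. In dimension at most three
  every curvature tensor is such a product, because there is no Weyl tensor: this is where
  \<open>b\<^sup>r \<le> 3\<close> enters. The resulting functional is constructed in \<open>quartic_functional\<close>. If \<open>r\<close> is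
  odd, \<open>q\<close> is a nondegenerate skew form, so \<open>dim H\<^sup>r\<close> is \<open>0\<close> or \<open>2\<close>, and there are no exact
  relations (\<open>odd_products\<close>).

  The algebra \<open>M\<close> records the polynomial from which a product was formed. It is a subalgebra of
  \<open>B \<times> T\<close>, where \<open>T\<close> is an algebra of polynomial labels that is acyclic in positive degrees. Below
  degree \<open>2 r - 1\<close> it consists of harmonic elements with their labels, in degree \<open>2 r - 1\<close> the
  pairs \<open>(w s, s)\<close> are added, in degree \<open>2 r\<close> enough elements are kept to close up under products
  and differentials, and in higher degrees everything is kept. The projection \<open>M \<rightarrow> B\<close> is a
  quasi-isomorphism (\<open>M_closed\<close>). The map \<open>\<psi>: M \<rightarrow> H\<close> takes harmonic parts in low degrees; in degree
  at least \<open>2 r\<close> it sends \<open>p\<close> to the class that represents, by Poincare duality, the functional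
  \<open>h \<mapsto> L (p h)\<close> with \<open>L (b, t) = \<integral> b - \<Gamma> t\<close>. The correction by \<open>\<Gamma>\<close> makes \<open>L\<close> vanish on products of
  \<open>(w s, s)\<close> with elements of degree \<open>2 r\<close>, and this is exactly what makes \<open>\<psi>\<close> multiplicative
  (\<open>psi_mult\<close>).

  These arguments are carried out for graded subspaces of a real vector space (locale \<open>gdga\<close>). Every
  DGCA given by a record is isomorphic to the direct sum of such a family (\<open>dgca_model\<close>), and its
  cohomology to the direct sum of its harmonic spaces (\<open>coh_iso\<close>). Finally, \<open>M\<close> is copied into the
  type of sets over the carrier type of \<open>B\<close> by a cardinality argument (\<open>graded_injection\<close>).
\<close>

section \<open>Linear algebra over the reals\<close>

abbreviation vsubspace :: "'v::real_vector set \<Rightarrow> bool" where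
  "vsubspace \<equiv> Real_Vector_Spaces.subspace"

lemmas vsubspace_0 = real_vector.subspace_0
lemmas vsubspace_add = real_vector.subspace_add
lemmas vsubspace_diff = real_vector.subspace_diff
lemmas vsubspace_scale = real_vector.subspace_scale
lemmas vsubspace_sum = real_vector.subspace_sum

lemma exists_projection:
  fixes U :: "'v::real_vector set"
  assumes "vsubspace U"
  obtains p where "linear p" "\<And>x. p x \<in> U" "\<And>x. x \<in> U \<Longrightarrow> p x = x"
proof -
  have "\<exists>g. range g \<subseteq> U \<and> linear g \<and> (\<forall>v\<in>U. g (id v) = v)"
    by (rule linear_exists_left_inverse_on) (use assms linear_ident in \<open>auto simp: id_def\<close>)
  then obtain g where g: "range g \<subseteq> U" "linear g" "\<forall>v\<in>U. g v = v" by auto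
  show ?thesis by (rule that[of g]) (use g in auto)
qed

text \<open>
  Splitting off \<open>C\<close> works without a complement of \<open>U + C\<close>: correct a projection \<open>p\<close> onto \<open>U\<close> by
  \<open>h\<close>, a left inverse on \<open>C\<close> of the injective map \<open>x - p x\<close>.
\<close>

lemma exists_projection_along:
  fixes U C :: "'v::real_vector set"
  assumes U: "vsubspace U" and C: "vsubspace C" and "\<And>x. x \<in> U \<Longrightarrow> x \<in> C \<Longrightarrow> x = 0"
  obtains g where "linear g" "\<And>x. x \<in> U \<Longrightarrow> g x = x" "\<And>x. x \<in> C \<Longrightarrow> g x = 0" "\<And>x. g x \<in> U"
proof -
  obtain p where p: "linear p" "\<And>x. p x \<in> U" "\<And>x. x \<in> U \<Longrightarrow> p x = x"
    using exists_projection[OF U] by blast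
  interpret p: linear p by fact
  have lin1: "linear (\<lambda>x. x - p x)"
    by (intro linear_compose_sub linear_ident p(1))
  have inj: "inj_on (\<lambda>x. x - p x) C"
  proof (rule inj_onI)
    fix x y assume xy: "x \<in> C" "y \<in> C" "x - p x = y - p y"
    then have "p (x - y) = x - y" unfolding p.diff using xy(3) by (metis add_diff_cancel_left' diff_add_cancel diff_diff_eq2 diff_diff_add)
    then have "x - y \<in> U" using p(2)[of "x - y"] by simp
    moreover have "x - y \<in> C" using xy vsubspace_diff[OF C] by blast
    ultimately show "x = y" using assms(3)[of "x - y"] by simp
  qed
  obtain h where h: "linear h" "range h \<subseteq> C" "\<And>x. x \<in> C \<Longrightarrow> h (x - p x) = x"
    using linear_exists_left_inverse_on[OF lin1 C inj] by auto
  interpret h: linear h by fact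
  define g where "g = (\<lambda>x. p (x - h (x - p x)))"
  have g: "linear g" unfolding g_def
    by (rule linearI) (simp_all only: p.add p.scale h.add h.scale p.diff h.diff scaleR_right_diff_distrib add_diff_add)
  have gU: "g x = x" if "x \<in> U" for x using p(3)[OF that] by (simp only: g_def) (simp add: h.zero)
  have gC: "g x = 0" if "x \<in> C" for x using h(3)[OF that] by (simp only: g_def) (simp add: p.zero)
  have gr: "g x \<in> U" for x unfolding g_def by (rule p(2))
  show ?thesis by (rule that[OF g]) (use gU gC gr in auto)
qed

lemma exists_complement_containing:
  fixes U W C0 :: "'v::real_vector set"
  assumes U: "vsubspace U" and W: "vsubspace W" and C0: "vsubspace C0"
    and "U \<subseteq> W" "C0 \<subseteq> W" "U \<inter> C0 \<subseteq> {0}"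
  obtains C where "vsubspace C" "C0 \<subseteq> C" "C \<subseteq> W" "\<And>x. x \<in> U \<Longrightarrow> x \<in> C \<Longrightarrow> x = 0"
    "\<And>w. w \<in> W \<Longrightarrow> \<exists>c\<in>C. w - c \<in> U"
proof -
  have disj: "x = 0" if "x \<in> U" "x \<in> C0" for x using that assms(6) by blast
  obtain g where g: "linear g" "\<And>x. x \<in> U \<Longrightarrow> g x = x" "\<And>x. x \<in> C0 \<Longrightarrow> g x = 0" "\<And>x. g x \<in> U"
    using exists_projection_along[OF U C0 disj] by blast
  interpret g: linear g by (rule g(1))
  show ?thesis
  proof (rule that[of "{x \<in> W. g x = 0}"])
    show "vsubspace {x \<in> W. g x = 0}"
      using W by (auto simp: real_vector.subspace_def g.add g.scale g.zero)
    show "C0 \<subseteq> {x \<in> W. g x = 0}" using g(3) assms by auto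
    show "\<exists>c\<in>{x \<in> W. g x = 0}. w - c \<in> U" if "w \<in> W" for w
    proof (rule bexI[of _ "w - g w"])
      show "w - (w - g w) \<in> U" using g(4) by simp
      show "w - g w \<in> {x \<in> W. g x = 0}"
        using vsubspace_diff[OF W that, of "g w"] subsetD[OF assms(4) g(4)[of w]] g(2)[OF g(4)] g.diff[of w "g w"] by simp
    qed
  qed (use g in auto)
qed

lemma exists_complement:
  fixes U W :: "'v::real_vector set"
  assumes U: "vsubspace U" and W: "vsubspace W" and "U \<subseteq> W"
  obtains C where "vsubspace C" "C \<subseteq> W" "\<And>x. x \<in> U \<Longrightarrow> x \<in> C \<Longrightarrow> x = 0"
    "\<And>w. w \<in> W \<Longrightarrow> \<exists>c\<in>C. w - c \<in> U"
proof -
  have "vsubspace {0::'v}" by (simp add: real_vector.subspace_def)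
  moreover have "{0} \<subseteq> W" using vsubspace_0[OF W] by simp
  moreover have "U \<inter> {0} \<subseteq> {0}" by simp
  ultimately obtain C where C: "vsubspace C" "{0} \<subseteq> C" "C \<subseteq> W" "\<And>x. x \<in> U \<Longrightarrow> x \<in> C \<Longrightarrow> x = 0"
    "\<And>w. w \<in> W \<Longrightarrow> \<exists>c\<in>C. w - c \<in> U"
    using exists_complement_containing[OF U W _ assms(3), of "{0}"] by metis
  show ?thesis by (rule that[of C]) (use C in auto)
qed

lemma linear_extension:
  fixes f :: "'v::real_vector \<Rightarrow> 'w::real_vector"
  assumes U: "vsubspace U"
    and "\<And>x y. x \<in> U \<Longrightarrow> y \<in> U \<Longrightarrow> f (x + y) = f x + f y"
    and "\<And>c x. x \<in> U \<Longrightarrow> f (c *\<^sub>R x) = c *\<^sub>R f x"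
  obtains g where "linear g" "\<And>x. x \<in> U \<Longrightarrow> g x = f x"
proof -
  obtain p where p: "linear p" "\<And>x. p x \<in> U" "\<And>x. x \<in> U \<Longrightarrow> p x = x"
    using exists_projection[OF U] by blast
  interpret p: linear p by fact
  have "linear (\<lambda>x. f (p x))"
    by (rule linearI) (simp_all add: p.add p.scale assms p)
  then show ?thesis using that[of "\<lambda>x. f (p x)"] p by auto
qed

text \<open>
  Only the right-hand space has to be finite-dimensional; separation of points by \<open>Z\<close> is enough to
  find elements of \<open>Z\<close> dual to a given basis. The induction is a Gram-Schmidt process: \<open>pr\<close> makes
  elements of \<open>Z\<close> orthogonal to the vectors treated so far, and if this killed the pairing with the
  new vector \<open>s\<close>, then \<open>s\<close> would be congruent to a vector in the span of the old ones that is
  orthogonal to all of \<open>Z\<close>.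
\<close>

lemma dual_basis:
  fixes b :: "'v::real_vector \<Rightarrow> 'w::real_vector \<Rightarrow> real"
  assumes b: "bilinear b" and Z: "vsubspace Z"
    and "finite S" "independent S"
    and "\<And>w. w \<in> span S \<Longrightarrow> (\<And>z. z \<in> Z \<Longrightarrow> b z w = 0) \<Longrightarrow> w = 0"
  shows "\<exists>\<zeta>. (\<forall>x\<in>S. \<zeta> x \<in> Z) \<and> (\<forall>x\<in>S. \<forall>y\<in>S. b (\<zeta> x) y = (if x = y then 1 else 0))"
  using assms(3,4,5)
proof (induction S rule: finite_induct)
  case empty
  then show ?case by auto
next
  case (insert s S)
  have ind: "independent S" and s: "s \<notin> span S"
    using insert.prems(1) insert.hyps by (auto simp: real_vector.independent_insert)
  have lin1: "linear (b z)" for z using b by (simp add: bilinear_def)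
  have lin2: "linear (\<lambda>z. b z w)" for w using b by (simp add: bilinear_def)
  have "span S \<subseteq> span (insert s S)" by (rule real_vector.span_mono) auto
  then have "\<exists>\<zeta>. (\<forall>x\<in>S. \<zeta> x \<in> Z) \<and> (\<forall>x\<in>S. \<forall>y\<in>S. b (\<zeta> x) y = (if x = y then 1 else 0))"
    using insert.IH[OF ind] insert.prems(2) by blast
  then obtain \<zeta> where \<zeta>: "\<And>x. x\<in>S \<Longrightarrow> \<zeta> x \<in> Z" "\<And>x y. x \<in> S \<Longrightarrow> y \<in> S \<Longrightarrow> b (\<zeta> x) y = (if x = y then 1 else 0)"
    by blast
  define pr where "pr = (\<lambda>z. z - (\<Sum>x\<in>S. b z x *\<^sub>R \<zeta> x))"
  have prZ: "pr z \<in> Z" if "z \<in> Z" for z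
    unfolding pr_def using that \<zeta>(1) Z by (intro vsubspace_diff vsubspace_sum vsubspace_scale) auto
  have bpr: "b (pr z) w = b z w - (\<Sum>x\<in>S. b z x * b (\<zeta> x) w)" for z w
    unfolding pr_def by (simp add: linear_diff[OF lin2] linear_sum[OF lin2] linear_scale[OF lin2])
  have pr0: "b (pr z) y = 0" if "y \<in> S" for z y
  proof -
    have "(\<Sum>x\<in>S. b z x * b (\<zeta> x) y) = (\<Sum>x\<in>S. if x = y then b z x else 0)"
      by (rule sum.cong) (use \<zeta>(2) that in auto)
    then show ?thesis using that insert.hyps(1) by (simp add: bpr)
  qed
  have "\<exists>z\<in>Z. b (pr z) s \<noteq> 0"
  proof (rule ccontr)
    assume "\<not> ?thesis"
    then have *: "b (pr z) s = 0" if "z \<in> Z" for z using that by blast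
    define s' where "s' = s - (\<Sum>x\<in>S. b (\<zeta> x) s *\<^sub>R x)"
    have sm: "(\<Sum>x\<in>S. b (\<zeta> x) s *\<^sub>R x) \<in> span S"
      by (intro real_vector.span_sum real_vector.span_scale real_vector.span_base)
    have "s' \<in> span (insert s S)"
      unfolding s'_def using sm \<open>span S \<subseteq> span (insert s S)\<close>
      by (intro real_vector.span_diff) (auto intro: real_vector.span_base)
    moreover have "b z s' = 0" if "z \<in> Z" for z
    proof -
      have "b z s' = b z s - (\<Sum>x\<in>S. b (\<zeta> x) s * b z x)"
        unfolding s'_def by (simp add: linear_diff[OF lin1] linear_sum[OF lin1] linear_scale[OF lin1])
      also have "\<dots> = b (pr z) s" by (simp add: bpr mult.commute)
      finally show ?thesis using *[OF that] by simp
    qed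
    ultimately have "s' = 0" using insert.prems(2) by blast
    then have "s \<in> span S" using sm by (simp add: s'_def)
    then show False using s by blast
  qed
  then obtain z0 where z0: "z0 \<in> Z" "b (pr z0) s \<noteq> 0" by blast
  define z1 where "z1 = (1 / b (pr z0) s) *\<^sub>R pr z0"
  have z1: "z1 \<in> Z" "b z1 s = 1" "\<And>y. y \<in> S \<Longrightarrow> b z1 y = 0"
    unfolding z1_def using prZ[OF z0(1)] vsubspace_scale[OF Z] linear_scale[OF lin2] z0 pr0 by auto
  define \<zeta>' where "\<zeta>' = (\<lambda>x. if x = s then z1 else \<zeta> x - b (\<zeta> x) s *\<^sub>R z1)"
  have "\<forall>x\<in>insert s S. \<zeta>' x \<in> Z"
    unfolding \<zeta>'_def using z1(1) \<zeta>(1) Z by (auto intro: vsubspace_diff vsubspace_scale)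
  moreover have "\<forall>x\<in>insert s S. \<forall>y\<in>insert s S. b (\<zeta>' x) y = (if x = y then 1 else 0)"
    using insert.hyps(2) z1 \<zeta>(2) linear_diff[OF lin2] linear_scale[OF lin2] by (auto simp: \<zeta>'_def)
  ultimately show ?case by blast
qed

text \<open>
  Poincare duality will be used in this form: a family of functionals on \<open>W\<close> that depends linearly on
  a parameter is represented by elements of \<open>Z\<close> that depend linearly on the parameter.
\<close>

lemma dual_operator:
  fixes b :: "'v::real_vector \<Rightarrow> 'w::real_vector \<Rightarrow> real" and \<kappa> :: "'u::real_vector \<Rightarrow> 'w \<Rightarrow> real"
  assumes b: "bilinear b" and Z: "vsubspace Z" and S: "finite S" and W: "W \<subseteq> span S" "vsubspace W"
    and sep: "\<And>w. w \<in> W \<Longrightarrow> (\<And>z. z \<in> Z \<Longrightarrow> b z w = 0) \<Longrightarrow> w = 0"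
    and \<kappa>: "bilinear \<kappa>"
  obtains \<gamma> where "linear \<gamma>" "\<And>x. \<gamma> x \<in> Z" "\<And>x w. w \<in> W \<Longrightarrow> b (\<gamma> x) w = \<kappa> x w"
proof -
  obtain B where B: "B \<subseteq> W" "independent B" "W \<subseteq> span B"
    using real_vector.basis_exists by metis
  have "finite B" using real_vector.independent_span_bound[OF S B(2)] B(1) W by auto
  have spB: "span B = W" using B W(2) by (simp add: real_vector.span_minimal subset_antisym)
  have "\<exists>\<zeta>. (\<forall>x\<in>B. \<zeta> x \<in> Z) \<and> (\<forall>x\<in>B. \<forall>y\<in>B. b (\<zeta> x) y = (if x = y then 1 else 0))"
    by (rule dual_basis[OF b Z \<open>finite B\<close> B(2)]) (use sep spB in auto)
  then obtain \<zeta> where \<zeta>: "\<And>x. x\<in>B \<Longrightarrow> \<zeta> x \<in> Z" "\<And>x y. x \<in> B \<Longrightarrow> y \<in> B \<Longrightarrow> b (\<zeta> x) y = (if x = y then 1 else 0)"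
    by blast
  have lin1: "linear (b z)" for z using b by (simp add: bilinear_def)
  have lin2: "linear (\<lambda>z. b z w)" for w using b by (simp add: bilinear_def)
  have kin1: "linear (\<kappa> z)" for z using \<kappa> by (simp add: bilinear_def)
  have kin2: "linear (\<lambda>z. \<kappa> z w)" for w using \<kappa> by (simp add: bilinear_def)
  define \<gamma> where "\<gamma> = (\<lambda>x. \<Sum>s\<in>B. \<kappa> x s *\<^sub>R \<zeta> s)"
  show ?thesis
  proof (rule that[of \<gamma>])
    show "linear \<gamma>" unfolding \<gamma>_def
      by (rule linearI) (simp_all add: linear_add[OF kin2] linear_scale[OF kin2] scaleR_left_distrib sum.distrib scaleR_sum_right)
    show "\<gamma> x \<in> Z" for x unfolding \<gamma>_def using \<zeta>(1) Z by (intro vsubspace_sum vsubspace_scale)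
    fix x w assume w: "w \<in> W"
    have "b (\<gamma> x) y = \<kappa> x y" if "y \<in> B" for y
    proof -
      have "b (\<gamma> x) y = (\<Sum>s\<in>B. \<kappa> x s * b (\<zeta> s) y)"
        unfolding \<gamma>_def by (simp add: linear_sum[OF lin2] linear_scale[OF lin2])
      also have "\<dots> = (\<Sum>s\<in>B. if s = y then \<kappa> x s else 0)"
        by (rule sum.cong) (use \<zeta>(2) that in auto)
      finally show ?thesis using that \<open>finite B\<close> by simp
    qed
    then show "b (\<gamma> x) w = \<kappa> x w"
      using linear_eq_on[OF lin1 kin1, of w B "\<gamma> x" x] w spB by blast
  qed
qed

lemma bilinearI:
  assumes "\<And>x y z. f (x + y) z = f x z + f y z" "\<And>x y z. f x (y + z) = f x y + f x z"
    "\<And>c x y. f (c *\<^sub>R x) y = c *\<^sub>R f x y" "\<And>c x y. f x (c *\<^sub>R y) = c *\<^sub>R f x y"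
  shows "bilinear f"
  unfolding bilinear_def by (auto intro!: linearI simp: assms)

section \<open>Graded algebras inside a real vector space\<close>

text \<open>
  A differential graded commutative algebra given by graded pieces inside one real vector space, called
  a typed model when it represents a given DGCA. The
  operations are linear on the whole ambient space, so that the library of linear algebra applies to
  them directly, while the algebraic laws are required on the graded pieces only.
\<close>

locale gdga =
  fixes G :: "nat \<Rightarrow> 'v::real_vector set" and mu :: "nat \<Rightarrow> nat \<Rightarrow> 'v \<Rightarrow> 'v \<Rightarrow> 'v"
    and d :: "nat \<Rightarrow> 'v \<Rightarrow> 'v" and e :: 'v
  assumes G_subspace: "vsubspace (G i)"
    and mu_bilinear: "bilinear (mu i j)"
    and d_linear: "linear (d i)"
    and e_G: "e \<in> G 0"
    and mu_G: "x \<in> G i \<Longrightarrow> y \<in> G j \<Longrightarrow> mu i j x y \<in> G (i + j)"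
    and d_G: "x \<in> G i \<Longrightarrow> d i x \<in> G (Suc i)"
    and mu_assoc: "x \<in> G i \<Longrightarrow> y \<in> G j \<Longrightarrow> z \<in> G k \<Longrightarrow>
      mu (i + j) k (mu i j x y) z = mu i (j + k) x (mu j k y z)"
    and mu_e: "x \<in> G i \<Longrightarrow> mu 0 i e x = x"
    and mu_comm: "x \<in> G i \<Longrightarrow> y \<in> G j \<Longrightarrow> mu i j x y = (-1) ^ (i * j) *\<^sub>R mu j i y x"
    and d_d: "x \<in> G i \<Longrightarrow> d (Suc i) (d i x) = 0"
    and d_mu: "x \<in> G i \<Longrightarrow> y \<in> G j \<Longrightarrow>
      d (i + j) (mu i j x y) = mu (Suc i) j (d i x) y + (-1) ^ i *\<^sub>R mu i (Suc j) x (d j y)"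
begin

text \<open>
  The letters \<open>Z\<close> and \<open>X\<close> stand for cocycles and coboundaries.
\<close>

definition Z :: "nat \<Rightarrow> 'v set" where "Z i = {x \<in> G i. d i x = 0}"

definition X :: "nat \<Rightarrow> 'v set" where "X i = (case i of 0 \<Rightarrow> {0} | Suc j \<Rightarrow> d j ` G j)"

lemma mu_linear1: "linear (\<lambda>x. mu i j x y)" and mu_linear2: "linear (mu i j x)"
  using mu_bilinear by (auto simp: bilinear_def)

lemmas mu_add_left = linear_add[OF mu_linear1] and mu_add_right = linear_add[OF mu_linear2]
  and mu_diff_left = linear_diff[OF mu_linear1] and mu_diff_right = linear_diff[OF mu_linear2]
  and mu_scale_left = linear_scale[OF mu_linear1] and mu_scale_right = linear_scale[OF mu_linear2]
  and mu_0_left = linear_0[OF mu_linear1] and mu_0_right = linear_0[OF mu_linear2]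
  and mu_sum_left = linear_sum[OF mu_linear1] and mu_sum_right = linear_sum[OF mu_linear2]
  and d_add = linear_add[OF d_linear] and d_diff = linear_diff[OF d_linear]
  and d_scale = linear_scale[OF d_linear] and d_0 = linear_0[OF d_linear]

lemma mu_e_right: "x \<in> G i \<Longrightarrow> mu i 0 x e = x"
  using mu_comm[of x i e 0] e_G mu_e by simp

lemma d_e: "d 0 e = 0"
  using d_mu[OF e_G e_G] mu_e[OF e_G] mu_e[OF d_G[OF e_G]] mu_e_right[OF d_G[OF e_G]] by simp

lemma Z_subspace: "vsubspace (Z i)"
  using G_subspace by (auto simp: real_vector.subspace_def Z_def d_add d_scale d_0)

lemma X_subspace: "vsubspace (X i)"
proof (cases i)
  case 0 then show ?thesis by (simp add: X_def real_vector.subspace_def)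
next
  case (Suc j)
  then show ?thesis using linear_subspace_image[OF d_linear G_subspace] by (simp add: X_def)
qed

lemma X_Z: "X i \<subseteq> Z i"
  by (auto simp: X_def Z_def d_G d_d d_0 vsubspace_0[OF G_subspace] split: nat.splits)

lemma X_Suc: "x \<in> X (Suc i) \<longleftrightarrow> (\<exists>y\<in>G i. x = d i y)"
  by (auto simp: X_def)

lemma d_X: "x \<in> G i \<Longrightarrow> d i x \<in> X (Suc i)"
  by (auto simp: X_def)

lemma Z_G: "x \<in> Z i \<Longrightarrow> x \<in> G i" and Z_d: "x \<in> Z i \<Longrightarrow> d i x = 0"
  by (auto simp: Z_def)

lemma X_G: "x \<in> X i \<Longrightarrow> x \<in> G i"
  using X_Z Z_G by blast

lemma e_Z: "e \<in> Z 0"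
  by (simp add: Z_def e_G d_e)

lemma mu_Z: "x \<in> Z i \<Longrightarrow> y \<in> Z j \<Longrightarrow> mu i j x y \<in> Z (i + j)"
  by (auto simp: Z_def mu_G d_mu mu_0_left mu_0_right)

lemma mu_X_left: assumes "x \<in> X i" "y \<in> Z j" shows "mu i j x y \<in> X (i + j)"
proof (cases i)
  case 0 then show ?thesis using assms vsubspace_0[OF X_subspace] by (simp add: X_def mu_0_left)
next
  case (Suc k)
  then obtain x' where x': "x' \<in> G k" "x = d k x'" using assms by (auto simp: X_Suc)
  have "d (k + j) (mu k j x' y) = mu i j x y"
    using d_mu[OF x'(1) Z_G[OF assms(2)]] Suc x' by (simp add: Z_d[OF assms(2)] mu_0_right)
  then show ?thesis using d_X[OF mu_G[OF x'(1) Z_G[OF assms(2)]]] Suc by simp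
qed

lemma mu_X_right: assumes "x \<in> Z i" "y \<in> X j" shows "mu i j x y \<in> X (i + j)"
proof -
  have "mu i j x y = (-1) ^ (i * j) *\<^sub>R mu j i y x"
    using assms X_G Z_G by (blast intro: mu_comm)
  then show ?thesis using mu_X_left[OF assms(2,1)] vsubspace_scale[OF X_subspace] by (simp add: add.commute)
qed

end

lemma gdga_sub:
  assumes "gdga G mu d e" and "\<And>i. vsubspace (M i)" and M: "\<And>i x. x \<in> M i \<Longrightarrow> x \<in> G i"
    and "e \<in> M 0" and "\<And>i j x y. x \<in> M i \<Longrightarrow> y \<in> M j \<Longrightarrow> mu i j x y \<in> M (i + j)"
    and "\<And>i x. x \<in> M i \<Longrightarrow> d i x \<in> M (Suc i)"
  shows "gdga M mu d e"
proof -
  interpret gdga G mu d e by fact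
  show ?thesis
  proof (rule gdga.intro)
    show "mu i j x y = (-1) ^ (i * j) *\<^sub>R mu j i y x" if "x \<in> M i" "y \<in> M j" for x y i j
      by (rule mu_comm) (use M that in auto)
  qed (use assms(2-) mu_bilinear d_linear in \<open>simp_all add: mu_assoc mu_e d_d d_mu\<close>)
qed

section \<open>The algebra of labels\<close>

text \<open>
  Labels are polynomials in one variable over the reals. For even \<open>r\<close> the label algebra \<open>T\<close> has a copy
  of all labels in each degree \<open>k r\<close> and in each degree \<open>k r - 1\<close> with \<open>k > 0\<close>. It is the tensor
  product of the labels with \<open>\<real>[x] \<oplus> \<epsilon> \<real>[x]\<close>, where \<open>x\<^sup>k\<close> has degree \<open>k r\<close>, \<open>\<epsilon> x\<^sup>k\<close> has degree
  \<open>k r - 1\<close>, \<open>\<epsilon>\<^sup>2 = 0\<close> and \<open>d (\<epsilon> x\<^sup>k) = x\<^sup>k\<close>. The structure constants of its product and differential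
  are \<open>tsc\<close> and \<open>dsc\<close>. For odd \<open>r\<close> the label algebra is zero, since \<open>x\<close> would be an odd element with
  nonzero square.
\<close>

definition tsc :: "nat \<Rightarrow> nat \<Rightarrow> nat \<Rightarrow> real" where
  "tsc r i j = (if r dvd i \<and> r dvd j \<or> r dvd Suc i \<and> r dvd j \<or> r dvd i \<and> r dvd Suc j then 1 else 0)"

definition dsc :: "nat \<Rightarrow> nat \<Rightarrow> real" where
  "dsc r i = (if r dvd Suc i then 1 else 0)"

definition FT :: "nat \<Rightarrow> nat \<Rightarrow> (nat \<Rightarrow>\<^sub>0 real) set" where
  "FT r i = (if even r \<and> (r dvd i \<or> r dvd Suc i) then UNIV else {0})"

lemma dvd_Suc_excl: assumes "2 \<le> r" "r dvd i" shows "\<not> r dvd Suc i"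
  using assms dvd_add_right_iff[of r i 1] by auto

lemma tsc_assoc: assumes r: "2 \<le> r"
  shows "tsc r i j * tsc r (i + j) k = tsc r j k * tsc r i (j + k)"
proof -
  have a: "r dvd x \<Longrightarrow> r dvd (x + y) \<longleftrightarrow> r dvd y" "r dvd x \<Longrightarrow> r dvd (y + x) \<longleftrightarrow> r dvd y" for x y
    by (simp_all add: dvd_add_right_iff dvd_add_left_iff)
  have b: "r dvd Suc x \<Longrightarrow> r dvd Suc (x + y) \<longleftrightarrow> r dvd y" "r dvd Suc x \<Longrightarrow> r dvd Suc (y + x) \<longleftrightarrow> r dvd y"
    "r dvd x \<Longrightarrow> r dvd Suc (x + y) \<longleftrightarrow> r dvd Suc y" "r dvd x \<Longrightarrow> r dvd Suc (y + x) \<longleftrightarrow> r dvd Suc y" for x y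
    using a[of "Suc x" y] a[of x "Suc y"] by (simp_all add: add.commute)
  have c: "r dvd Suc x \<Longrightarrow> \<not> r dvd x" for x using dvd_Suc_excl[OF r, of x] by blast
  show ?thesis using c[of i] c[of j] c[of k] unfolding tsc_def
    by (cases "r dvd i"; cases "r dvd Suc i"; cases "r dvd j"; cases "r dvd Suc j"; cases "r dvd k"; cases "r dvd Suc k")
      (simp_all add: a b)
qed

lemma tsc_comm: "tsc r i j = tsc r j i"
  by (auto simp: tsc_def)

lemma tsc_even: "even r \<Longrightarrow> tsc r i j \<noteq> 0 \<Longrightarrow> even (i * j)"
  by (auto simp: tsc_def split: if_splits)

lemma dsc_tsc: assumes r: "2 \<le> r" "even r"
  shows "dsc r (i + j) * tsc r i j = dsc r i * tsc r (Suc i) j + (-1) ^ i * (dsc r j * tsc r i (Suc j))"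
proof -
  have a: "r dvd x \<Longrightarrow> r dvd (x + y) \<longleftrightarrow> r dvd y" "r dvd x \<Longrightarrow> r dvd (y + x) \<longleftrightarrow> r dvd y" for x y
    by (simp_all add: dvd_add_right_iff dvd_add_left_iff)
  have b: "r dvd Suc x \<Longrightarrow> r dvd Suc (x + y) \<longleftrightarrow> r dvd y" "r dvd Suc x \<Longrightarrow> r dvd Suc (y + x) \<longleftrightarrow> r dvd y"
    "r dvd x \<Longrightarrow> r dvd Suc (x + y) \<longleftrightarrow> r dvd Suc y" "r dvd x \<Longrightarrow> r dvd Suc (y + x) \<longleftrightarrow> r dvd Suc y" for x y
    using a[of "Suc x" y] a[of x "Suc y"] by (simp_all add: add.commute)
  have c: "r dvd Suc x \<Longrightarrow> \<not> r dvd x" "r dvd Suc x \<Longrightarrow> \<not> r dvd Suc (Suc x)" for x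
    using dvd_Suc_excl[OF r(1)] by blast+
  have d: "r dvd x \<Longrightarrow> even x" "r dvd Suc x \<Longrightarrow> odd x" for x
    using dvd_trans[OF r(2), of x] dvd_trans[OF r(2), of "Suc x"] by auto
  show ?thesis using d[of i] c[of i] c[of j] unfolding tsc_def dsc_def
    by (cases "r dvd i"; cases "r dvd Suc i"; cases "r dvd j"; cases "r dvd Suc j")
      (simp_all add: a b)
qed

lemma FT_subspace: "vsubspace (FT r i)"
  by (auto simp: FT_def real_vector.subspace_def)

lemma pm_lookup_scaleR [simp]: "Poly_Mapping.lookup (c *\<^sub>R (x :: 'k \<Rightarrow>\<^sub>0 real)) k = c * Poly_Mapping.lookup x k"
proof -
  have "finite {k. c * Poly_Mapping.lookup x k \<noteq> 0}"
    by (rule finite_subset[OF _ finite_lookup[of x]]) auto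
  then show ?thesis by (simp add: scaleR_poly_mapping_def Abs_poly_mapping_inverse)
qed

lemma pm_scaleR_single: "(c *\<^sub>R (x :: nat \<Rightarrow>\<^sub>0 real)) = Poly_Mapping.single 0 c * x"
  by (simp add: mult_map_scale_conv_mult[symmetric] poly_mapping_eqI Poly_Mapping.map.rep_eq when_def)

lemma pm_scale_left: "(c *\<^sub>R x) * y = c *\<^sub>R (x * (y :: nat \<Rightarrow>\<^sub>0 real))"
  by (simp add: pm_scaleR_single mult.assoc)

lemma pm_scale_right: "x * (c *\<^sub>R y) = c *\<^sub>R (x * (y :: nat \<Rightarrow>\<^sub>0 real))"
  by (simp add: pm_scaleR_single mult.left_commute)

text \<open>
  Product, differential and unit of the direct product of an algebra with the label algebra.
\<close>

definition pmu where
  "pmu r mu i j p q = (mu i j (fst p) (fst q), tsc r i j *\<^sub>R (snd p * snd q :: nat \<Rightarrow>\<^sub>0 real))"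

definition pd where
  "pd r d i p = (d i (fst p), dsc r i *\<^sub>R (snd p :: nat \<Rightarrow>\<^sub>0 real))"

definition punit :: "nat \<Rightarrow> nat \<Rightarrow>\<^sub>0 real" where "punit r = (if even r then 1 else 0)"

lemma gdga_labelled:
  assumes "gdga G mu d e" and r: "2 \<le> r"
  shows "gdga (\<lambda>i. G i \<times> FT r i) (pmu r mu) (pd r d) (e, punit r)"
proof -
  interpret gdga G mu d e by fact
  have FT0: "odd r \<Longrightarrow> f \<in> FT r i \<Longrightarrow> f = 0" for f i by (simp add: FT_def)
  show ?thesis
  proof (rule gdga.intro)
    show "vsubspace (G i \<times> FT r i)" for i
      using G_subspace[of i] FT_subspace[of r i] by (auto simp: real_vector.subspace_def zero_prod_def)
    show "bilinear (pmu r mu i j)" for i j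
      by (rule bilinearI) (simp_all add: pmu_def mu_add_left mu_add_right mu_scale_left mu_scale_right
          distrib_left distrib_right scaleR_right_distrib pm_scale_left pm_scale_right scaleR_left_commute)
    show "linear (pd r d i)" for i
      by (rule linearI) (simp_all add: pd_def d_add d_scale scaleR_right_distrib scaleR_left_commute)
    show "(e, punit r) \<in> G 0 \<times> FT r 0" by (auto simp: e_G FT_def punit_def)
  next
    fix x y i j assume xy: "x \<in> G i \<times> FT r i" "y \<in> G j \<times> FT r j"
    have a: "r dvd x \<Longrightarrow> r dvd (x + y) \<longleftrightarrow> r dvd y" "r dvd x \<Longrightarrow> r dvd (y + x) \<longleftrightarrow> r dvd y" for x y
      by (simp_all add: dvd_add_right_iff dvd_add_left_iff)
    have b: "r dvd Suc x \<Longrightarrow> r dvd Suc (x + y) \<longleftrightarrow> r dvd y" "r dvd Suc x \<Longrightarrow> r dvd Suc (y + x) \<longleftrightarrow> r dvd y" for x y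
      using a[of "Suc x" y] by (simp_all add: add.commute)
    have "tsc r i j *\<^sub>R (snd x * snd y) \<in> FT r (i + j)"
      using xy by (auto simp: FT_def tsc_def a b split: if_splits)
    then show "pmu r mu i j x y \<in> G (i + j) \<times> FT r (i + j)"
      using xy by (auto simp: pmu_def mu_G)
    have "tsc r i j *\<^sub>R (snd x * snd y) = ((-1) ^ (i * j) * tsc r j i) *\<^sub>R (snd y * snd x)"
    proof (cases "even r \<and> tsc r i j \<noteq> 0")
      case True then show ?thesis using tsc_even[of r i j] by (simp add: tsc_comm mult.commute)
    next
      case False
      then show ?thesis using xy FT0[of "snd x" i] by (cases "odd r") (auto simp: tsc_comm[of r j i])
    qed
    then show "pmu r mu i j x y = (- 1) ^ (i * j) *\<^sub>R pmu r mu j i y x"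
      using xy mu_comm[of "fst x" i "fst y" j] by (auto simp: pmu_def)
    have "dsc r (i + j) *\<^sub>R tsc r i j *\<^sub>R (snd x * snd y)
      = tsc r (Suc i) j *\<^sub>R (dsc r i *\<^sub>R snd x * snd y) + (-1) ^ i *\<^sub>R tsc r i (Suc j) *\<^sub>R (snd x * dsc r j *\<^sub>R snd y)"
    proof (cases "even r")
      case True
      show ?thesis unfolding scaleR_scaleR dsc_tsc[OF r True] scaleR_left_distrib pm_scale_left pm_scale_right
        by (simp add: mult_ac)
    qed (use xy FT0[of "snd x" i] FT0[of "snd y" j] in auto)
    then show "pd r d (i + j) (pmu r mu i j x y) =
       pmu r mu (Suc i) j (pd r d i x) y + (- 1) ^ i *\<^sub>R pmu r mu i (Suc j) x (pd r d j y)"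
      using xy d_mu[of "fst x" i "fst y" j] by (auto simp: pmu_def pd_def)
  next
    fix x i assume x: "x \<in> G i \<times> FT r i"
    show "pd r d i x \<in> G (Suc i) \<times> FT r (Suc i)"
      using x by (auto simp: pd_def d_G FT_def dsc_def split: if_splits)
    show "pmu r mu 0 i (e, punit r) x = x"
      using x by (auto simp: pmu_def mu_e tsc_def punit_def FT_def split: if_splits)
    show "pd r d (Suc i) (pd r d i x) = 0"
      using x dvd_Suc_excl[OF r, of "Suc i"] by (auto simp: pd_def d_d dsc_def zero_prod_def)
  next
    fix x y z i j k assume "x \<in> G i \<times> FT r i" "y \<in> G j \<times> FT r j" "z \<in> G k \<times> FT r k"
    moreover have "tsc r (i + j) k *\<^sub>R (tsc r i j *\<^sub>R (f * g) * h) = tsc r i (j + k) *\<^sub>R (f * tsc r j k *\<^sub>R (g * h))" for f g h :: "nat \<Rightarrow>\<^sub>0 real"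
    proof -
      have "tsc r (i + j) k *\<^sub>R (tsc r i j *\<^sub>R (f * g) * h) = (tsc r i j * tsc r (i + j) k) *\<^sub>R (f * (g * h))"
        by (simp add: pm_scale_left pm_scale_right mult_ac)
      then show ?thesis by (simp add: tsc_assoc[OF r] pm_scale_right mult_ac)
    qed
    ultimately show "pmu r mu (i + j) k (pmu r mu i j x y) z = pmu r mu i (j + k) x (pmu r mu j k y z)"
      by (auto simp: pmu_def mu_assoc)
  qed
qed

section \<open>Orthogonal bases and quartic functionals\<close>

lemma span_exchange:
  fixes S :: "'v::real_vector set"
  assumes "finite S" "v \<in> span S" "v \<noteq> 0"
  shows "\<exists>t\<in>S. t \<in> span (insert v (S - {t}))"
  using assms
proof (induction S rule: finite_induct)
  case (insert s S)
  show ?case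
  proof (cases "v \<in> span S")
    case True
    then obtain t where t: "t \<in> S" "t \<in> span (insert v (S - {t}))" using insert by blast
    have "span (insert v (S - {t})) \<subseteq> span (insert v (insert s S - {t}))"
      by (rule real_vector.span_mono) auto
    then show ?thesis using t by blast
  next
    case False
    then have "s \<in> span (insert v S)" using insert.prems real_vector.in_span_insert by blast
    moreover have "insert s S - {s} = S" using insert.hyps by auto
    ultimately show ?thesis by auto
  qed
qed simp

lemma span_exchange':
  fixes S :: "'v::real_vector set"
  assumes "finite S" "v \<in> span S" "v \<noteq> 0"
  obtains t where "t \<in> S" "span (insert v (S - {t})) = span S"
proof -
  obtain t where t: "t \<in> S" "t \<in> span (insert v (S - {t}))"
    using span_exchange[OF assms] by blast
  have "insert v (S - {t}) \<subseteq> span S" using assms(2) by (auto intro: real_vector.span_base)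
  moreover have "x \<in> span (insert v (S - {t}))" if "x \<in> S" for x
    using t(2) that by (cases "x = t") (auto intro: real_vector.span_base)
  ultimately have "span (insert v (S - {t})) = span S"
    unfolding real_vector.span_eq by blast
  then show ?thesis using t(1) that by blast
qed

text \<open>
  Padding with zeros lets later computations treat all dimensions up to \<open>k\<close> at once.
\<close>

lemma enumerate_span:
  fixes S :: "'v::real_vector set"
  assumes "finite S" "card S \<le> k"
  obtains a :: "nat \<Rightarrow> 'v" where "span (a ` {..<k}) = span S"
proof -
  obtain f where f: "bij_betw f {0..<card S} S" using ex_bij_betw_nat_finite[OF assms(1)] by blast
  define a where "a = (\<lambda>i. if i < card S then f i else 0)"
  have "S \<subseteq> a ` {..<k}"
  proof
    fix x assume "x \<in> S"
    then obtain i where i: "i < card S" "x = f i" using f by (force simp: bij_betw_def)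
    then have "x = a i" "i < k" using assms by (auto simp: a_def)
    then show "x \<in> a ` {..<k}" by blast
  qed
  moreover have "a ` {..<k} \<subseteq> span S"
    using f by (force simp: a_def bij_betw_def intro: real_vector.span_base real_vector.span_zero)
  ultimately have "span (a ` {..<k}) = span S" unfolding real_vector.span_eq
    by (auto intro: real_vector.span_base)
  then show ?thesis using that by blast
qed

text \<open>
  Diagonalisation of a symmetric form, stated with a spanning family of exactly \<open>k\<close> vectors. If the
  form vanishes on the diagonal it is zero by polarisation; otherwise split off a vector \<open>v\<close> with
  \<open>q v v \<noteq> 0\<close>, exchange it for an element of the spanning set and continue in its orthogonal
  complement.
\<close>

lemma orthogonal_basis:
  fixes q :: "'v::real_vector \<Rightarrow> 'v \<Rightarrow> real"
  assumes q: "bilinear q"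
  shows "finite S \<Longrightarrow> card S \<le> k \<Longrightarrow> span S = W \<Longrightarrow> (\<And>x y. x \<in> W \<Longrightarrow> y \<in> W \<Longrightarrow> q x y = q y x) \<Longrightarrow>
    \<exists>a :: nat \<Rightarrow> 'v. W = span (a ` {..<k}) \<and> (\<forall>i<k. \<forall>j<k. i \<noteq> j \<longrightarrow> q (a i) (a j) = 0)"
proof (induction k arbitrary: S W)
  case 0
  then show ?case by (intro exI[of _ "\<lambda>_. 0"]) auto
next
  case (Suc k)
  note qs = bilinear_ladd[OF q] bilinear_radd[OF q] bilinear_lmul[OF q] bilinear_rmul[OF q]
    bilinear_lsub[OF q] bilinear_rsub[OF q]
  have W: "vsubspace W" using Suc.prems(3) by auto
  show ?case
  proof (cases "\<forall>x\<in>W. q x x = 0")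
    case True
    have "q x y = 0" if "x \<in> W" "y \<in> W" for x y
    proof -
      have "q (x + y) (x + y) = 0" using True vsubspace_add[OF W that] by blast
      then show ?thesis using True that Suc.prems(4)[OF that] by (simp add: qs)
    qed
    moreover obtain a where a: "span (a ` {..<Suc k}) = W" using enumerate_span[OF Suc.prems(1,2)] Suc.prems(3) by metis
    moreover have "a i \<in> W" if "i < Suc k" for i using a that by (metis imageI lessThan_iff real_vector.span_base)
    ultimately show ?thesis by (intro exI[of _ a]) auto
  next
    case False
    then obtain v where v: "v \<in> W" "q v v \<noteq> 0" by blast
    have "v \<noteq> 0" using v(2) bilinear_lzero[OF q] by auto
    then obtain t where t: "t \<in> S" "span (insert v (S - {t})) = W"
      using span_exchange'[OF Suc.prems(1), of v] Suc.prems(3) v(1) by metis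
    define P where "P = (\<lambda>w. w - (q v w / q v v) *\<^sub>R v)"
    have P: "linear P" unfolding P_def
      by (rule linearI) (simp_all add: qs scaleR_left_distrib add_divide_distrib scaleR_right_diff_distrib)
    have Pv: "P v = 0" using v(2) by (simp add: P_def)
    have qP: "q v (P w) = 0" for w using v(2) by (simp add: P_def qs)
    have PW: "P w \<in> W" if "w \<in> W" for w unfolding P_def using that v W by (intro vsubspace_diff vsubspace_scale)
    define W' where "W' = span (P ` (S - {t}))"
    have W'W: "W' \<subseteq> W" unfolding W'_def
      by (rule real_vector.span_minimal[OF _ W]) (use PW Suc.prems(3) in \<open>auto intro: real_vector.span_base\<close>)
    have W'P: "P w \<in> W'" if "w \<in> W" for w
    proof -
      have "P ` span (insert v (S - {t})) = span (P ` insert v (S - {t}))"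
        by (rule linear_span_image[OF P, symmetric])
      moreover have "span (P ` insert v (S - {t})) = W'" by (simp add: W'_def Pv real_vector.span_insert_0)
      ultimately show ?thesis using t(2) that by blast
    qed
    have qW': "q v w = 0" if "w \<in> W'" for w
    proof -
      have "linear (q v)" using q by (simp add: bilinear_def)
      then have "q v w = (\<lambda>_. 0) w"
        by (rule linear_eq_on[of "q v" "\<lambda>_. 0" w "P ` (S - {t})"]) (use that qP in \<open>auto simp: W'_def linear_zero\<close>)
      then show ?thesis by simp
    qed
    have "card (P ` (S - {t})) \<le> k"
      using card_image_le[of "S - {t}" P] Suc.prems(1,2) t(1) by (simp add: card_Diff_singleton)
    then obtain a where a: "W' = span (a ` {..<k})" "\<forall>i<k. \<forall>j<k. i \<noteq> j \<longrightarrow> q (a i) (a j) = 0"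
      using Suc.IH[of "P ` (S - {t})" W'] Suc.prems(1,4) W'W by (auto simp: W'_def[symmetric])
    define a' where "a' = (\<lambda>i. if i = k then v else a i)"
    have im: "a' ` {..<Suc k} = insert v (a ` {..<k})"
      by (auto simp: a'_def lessThan_Suc image_def)
    have "W = span (insert v (a ` {..<k}))"
    proof
      have "insert v (a ` {..<k}) \<subseteq> W" using v W'W a(1) by (auto intro: real_vector.span_base)
      then show "span (insert v (a ` {..<k})) \<subseteq> W" by (rule real_vector.span_minimal[OF _ W])
      show "W \<subseteq> span (insert v (a ` {..<k}))"
      proof
        fix w assume "w \<in> W"
        then have "P w \<in> span (a ` {..<k})" using W'P a(1) by blast
        then show "w \<in> span (insert v (a ` {..<k}))"
          unfolding real_vector.span_insert P_def by blast
      qed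
    qed
    moreover have "q (a' i) (a' j) = 0" if "i < Suc k" "j < Suc k" "i \<noteq> j" for i j
    proof -
      have av: "q v (a i) = 0" "q (a i) v = 0" if "i < k" for i
      proof -
        have "a i \<in> W'" using that a(1) by (auto intro: real_vector.span_base)
        then show "q v (a i) = 0" "q (a i) v = 0" using qW' Suc.prems(4)[of "a i" v] v(1) W'W by auto
      qed
      show ?thesis using that a(2) av by (auto simp: a'_def less_Suc_eq)
    qed
    ultimately show ?thesis using im by (intro exI[of _ a']) auto
  qed
qed

text \<open>
  Polynomials in three variables of degree at most four are encoded in one variable by substituting
  the powers \<open>1\<close>, \<open>5\<close> and \<open>25\<close>: then distinct monomials of degree at most four have distinct exponents.
  The exponents in \<open>quad\<close> are those of the six quadratic monomials.
\<close>

abbreviation mon :: "nat \<Rightarrow> nat \<Rightarrow>\<^sub>0 real" where "mon k \<equiv> Poly_Mapping.single k 1"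

definition quad :: "real \<Rightarrow> real \<Rightarrow> real \<Rightarrow> real \<Rightarrow> real \<Rightarrow> real \<Rightarrow> nat \<Rightarrow>\<^sub>0 real" where
  "quad c00 c11 c22 c01 c02 c12 = c00 *\<^sub>R mon 2 + c11 *\<^sub>R mon 10 + c22 *\<^sub>R mon 50
     + c01 *\<^sub>R mon 6 + c02 *\<^sub>R mon 26 + c12 *\<^sub>R mon 30"

text \<open>
  The central algebraic fact. A symmetric bilinear form \<open>f\<close> on ternary quadratic forms is given by a
  functional on quartics exactly if it satisfies six equations, one for each component of a curvature
  tensor in dimension three. On the kernel of \<open>\<ell> = q0 c00 + q1 c11 + q2 c22\<close> the form \<open>f\<close> does not
  change if a symmetrised product of \<open>\<ell>\<close> with a linear form on quadratics is added. The six
  coefficients of that linear form are determined by the six equations, because no \<open>q\<^sub>i\<close> vanishes.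

  The last conclusion says that \<open>\<Gamma>\<close> can moreover be taken so that its pairing with quadratics realises
  every linear functional on them; the exponents of the multipliers \<open>\<tau> y\<close> are so large that only
  one further value of \<open>\<Gamma>\<close> matters.
\<close>

lemma quartic_functional:
  fixes f :: "(nat \<Rightarrow>\<^sub>0 real) \<Rightarrow> (nat \<Rightarrow>\<^sub>0 real) \<Rightarrow> real"
  assumes f: "bilinear f" and sym: "\<And>x y. f x y = f y x" and q: "q0 \<noteq> 0" "q1 \<noteq> 0" "q2 \<noteq> 0"
  obtains \<Gamma> :: "(nat \<Rightarrow>\<^sub>0 real) \<Rightarrow> real" where "linear \<Gamma>"
    "\<And>c00 c11 c22 c01 c02 c12 e00 e11 e22 e01 e02 e12.
       q0 * c00 + q1 * c11 + q2 * c22 = 0 \<Longrightarrow> q0 * e00 + q1 * e11 + q2 * e22 = 0 \<Longrightarrow>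
       \<Gamma> (quad c00 c11 c22 c01 c02 c12 * quad e00 e11 e22 e01 e02 e12) =
       f (quad c00 c11 c22 c01 c02 c12) (quad e00 e11 e22 e01 e02 e12)"
    "\<And>\<kappa> :: (nat \<Rightarrow>\<^sub>0 real) \<Rightarrow> 'v::real_vector \<Rightarrow> real. bilinear \<kappa> \<Longrightarrow>
       \<exists>\<tau>. linear \<tau> \<and> (\<forall>c00 c11 c22 c01 c02 c12 y.
          \<Gamma> (quad c00 c11 c22 c01 c02 c12 * \<tau> y) = \<kappa> (quad c00 c11 c22 c01 c02 c12) y)"
proof -
  define F where "F = (\<lambda>i j. f (mon i) (mon j))"
  have Ff: "f (mon i) (mon j) = F i j" for i j by (simp add: F_def)
  have Fsym: "F 6 2 = F 2 6" "F 6 10 = F 10 6" "F 6 50 = F 50 6" "F 26 2 = F 2 26" "F 26 10 = F 10 26" "F 26 50 = F 50 26"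
    "F 30 2 = F 2 30" "F 30 10 = F 10 30" "F 30 50 = F 50 30" "F 10 2 = F 2 10" "F 50 2 = F 2 50" "F 50 10 = F 10 50"
    "F 26 6 = F 6 26" "F 30 6 = F 6 30" "F 30 26 = F 26 30"
    using sym by (auto simp: F_def)
  \<comment> \<open>The off-diagonal coefficients of the linear form, each from one of the three equations that
    compare the two ways of writing a monomial such as \<open>x\<^sub>0 x\<^sub>1 x\<^sub>2\<^sup>2\<close>.\<close>
  define s01 where "s01 = (F 26 30 - F 50 6) / q2"
  define s02 where "s02 = (F 6 30 - F 10 26) / q1"
  define s12 where "s12 = (F 6 26 - F 2 30) / q0"
  have s: "F 26 30 = F 50 6 + s01 * q2" "F 6 30 = F 10 26 + s02 * q1" "F 6 26 = F 2 30 + s12 * q0"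
    using q by (simp_all add: s01_def s02_def s12_def)
  \<comment> \<open>The diagonal coefficients solve the equations for \<open>x\<^sub>i\<^sup>2 x\<^sub>j\<^sup>2\<close>, which prescribe
    the pairwise sums \<open>u\<close> of \<open>t0 / q0\<close>, \<open>t1 / q1\<close> and \<open>t2 / q2\<close>.\<close>
  define u01 where "u01 = 2 * (F 6 6 - F 2 10) / (q0 * q1)"
  define u02 where "u02 = 2 * (F 26 26 - F 2 50) / (q0 * q2)"
  define u12 where "u12 = 2 * (F 30 30 - F 10 50) / (q1 * q2)"
  define t0 where "t0 = q0 * (u01 + u02 - u12) / 2"
  define t1 where "t1 = q1 * (u01 + u12 - u02) / 2"
  define t2 where "t2 = q2 * (u02 + u12 - u01) / 2"
  have "(q0 * t1 + q1 * t0) / 2 = q0 * q1 * u01 / 2" "(q0 * t2 + q2 * t0) / 2 = q0 * q2 * u02 / 2"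
    "(q1 * t2 + q2 * t1) / 2 = q1 * q2 * u12 / 2"
    by (simp_all add: t0_def t1_def t2_def field_simps)
  moreover have "q0 * q1 * u01 / 2 = F 6 6 - F 2 10" "q0 * q2 * u02 / 2 = F 26 26 - F 2 50" "q1 * q2 * u12 / 2 = F 30 30 - F 10 50"
    using q by (simp_all add: u01_def u02_def u12_def)
  ultimately have t: "F 6 6 = F 2 10 + (q0 * t1 + q1 * t0) / 2" "F 26 26 = F 2 50 + (q0 * t2 + q2 * t0) / 2"
    "F 30 30 = F 10 50 + (q1 * t2 + q2 * t1) / 2"
    by (linarith, linarith, linarith)
  \<comment> \<open>The values of the functional on the fifteen quartic monomials. The exponent \<open>1000\<close> is far from
    all of them; its value is what the multipliers \<open>\<tau> y\<close> use.\<close>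
  define g :: "(nat \<times> real) list" where "g = [(4, F 2 2 + q0 * t0), (20, F 10 10 + q1 * t1), (100, F 50 50 + q2 * t2),
     (12, F 6 6), (52, F 26 26), (60, F 30 30), (8, F 2 6 + s01 * q0), (16, F 10 6 + s01 * q1), (56, F 26 30),
     (28, F 2 26 + s02 * q0), (76, F 50 26 + s02 * q2), (36, F 6 30), (40, F 10 30 + s12 * q1), (80, F 50 30 + s12 * q2),
     (32, F 6 26), (1000, 1)]"
  define \<Gamma> where "\<Gamma> = (\<lambda>p :: nat \<Rightarrow>\<^sub>0 real. \<Sum>(k, x)\<leftarrow>g. x * Poly_Mapping.lookup p k)"
  have lin: "linear \<Gamma>"
    by (rule linearI) (simp_all add: \<Gamma>_def g_def lookup_add algebra_simps)
  have \<Gamma>s: "\<Gamma> (mon k) = (\<Sum>(l, x)\<leftarrow>g. if l = k then x else 0)" for k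
    by (simp add: \<Gamma>_def g_def lookup_single when_def)
  note \<Gamma>l = linear_add[OF lin] linear_scale[OF lin]
  note fl = bilinear_ladd[OF f] bilinear_radd[OF f] bilinear_lmul[OF f] bilinear_rmul[OF f]
  note prod = distrib_left distrib_right pm_scale_left pm_scale_right mult_single
  show ?thesis
  proof (rule that[OF lin])
    fix c00 c11 c22 c01 c02 c12 e00 e11 e22 e01 e02 e12 :: real
    assume c: "q0 * c00 + q1 * c11 + q2 * c22 = 0" and e: "q0 * e00 + q1 * e11 + q2 * e22 = 0"
    have 1: "f (quad c00 c11 c22 c01 c02 c12) (quad e00 e11 e22 e01 e02 e12) =
      c00 * e00 * F 2 2 + c11 * e11 * F 10 10 + c22 * e22 * F 50 50
      + c01 * e01 * F 6 6 + c02 * e02 * F 26 26 + c12 * e12 * F 30 30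
      + (c00 * e11 + c11 * e00) * F 2 10 + (c00 * e22 + c22 * e00) * F 2 50 + (c11 * e22 + c22 * e11) * F 10 50
      + (c01 * e00 + c00 * e01) * F 2 6 + (c01 * e11 + c11 * e01) * F 10 6 + (c01 * e22 + c22 * e01) * F 50 6
      + (c02 * e00 + c00 * e02) * F 2 26 + (c02 * e11 + c11 * e02) * F 10 26 + (c02 * e22 + c22 * e02) * F 50 26
      + (c12 * e00 + c00 * e12) * F 2 30 + (c12 * e11 + c11 * e12) * F 10 30 + (c12 * e22 + c22 * e12) * F 50 30
      + (c01 * e02 + c02 * e01) * F 6 26 + (c01 * e12 + c12 * e01) * F 6 30 + (c02 * e12 + c12 * e02) * F 26 30"
      unfolding quad_def fl Ff Fsym real_scaleR_def by (simp add: algebra_simps)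
    have 2: "\<Gamma> (quad c00 c11 c22 c01 c02 c12 * quad e00 e11 e22 e01 e02 e12) =
      c00 * e00 * (F 2 2 + q0 * t0) + c11 * e11 * (F 10 10 + q1 * t1) + c22 * e22 * (F 50 50 + q2 * t2)
      + c01 * e01 * F 6 6 + c02 * e02 * F 26 26 + c12 * e12 * F 30 30
      + (c00 * e11 + c11 * e00) * F 6 6 + (c00 * e22 + c22 * e00) * F 26 26 + (c11 * e22 + c22 * e11) * F 30 30
      + (c01 * e00 + c00 * e01) * (F 2 6 + s01 * q0) + (c01 * e11 + c11 * e01) * (F 10 6 + s01 * q1) + (c01 * e22 + c22 * e01) * F 26 30
      + (c02 * e00 + c00 * e02) * (F 2 26 + s02 * q0) + (c02 * e11 + c11 * e02) * F 6 30 + (c02 * e22 + c22 * e02) * (F 50 26 + s02 * q2)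
      + (c12 * e00 + c00 * e12) * F 6 26 + (c12 * e11 + c11 * e12) * (F 10 30 + s12 * q1) + (c12 * e22 + c22 * e12) * (F 50 30 + s12 * q2)
      + (c01 * e02 + c02 * e01) * F 6 26 + (c01 * e12 + c12 * e01) * F 6 30 + (c02 * e12 + c12 * e02) * F 26 30"
      unfolding quad_def prod \<Gamma>l by (simp add: \<Gamma>s g_def algebra_simps)
    have "\<Gamma> (quad c00 c11 c22 c01 c02 c12 * quad e00 e11 e22 e01 e02 e12) -
        f (quad c00 c11 c22 c01 c02 c12) (quad e00 e11 e22 e01 e02 e12) =
        ((q0 * c00 + q1 * c11 + q2 * c22) * (t0 * e00 + t1 * e11 + t2 * e22)
        + (t0 * c00 + t1 * c11 + t2 * c22) * (q0 * e00 + q1 * e11 + q2 * e22)) / 2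
        + s01 * (c01 * (q0 * e00 + q1 * e11 + q2 * e22) + (q0 * c00 + q1 * c11 + q2 * c22) * e01)
        + s02 * (c02 * (q0 * e00 + q1 * e11 + q2 * e22) + (q0 * c00 + q1 * c11 + q2 * c22) * e02)
        + s12 * (c12 * (q0 * e00 + q1 * e11 + q2 * e22) + (q0 * c00 + q1 * c11 + q2 * c22) * e12)"
      unfolding 1 2 s t by (simp add: field_simps)
    then show "\<Gamma> (quad c00 c11 c22 c01 c02 c12 * quad e00 e11 e22 e01 e02 e12) =
        f (quad c00 c11 c22 c01 c02 c12) (quad e00 e11 e22 e01 e02 e12)"
      unfolding c e by simp
  next
    fix \<kappa> :: "(nat \<Rightarrow>\<^sub>0 real) \<Rightarrow> 'v \<Rightarrow> real" assume \<kappa>: "bilinear \<kappa>"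
    note kl = bilinear_ladd[OF \<kappa>] bilinear_radd[OF \<kappa>] bilinear_lmul[OF \<kappa>] bilinear_rmul[OF \<kappa>]
    define \<tau> where "\<tau> = (\<lambda>y. \<kappa> (mon 2) y *\<^sub>R mon 998 + \<kappa> (mon 10) y *\<^sub>R mon 990 + \<kappa> (mon 50) y *\<^sub>R mon 950
       + \<kappa> (mon 6) y *\<^sub>R mon 994 + \<kappa> (mon 26) y *\<^sub>R mon 974 + \<kappa> (mon 30) y *\<^sub>R mon 970)"
    have "linear \<tau>" unfolding \<tau>_def
      by (rule linearI) (simp_all add: kl scaleR_left_distrib scaleR_right_distrib)
    moreover have "\<Gamma> (quad c00 c11 c22 c01 c02 c12 * \<tau> y) = \<kappa> (quad c00 c11 c22 c01 c02 c12) y" for c00 c11 c22 c01 c02 c12 y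
      unfolding quad_def \<tau>_def prod \<Gamma>l kl by (simp add: \<Gamma>s g_def)
    ultimately show "\<exists>\<tau>. linear \<tau> \<and> (\<forall>c00 c11 c22 c01 c02 c12 y.
          \<Gamma> (quad c00 c11 c22 c01 c02 c12 * \<tau> y) = \<kappa> (quad c00 c11 c22 c01 c02 c12) y)" by blast
  qed
qed

section \<open>The intermediate algebra\<close>

text \<open>
  The functional \<open>lam\<close> is integration over cocycles of top degree \<open>4 r - 1\<close>.
\<close>

locale integrated_gdga = gdga G "\<lambda>_ _. m" "\<lambda>_. D" e
  for G :: "nat \<Rightarrow> 'v::real_vector set" and m :: "'v \<Rightarrow> 'v \<Rightarrow> 'v" and D :: "'v \<Rightarrow> 'v" and e :: 'v +
  fixes r :: nat and lam :: "'v \<Rightarrow> real"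
  assumes r2: "2 \<le> r"
    and lam_linear: "linear lam" and lam_D: "x \<in> G (4 * r - 2) \<Longrightarrow> lam (D x) = 0"
begin

lemma lam_X: assumes "i + j = 4 * r - 1" and "x \<in> X i" "z \<in> Z j" shows "lam (m x z) = 0" "lam (m z x) = 0"
proof -
  have "lam y = 0" if "y \<in> X (4 * r - 1)" for y
  proof -
    have "4 * r - 1 = Suc (4 * r - 2)" using r2 by simp
    then show ?thesis using that lam_D by (auto simp: X_Suc)
  qed
  then show "lam (m x z) = 0" "lam (m z x) = 0"
    using mu_X_left[OF assms(2,3)] mu_X_right[OF assms(3,2)] assms(1) by (simp_all add: add.commute)
qed

lemma lam_bilinear: "bilinear (\<lambda>x y. lam (m x y))"
  by (rule bilinearI) (simp_all add: mu_add_left mu_add_right mu_scale_left mu_scale_right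
      linear_add[OF lam_linear] linear_scale[OF lam_linear])

lemma mm_comm: "x \<in> G i \<Longrightarrow> y \<in> G j \<Longrightarrow> m x y = (-1) ^ (i * j) *\<^sub>R m y x"
  using mu_comm by blast

end

text \<open>
  The data from which the intermediate algebra is built.
  \<^item> \<open>H i\<close> is a space of harmonic cocycles, and \<open>cc\<close> reads off the multiple of the unit in degree zero.
  \<^item> \<open>rho a\<close> is the label (a linear polynomial) of an element \<open>a\<close> of degree \<open>r\<close>; \<open>S\<close> contains the
  products of two such labels, and \<open>ev s\<close> is the cocycle obtained by evaluating a quadratic label.
  \<^item> \<open>N\<close> consists of harmonic elements of degree \<open>2 r\<close>; modulo \<open>N\<close> every harmonic element of that
  degree is the evaluation of a label, and \<open>sig\<close> picks such a label linearly.
  \<^item> \<open>w s\<close> is a primitive of \<open>ev s\<close> if that is exact, normalised so that its pairing with \<open>ev t\<close>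
  is \<open>Gam (s * t)\<close> and its pairing with \<open>N\<close> is zero.
  \<^item> \<open>Y\<close> is a complement of the cocycles in degree \<open>2 r\<close>; the label \<open>tau y\<close> is chosen such that the
  pairing with \<open>w s\<close> on \<open>Y\<close> is also given by \<open>Gam\<close>.
  \<^item> \<open>SN_dec\<close>: an element \<open>(ev s + x, s)\<close> of degree \<open>2 r\<close> with \<open>x\<close> in \<open>N\<close> becomes a labelled harmonic
  element after subtracting some \<open>(ev s', s')\<close> with \<open>ev s'\<close> exact.
\<close>

locale formality_data = integrated_gdga G m D e r lam
  for G :: "nat \<Rightarrow> 'v::real_vector set" and m :: "'v \<Rightarrow> 'v \<Rightarrow> 'v" and D :: "'v \<Rightarrow> 'v" and e :: 'v
    and r :: nat and lam :: "'v \<Rightarrow> real" +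
  fixes H :: "nat \<Rightarrow> 'v set" and cc :: "'v \<Rightarrow> real"
    and rho :: "'v \<Rightarrow> nat \<Rightarrow>\<^sub>0 real" and ev :: "(nat \<Rightarrow>\<^sub>0 real) \<Rightarrow> 'v" and S :: "(nat \<Rightarrow>\<^sub>0 real) set"
    and Gam :: "(nat \<Rightarrow>\<^sub>0 real) \<Rightarrow> real" and sig :: "'v \<Rightarrow> nat \<Rightarrow>\<^sub>0 real" and w :: "(nat \<Rightarrow>\<^sub>0 real) \<Rightarrow> 'v"
    and Y N :: "'v set" and tau :: "'v \<Rightarrow> nat \<Rightarrow>\<^sub>0 real"
  assumes H_subspace: "vsubspace (H i)" and H_Z: "x \<in> H i \<Longrightarrow> x \<in> Z i"
    and H_X: "x \<in> H i \<Longrightarrow> x \<in> X i \<Longrightarrow> x = 0" and H_dec: "z \<in> Z i \<Longrightarrow> \<exists>h\<in>H i. z - h \<in> X i"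
    and H_vanish: "\<not> (i = 0 \<or> r \<le> i \<and> i \<le> 3 * r - 1 \<or> i = 4 * r - 1) \<Longrightarrow> x \<in> H i \<Longrightarrow> x = 0"
    and H_finite: "\<exists>T. finite T \<and> H i \<subseteq> span T"
    and cc_linear: "linear cc" and cc_e: "cc e = 1" and H_0: "x \<in> H 0 \<Longrightarrow> x = cc x *\<^sub>R e" and e_H: "e \<in> H 0"
    and duality: "i + j = 4 * r - 1 \<Longrightarrow> x \<in> H i \<Longrightarrow> (\<And>y. y \<in> H j \<Longrightarrow> lam (m x y) = 0) \<Longrightarrow> x = 0"
    and rho_linear: "linear rho" and ev_linear: "linear ev" and Gam_linear: "linear Gam" and sig_linear: "linear sig"
    and w_linear: "linear w" and tau_linear: "linear tau"
    and S_subspace: "vsubspace S" and S_odd: "odd r \<Longrightarrow> s \<in> S \<Longrightarrow> s = 0"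
    and rho_odd: "odd r \<Longrightarrow> rho a = 0" and tau_odd: "odd r \<Longrightarrow> tau y = 0"
    and ev_Z: "s \<in> S \<Longrightarrow> ev s \<in> Z (2 * r)"
    and rho_S: "a \<in> H r \<Longrightarrow> b \<in> H r \<Longrightarrow> rho a * rho b \<in> S"
    and rho_N: "a \<in> H r \<Longrightarrow> b \<in> H r \<Longrightarrow> m a b - ev (rho a * rho b) \<in> N"
    and N_subspace: "vsubspace N" and N_H: "x \<in> N \<Longrightarrow> x \<in> H (2 * r)"
    and sig_S: "h \<in> H (2 * r) \<Longrightarrow> sig h \<in> S" and sig_N: "h \<in> H (2 * r) \<Longrightarrow> h - ev (sig h) \<in> N"
    and w_G: "s \<in> S \<Longrightarrow> ev s \<in> X (2 * r) \<Longrightarrow> w s \<in> G (2 * r - 1)"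
    and w_D: "s \<in> S \<Longrightarrow> ev s \<in> X (2 * r) \<Longrightarrow> D (w s) = ev s"
    and w_S: "s \<in> S \<Longrightarrow> ev s \<in> X (2 * r) \<Longrightarrow> t \<in> S \<Longrightarrow> lam (m (w s) (ev t)) = Gam (s * t)"
    and w_N: "s \<in> S \<Longrightarrow> ev s \<in> X (2 * r) \<Longrightarrow> x \<in> N \<Longrightarrow> lam (m (w s) x) = 0"
    and Y_subspace: "vsubspace Y" and Y_G: "y \<in> Y \<Longrightarrow> y \<in> G (2 * r)" and Y_Z: "y \<in> Y \<Longrightarrow> y \<in> Z (2 * r) \<Longrightarrow> y = 0"
    and Y_dec: "x \<in> G (2 * r) \<Longrightarrow> \<exists>y\<in>Y. x - y \<in> Z (2 * r)"
    and w_Y: "s \<in> S \<Longrightarrow> ev s \<in> X (2 * r) \<Longrightarrow> y \<in> Y \<Longrightarrow> lam (m (w s) y) = Gam (s * tau y)"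
    and SN_dec: "s \<in> S \<Longrightarrow> x \<in> N \<Longrightarrow> \<exists>s'\<in>S. ev s' \<in> X (2 * r) \<and> ev (s - s') + x \<in> H (2 * r) \<and> sig (ev (s - s') + x) = s - s'"
begin

text \<open>
  The quadratic relations that are exact in cohomology.
\<close>

definition "E = {s \<in> S. ev s \<in> X (2 * r)}"

text \<open>
  The label of a harmonic element.
\<close>

definition rr :: "nat \<Rightarrow> 'v \<Rightarrow> nat \<Rightarrow>\<^sub>0 real" where
  "rr i h = (if i = r then rho h else if i = 0 then cc h *\<^sub>R punit r else if i = 2 * r then sig h else 0)"

definition iota :: "nat \<Rightarrow> 'v \<Rightarrow> 'v \<times> (nat \<Rightarrow>\<^sub>0 real)" where "iota i h = (h, rr i h)"

definition wt :: "(nat \<Rightarrow>\<^sub>0 real) \<Rightarrow> 'v \<times> (nat \<Rightarrow>\<^sub>0 real)" where "wt s = (w s, s)"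

text \<open>
  The graded pieces of the intermediate algebra. In degree \<open>2 r\<close> a product of two labelled elements of
  degree \<open>r\<close> has the form \<open>(ev s + x, s)\<close> with \<open>x\<close> in \<open>N\<close>; the elements \<open>(y, tau y)\<close> provide primitives
  for the coboundaries of degree \<open>2 r + 1\<close>. A full copy of the degree \<open>2 r\<close> piece of the product
  algebra would in general destroy the vanishing stated in \<open>L_wt\<close>.
\<close>

definition M :: "nat \<Rightarrow> ('v \<times> (nat \<Rightarrow>\<^sub>0 real)) set" where
  "M i = (if i < 2 * r - 1 then iota i ` H i
     else if i = 2 * r - 1 then {(h + w s, s) | h s. h \<in> H i \<and> s \<in> E}
     else if i = 2 * r then {(ev s + x + y, s + tau y) | s x y. s \<in> S \<and> x \<in> N \<and> y \<in> Y}
     else G i \<times> FT r i)"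

lemma M_lt: "i < 2 * r - 1 \<Longrightarrow> M i = iota i ` H i"
  unfolding M_def by simp

lemma M_mid: "M (2 * r - 1) = {(h + w s, s) | h s. h \<in> H (2 * r - 1) \<and> s \<in> E}"
  unfolding M_def by simp

lemma M_2r: "M (2 * r) = {(ev s + x + y, s + tau y) | s x y. s \<in> S \<and> x \<in> N \<and> y \<in> Y}"
proof -
  have "\<not> 2 * r < 2 * r - 1" "2 * r \<noteq> 2 * r - 1" using r2 by linarith+
  then show ?thesis unfolding M_def by (simp only: if_False if_True refl)
qed

lemma M_gt: assumes "i > 2 * r" shows "M i = G i \<times> FT r i"
proof -
  have "\<not> i < 2 * r - 1" "i \<noteq> 2 * r - 1" "i \<noteq> 2 * r" using assms by linarith+
  then show ?thesis unfolding M_def by (simp only: if_False)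
qed

abbreviation "pm \<equiv> pmu r (\<lambda>_ _. m)"
abbreviation "dd \<equiv> pd r (\<lambda>_. D)"

text \<open>
  Corrected integration: exact elements of \<open>M\<close> still have integral zero, and so do the products in
  \<open>L_wt\<close>.
\<close>

definition L :: "'v \<times> (nat \<Rightarrow>\<^sub>0 real) \<Rightarrow> real" where "L p = lam (fst p) - Gam (snd p)"

lemma labelled_gdga: "gdga (\<lambda>i. G i \<times> FT r i) pm dd (e, punit r)"
  by (rule gdga_labelled[OF _ r2]) unfold_locales

interpretation P: gdga "\<lambda>i. G i \<times> FT r i" pm dd "(e, punit r)"
  by (rule labelled_gdga)

lemmas lin_simps = linear_add linear_diff linear_scale linear_0
lemmas lam_s = lin_simps[OF lam_linear] and rho_s = lin_simps[OF rho_linear] and ev_s = lin_simps[OF ev_linear]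
  and Gam_s = lin_simps[OF Gam_linear] and sig_s = lin_simps[OF sig_linear] and w_s = lin_simps[OF w_linear]
  and tau_s = lin_simps[OF tau_linear] and cc_s = lin_simps[OF cc_linear]

lemma E_subspace: "vsubspace E"
  using S_subspace X_subspace[of "2 * r"] by (auto simp: E_def real_vector.subspace_def ev_s)

lemma E_S: "s \<in> E \<Longrightarrow> s \<in> S" by (simp add: E_def)

lemma N_Z: "x \<in> N \<Longrightarrow> x \<in> Z (2 * r)" using N_H H_Z by blast

lemma H_G: "x \<in> H i \<Longrightarrow> x \<in> G i" using H_Z Z_G by blast

lemma rr_linear: "linear (rr i)"
  by (rule linearI) (auto simp: rr_def rho_s cc_s sig_s scaleR_left_distrib)

lemmas rr_s = lin_simps[OF rr_linear]

lemma iota_linear: "linear (iota i)"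
  by (rule linearI) (simp_all add: iota_def rr_s)

lemmas iota_s = lin_simps[OF iota_linear]

lemma wt_linear: "linear wt"
  by (rule linearI) (simp_all add: wt_def w_s)

lemma L_linear: "linear L"
  by (rule linearI) (simp_all add: L_def lam_s Gam_s right_diff_distrib)

lemmas L_s = lin_simps[OF L_linear]

lemma iota_M: assumes "h \<in> H i" shows "iota i h \<in> M i"
proof -
  have "odd r \<Longrightarrow> rr i h = 0" using assms S_odd[OF _ sig_S, of h] rho_odd[of h] by (auto simp: rr_def punit_def)
  then have FT: "rr i h \<in> FT r i" by (auto simp: FT_def rr_def)
  consider "i < 2 * r - 1" | "i = 2 * r - 1" | "i = 2 * r" | "i > 2 * r" by linarith
  then show ?thesis
  proof cases
    case 2
    then have "rr i h = 0" using r2 by (auto simp: rr_def)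
    moreover have "h = h + w 0" "0 \<in> E" using vsubspace_0[OF E_subspace] by (simp_all add: w_s)
    ultimately show ?thesis using 2 assms unfolding 2 M_mid iota_def by fastforce
  next
    case 3
    have "iota i h = (ev (sig h) + (h - ev (sig h)) + 0, sig h + tau 0)" using 3 r2 by (simp add: iota_def rr_def tau_s)
    then show ?thesis unfolding 3 M_2r using 3 sig_S[of h] sig_N[of h] assms vsubspace_0[OF Y_subspace] by blast
  next
    case 4 then show ?thesis using assms FT H_G by (auto simp: M_gt iota_def)
  qed (use assms in \<open>auto simp: M_lt\<close>)
qed

lemma wt_M: "s \<in> E \<Longrightarrow> wt s \<in> M (2 * r - 1)"
  using vsubspace_0[OF H_subspace[of "2 * r - 1"]] unfolding M_mid wt_def by force

text \<open>
  Up to degree \<open>2 r - 1\<close> the elements of \<open>M\<close> are harmonic up to a labelled primitive, which occurs in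
  degree \<open>2 r - 1\<close> only.
\<close>

lemma M_low: assumes "i \<le> 2 * r - 1" "x \<in> M i"
  obtains h s where "h \<in> H i" "s \<in> E" "x = iota i h + wt s" "i \<noteq> 2 * r - 1 \<Longrightarrow> s = 0"
proof (cases "i = 2 * r - 1")
  case True
  then obtain h s where "h \<in> H i" "s \<in> E" "x = (h + w s, s)" using assms unfolding True M_mid by auto
  moreover have "rr i h = 0" using True r2 by (auto simp: rr_def)
  ultimately show ?thesis using that True by (simp add: iota_def wt_def)
next
  case False
  then obtain h where "h \<in> H i" "x = iota i h" using assms by (auto simp: M_lt)
  then show ?thesis using that[of h 0] vsubspace_0[OF E_subspace] linear_0[OF wt_linear] by simp
qed

lemma M_sub: "x \<in> M i \<Longrightarrow> x \<in> G i \<times> FT r i"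
proof -
  assume x: "x \<in> M i"
  have FS: "s \<in> S \<Longrightarrow> s \<in> FT r (2 * r)" "s \<in> S \<Longrightarrow> s \<in> FT r (2 * r - 1)" for s
    using S_odd r2 by (auto simp: FT_def)
  have rrF: "h \<in> H i \<Longrightarrow> rr i h \<in> FT r i" for h
    using S_odd[OF _ sig_S, of h] rho_odd[of h] by (auto simp: rr_def punit_def FT_def)
  have tF: "tau y \<in> FT r (2 * r)" for y using tau_odd by (auto simp: FT_def)
  consider "i \<le> 2 * r - 1" | "i = 2 * r" | "i > 2 * r" by linarith
  then show ?thesis
  proof cases
    case 1
    then obtain h s where *: "h \<in> H i" "s \<in> E" "x = iota i h + wt s" "i \<noteq> 2 * r - 1 \<Longrightarrow> s = 0"
      using M_low[OF 1 x] by metis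
    have "h + w s \<in> G i" "rr i h + s \<in> FT r i"
      using *(1,2,4) H_G[OF *(1)] w_G[of s] vsubspace_add[OF G_subspace[of i]] vsubspace_add[OF FT_subspace[of r i]]
        rrF[OF *(1)] FS(2)[of s] by (cases "i = 2 * r - 1"; simp add: E_def w_s)+
    then show ?thesis using *(3) by (simp add: iota_def wt_def)
  next
    case 2
    then obtain s x1 y where "s \<in> S" "x1 \<in> N" "y \<in> Y" "x = (ev s + x1 + y, s + tau y)"
      using x unfolding 2 M_2r by auto
    then show ?thesis using 2 vsubspace_add[OF G_subspace[of i]] vsubspace_add[OF FT_subspace[of r i]]
        Z_G[OF ev_Z] Z_G[OF N_Z] Y_G FS(1) tF by auto
  qed (use x M_gt in auto)
qed

lemma M_subspace: "vsubspace (M i)"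
proof -
  consider "i < 2 * r - 1" | "i = 2 * r - 1" | "i = 2 * r" | "i > 2 * r" by linarith
  then show ?thesis
  proof cases
    case 1
    then show ?thesis using linear_subspace_image[OF iota_linear H_subspace] by (simp add: M_lt)
  next
    case 2
    have "linear (\<lambda>p. (fst p + w (snd p), snd p))" by (rule linearI) (simp_all add: w_s scaleR_right_distrib)
    moreover have "vsubspace (H i \<times> E)"
      using H_subspace[of i] E_subspace by (auto simp: real_vector.subspace_def zero_prod_def)
    ultimately have "vsubspace ((\<lambda>p. (fst p + w (snd p), snd p)) ` (H i \<times> E))" by (rule linear_subspace_image)
    moreover have "M i = (\<lambda>p. (fst p + w (snd p), snd p)) ` (H i \<times> E)" unfolding 2 M_mid by force
    ultimately show ?thesis by simp
  next
    case 3
    let ?f = "\<lambda>p. (ev (fst p) + fst (snd p) + snd (snd p), fst p + tau (snd (snd p)))"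
    have "linear ?f" by (rule linearI) (simp_all add: ev_s tau_s scaleR_right_distrib)
    moreover have "vsubspace (S \<times> N \<times> Y)"
      using S_subspace N_subspace Y_subspace by (auto simp: real_vector.subspace_def zero_prod_def)
    ultimately have "vsubspace (?f ` (S \<times> N \<times> Y))" by (rule linear_subspace_image)
    moreover have "M i = ?f ` (S \<times> N \<times> Y)" unfolding 3 M_2r by force
    ultimately show ?thesis by simp
  next
    case 4
    then show ?thesis using P.G_subspace[of i] by (simp add: M_gt)
  qed
qed

lemma dd_iota: "h \<in> H i \<Longrightarrow> dd i (iota i h) = 0"
  using Z_d[OF H_Z] r2 dvd_Suc_excl[OF r2, of r] dvd_Suc_excl[OF r2, of 0] dvd_Suc_excl[OF r2, of "2 * r"]
  by (auto simp: pd_def iota_def rr_def dsc_def zero_prod_def)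

lemma dd_wt: "s \<in> E \<Longrightarrow> dd (2 * r - 1) (wt s) = (ev s, s)"
  using w_D r2 by (auto simp: pd_def wt_def dsc_def E_def)

text \<open>
  Closure under products is immediate except in degree \<open>2 r\<close>: a product with a factor of degree between
  \<open>0\<close> and \<open>r\<close> is zero, and all other products of positive degrees land above degree \<open>2 r\<close>, where \<open>M\<close> is
  the whole product algebra.
\<close>

lemma M_gdga: "gdga M pm dd (e, punit r)"
proof (rule gdga_sub[OF labelled_gdga M_subspace M_sub])
  show one: "(e, punit r) \<in> M 0"
    using iota_M[OF e_H] r2 by (simp add: iota_def rr_def cc_e)
  fix i x assume x: "x \<in> M i"
  consider "i \<le> 2 * r - 1" | "i = 2 * r" | "i > 2 * r" by linarith
  then show "dd i x \<in> M (Suc i)"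
  proof cases
    case 1
    then obtain h s where *: "h \<in> H i" "s \<in> E" "x = iota i h + wt s" "i \<noteq> 2 * r - 1 \<Longrightarrow> s = 0"
      using M_low[OF 1 x] by metis
    show ?thesis
    proof (cases "i = 2 * r - 1")
      case True
      have "dd i x = (ev s + 0 + 0, s + tau 0)" using dd_iota[OF *(1)] dd_wt[OF *(2)] True by (simp add: *(3) P.d_add tau_s)
      moreover have "Suc i = 2 * r" using True r2 by simp
      ultimately show ?thesis using E_S[OF *(2)] vsubspace_0[OF N_subspace] vsubspace_0[OF Y_subspace] unfolding \<open>Suc i = 2 * r\<close> M_2r by blast
    next
      case False
      then have "dd i x = 0" using * dd_iota[OF *(1)] linear_0[OF wt_linear] by simp
      then show ?thesis using vsubspace_0[OF M_subspace] by simp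
    qed
  next
    case 2
    then show ?thesis using P.d_G[OF M_sub[OF x]] by (simp add: M_gt)
  next
    case 3
    then show ?thesis using P.d_G[OF M_sub[OF x]] by (simp add: M_gt)
  qed
next
  fix i j x y assume x: "x \<in> M i" and y: "y \<in> M j"
  have unit: "pm 0 j x y \<in> M j" if u: "x \<in> M 0" "y \<in> M j" for j x y
  proof -
    obtain h where "h \<in> H 0" "x = iota 0 h" using u M_lt[of 0] r2 by auto
    then have xc: "x = cc h *\<^sub>R (e, punit r)" using H_0[of h] r2 by (simp add: iota_def rr_def)
    have "pm 0 j x y = cc h *\<^sub>R y" unfolding xc P.mu_scale_left P.mu_e[OF M_sub[OF u(2)]] ..
    then show ?thesis using vsubspace_scale[OF M_subspace u(2)] by simp
  qed
  have low: "x = 0" if u: "x \<in> M i" "0 < i" "i < r" for i x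
  proof -
    obtain h where h: "h \<in> H i" "x = iota i h" using u by (auto simp: M_lt)
    have "h = 0" using H_vanish[OF _ h(1)] u by simp
    then show ?thesis using h(2) by (simp add: iota_s)
  qed
  consider "i = 0" | "j = 0" | "0 < i" "i < r" | "0 < j" "j < r" | "i = r" "j = r" | "r \<le> i" "r \<le> j" "i \<noteq> r \<or> j \<noteq> r" by linarith
  then show "pm i j x y \<in> M (i + j)"
  proof cases
    case 1 then show ?thesis using unit x y by simp
  next
    case 2
    have "pm i j x y = pm 0 i y x" using 2 P.mu_comm[OF M_sub[OF x] M_sub[OF y]] by simp
    moreover have "pm 0 i y x \<in> M i" using unit[where x=y and y=x and j=i] x y 2 by simp
    ultimately show ?thesis using 2 by simp
  next
    case 3 then show ?thesis using low[OF x] vsubspace_0[OF M_subspace] by (simp add: P.mu_0_left)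
  next
    case 4 then show ?thesis using low[OF y] vsubspace_0[OF M_subspace] by (simp add: P.mu_0_right)
  next
    case 5
    then obtain a b where ab: "a \<in> H r" "b \<in> H r" "x = iota r a" "y = iota r b" using x y r2 by (auto simp: M_lt)
    let ?s = "rho a * rho b"
    have "pm i j x y = (ev ?s + (m a b - ev ?s) + 0, ?s + tau 0)"
      using ab 5 by (simp add: pmu_def iota_def rr_def tsc_def tau_s)
    moreover have ij: "i + j = 2 * r" using 5 by simp
    ultimately show ?thesis unfolding ij M_2r using rho_S[OF ab(1,2)] rho_N[OF ab(1,2)] vsubspace_0[OF Y_subspace] by blast
  next
    case 6
    then have "i + j > 2 * r" by linarith
    then show ?thesis using P.mu_G[OF M_sub[OF x] M_sub[OF y]] by (simp add: M_gt)
  qed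
qed

interpretation M: gdga M pm dd "(e, punit r)"
  by (rule M_gdga)

text \<open>
  The normalisations of \<open>w\<close>, \<open>Gam\<close> and \<open>tau\<close> were chosen for this equation.
\<close>

lemma L_wt: assumes s: "s \<in> E" and p: "p \<in> M (2 * r)" shows "L (pm (2 * r - 1) (2 * r) (wt s) p) = 0"
proof -
  obtain t x y where t: "t \<in> S" "x \<in> N" "y \<in> Y" "p = (ev t + x + y, t + tau y)"
    using p unfolding M_2r by auto
  have "tsc r (2 * r - 1) (2 * r) = 1" using r2 by (simp add: tsc_def)
  then show ?thesis using s t(1-3)
    by (simp add: t(4) L_def pmu_def wt_def E_def mu_add_right lam_s distrib_left Gam_s w_S w_N w_Y)
qed

lemma dual_ex:
  assumes "i \<le> 4 * r - 1"
  shows "\<exists>f. linear f \<and> (\<forall>p. f p \<in> H i) \<and>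
    (\<forall>p. \<forall>h\<in>H (4 * r - 1 - i). lam (m (f p) h) = L (pm i (4 * r - 1 - i) p (iota (4 * r - 1 - i) h)))"
proof -
  let ?j = "4 * r - 1 - i"
  obtain T where T: "finite T" "H ?j \<subseteq> span T" using H_finite by blast
  have k: "bilinear (\<lambda>p h. L (pm i ?j p (iota ?j h)))"
    by (rule bilinearI) (simp_all only: iota_s P.mu_add_left P.mu_add_right P.mu_scale_left P.mu_scale_right L_s real_scaleR_def)
  have sep: "x = 0" if x: "x \<in> H ?j" "\<And>z. z \<in> H i \<Longrightarrow> lam (m z x) = 0" for x
  proof (rule duality[of ?j i])
    fix y assume y: "y \<in> H i"
    show "lam (m x y) = 0" using mm_comm[OF H_G[OF x(1)] H_G[OF y]] x(2)[OF y] by (simp add: lam_s)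
  qed (use assms x in auto)
  show ?thesis
    by (rule dual_operator[OF lam_bilinear H_subspace[of i] T(1) T(2) H_subspace sep k]) auto
qed

text \<open>
  \<open>R i p\<close> is the harmonic element dual to the functional \<open>h \<mapsto> L (p h)\<close>; it exists and depends linearly
  on \<open>p\<close> by \<open>dual_operator\<close>.
\<close>

definition R where "R i = (SOME f. linear f \<and> (\<forall>p. f p \<in> H i) \<and>
    (\<forall>p. \<forall>h\<in>H (4 * r - 1 - i). lam (m (f p) h) = L (pm i (4 * r - 1 - i) p (iota (4 * r - 1 - i) h))))"

lemma R: assumes "i \<le> 4 * r - 1"
  shows "linear (R i)" "R i p \<in> H i"
    "h \<in> H (4 * r - 1 - i) \<Longrightarrow> lam (m (R i p) h) = L (pm i (4 * r - 1 - i) p (iota (4 * r - 1 - i) h))"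
  using someI_ex[OF dual_ex[OF assms]] unfolding R_def by blast+

text \<open>
  In degree \<open>2 r - 1\<close> the second summand removes the labelled primitive, which leaves the harmonic
  part. Beyond the top degree the cohomology vanishes.
\<close>

definition psi :: "nat \<Rightarrow> 'v \<times> (nat \<Rightarrow>\<^sub>0 real) \<Rightarrow> 'v" where
  "psi i p = (if i < 2 * r then fst p - (if i = 2 * r - 1 then w (snd p) else 0)
     else if i \<le> 4 * r - 1 then R i p else 0)"

lemma psi_linear: "linear (psi i)"
proof (cases "2 * r \<le> i \<and> i \<le> 4 * r - 1")
  case True
  then have "psi i = R i" by (auto simp: psi_def)
  then show ?thesis using R(1) True by simp
next
  case False
  then show ?thesis by (intro linearI) (auto simp: psi_def w_s scaleR_right_diff_distrib)
qed

lemmas psi_s = lin_simps[OF psi_linear]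

lemma psi_low: assumes "i < 2 * r" "h \<in> H i" "s \<in> E" "i \<noteq> 2 * r - 1 \<Longrightarrow> s = 0"
  shows "psi i (iota i h + wt s) = h"
proof -
  have "i = 2 * r - 1 \<Longrightarrow> rr i h = 0" using r2 by (auto simp: rr_def)
  then show ?thesis using assms by (auto simp: psi_def iota_def wt_def w_s)
qed

lemma psi_H: assumes "x \<in> M i" shows "psi i x \<in> H i"
proof -
  consider "i < 2 * r" | "2 * r \<le> i" "i \<le> 4 * r - 1" | "2 * r \<le> i" "i > 4 * r - 1" by linarith
  then show ?thesis
  proof cases
    case 1
    then have "i \<le> 2 * r - 1" by simp
    then obtain h s where *: "h \<in> H i" "s \<in> E" "x = iota i h + wt s" "i \<noteq> 2 * r - 1 \<Longrightarrow> s = 0"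
      using M_low[OF _ assms] by metis
    show ?thesis using psi_low[OF 1 *(1,2,4)] *(1) by (simp add: *(3))
  next
    case 2 then show ?thesis using R(2) by (simp add: psi_def)
  next
    case 3 then show ?thesis using vsubspace_0[OF H_subspace] by (simp add: psi_def)
  qed
qed

lemma psi_high: assumes "2 * r \<le> i" "i + j = 4 * r - 1" "h \<in> H j"
  shows "lam (m (psi i p) h) = L (pm i j p (iota j h))"
proof -
  have "j = 4 * r - 1 - i" "i \<le> 4 * r - 1" using assms by auto
  then show ?thesis using R(3)[of i h p] assms by (simp add: psi_def)
qed

text \<open>
  Three harmonic elements of positive degree with total degree \<open>4 r - 1\<close> cannot all have degree \<open>r\<close>, so
  one of them has label zero and the correction term in \<open>L\<close> disappears.
\<close>

lemma L_iota3: assumes "r \<le> i" "i < 2 * r" "r \<le> j" "j < 2 * r" "i + j + k = 4 * r - 1" "0 < k" "k < 2 * r"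
  shows "L (pm (i + j) k (pm i j (iota i a) (iota j b)) (iota k h)) = lam (m (m a b) h)"
proof -
  have "rr i a * rr j b * rr k h = 0" using assms r2 by (auto simp: rr_def)
  then show ?thesis by (auto simp: L_def pmu_def iota_def pm_scale_left Gam_s)
qed

text \<open>
  Poincare duality reduces an identity between cohomology classes to pairings with harmonic elements.
\<close>

lemma exact_by_pairing: assumes k: "k + l = 4 * r - 1" and z: "z \<in> Z k" and p: "p \<in> M k"
  and eq: "\<And>h. h \<in> H l \<Longrightarrow> lam (m z h) = lam (m (psi k p) h)"
  shows "z - psi k p \<in> X k"
proof -
  obtain h0 where h0: "h0 \<in> H k" "z - h0 \<in> X k" using H_dec[OF z] by blast
  have "h0 - psi k p = 0"
  proof (rule duality[OF k])
    show "h0 - psi k p \<in> H k" using h0 psi_H[OF p] H_subspace by (blast intro: vsubspace_diff)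
    fix h assume h: "h \<in> H l"
    have "lam (m (z - h0) h) = 0" using lam_X(1)[OF k h0(2) H_Z[OF h]] .
    then show "lam (m (h0 - psi k p) h) = 0" using eq[OF h] by (simp add: mu_diff_left lam_s)
  qed
  then show ?thesis using h0 by simp
qed

lemma psi_0_by_pairing: assumes "x \<in> M k" "2 * r \<le> k" "k \<le> 4 * r - 1"
  "\<And>h. h \<in> H (4 * r - 1 - k) \<Longrightarrow> L (pm k (4 * r - 1 - k) x (iota (4 * r - 1 - k) h)) = 0"
  shows "psi k x = 0"
  by (rule duality[of k "4 * r - 1 - k"]) (use assms psi_H psi_high[of k "4 * r - 1 - k" _ x] in auto)

text \<open>
  The label algebra is zero in degree \<open>4 r - 2\<close> or at least has no differential there, because \<open>r\<close> does
  not divide \<open>4 r - 1\<close>.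
\<close>

lemma L_dd: assumes "q \<in> M (4 * r - 2)" shows "L (dd (4 * r - 2) q) = 0"
proof -
  have "Suc (4 * r - 2) = 4 * r - 1" "Suc (4 * r - 1) = 4 * r" using r2 by auto
  then have "\<not> r dvd Suc (4 * r - 2)" using dvd_Suc_excl[OF r2, of "4 * r - 1"] by auto
  then show ?thesis using lam_D[of "fst q"] M_sub[OF assms] by (auto simp: L_def pd_def dsc_def Gam_s)
qed

text \<open>
  Below degree \<open>2 r - 1\<close> differentials vanish on \<open>M\<close>. In degree \<open>2 r - 1\<close> the differential of \<open>(w s, s)\<close> is
  \<open>(ev s, s)\<close>, which pairs to zero with degree \<open>2 r - 1\<close> since \<open>ev s\<close> is exact and harmonic elements of
  that degree have no label. Above, \<open>L\<close> vanishes on \<open>d (x h) = d x \<cdot> h\<close>.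
\<close>

lemma psi_dd: assumes x: "x \<in> M i" shows "psi (Suc i) (dd i x) = 0"
proof -
  consider "i < 2 * r - 1" | "i = 2 * r - 1" | "2 * r \<le> i" "Suc i \<le> 4 * r - 1" | "2 * r \<le> i" "Suc i > 4 * r - 1" by linarith
  then show ?thesis
  proof cases
    case 1
    then show ?thesis using x dd_iota by (auto simp: M_lt psi_s)
  next
    case 2
    obtain h s where *: "h \<in> H i" "s \<in> E" "x = iota i h + wt s"
      using M_low[of i x] x 2 by (metis order_refl)
    have d: "dd i x = (ev s, s)" using dd_iota[OF *(1)] dd_wt[OF *(2)] 2 by (simp add: *(3) P.d_add)
    have Si: "Suc i = 2 * r" using 2 r2 by simp
    show ?thesis
    proof (rule psi_0_by_pairing)
      show "dd i x \<in> M (Suc i)" by (rule M.d_G[OF x])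
      let ?l = "4 * r - 1 - Suc i"
      fix h assume h: "h \<in> H ?l"
      have l: "?l = 2 * r - 1" using Si by simp
      have "rr ?l h = 0" using l r2 by (auto simp: rr_def)
      moreover have "lam (m (ev s) h) = 0" using lam_X(1)[of "2 * r" ?l "ev s" h] *(2) H_Z[OF h] Si r2 by (auto simp: E_def)
      ultimately show "L (pm (Suc i) ?l (dd i x) (iota ?l h)) = 0"
        by (simp add: d L_def pmu_def iota_def Gam_s)
    qed (use Si r2 in auto)
  next
    case 3
    show ?thesis
    proof (rule psi_0_by_pairing)
      show "dd i x \<in> M (Suc i)" by (rule M.d_G[OF x])
      let ?l = "4 * r - 1 - Suc i"
      fix h assume h: "h \<in> H ?l"
      have "dd (i + ?l) (pm i ?l x (iota ?l h)) = pm (Suc i) ?l (dd i x) (iota ?l h)"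
        using M.d_mu[OF x iota_M[OF h]] dd_iota[OF h] by (simp add: M.mu_0_right)
      moreover have "i + ?l = 4 * r - 2" using 3 by simp
      moreover have "L (dd (i + ?l) (pm i ?l x (iota ?l h))) = 0"
        using L_dd M.mu_G[OF x iota_M[OF h]] \<open>i + ?l = 4 * r - 2\<close> by metis
      ultimately show "L (pm (Suc i) ?l (dd i x) (iota ?l h)) = 0" by simp
    qed (use 3 in auto)
  next
    case 4 then show ?thesis by (simp add: psi_def)
  qed
qed

lemma H_zero_X: assumes "\<And>h. h \<in> H k \<Longrightarrow> h = 0" "z \<in> Z k" shows "z \<in> X k"
  using H_dec[OF assms(2)] assms(1) by force

text \<open>
  Compare the pairings of both sides with a harmonic element \<open>h\<close> of complementary degree. If the
  product has degree at most \<open>3 r - 1\<close>, both factors are harmonic up to a summand \<open>(w t, t)\<close>, which can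
  occur only if the degrees of the other factor and of \<open>h\<close> are \<open>r\<close>; then it contributes a multiple of
  \<open>L ((w t, t) p)\<close> with \<open>p\<close> of degree \<open>2 r\<close>, which is zero by \<open>L_wt\<close>. If the product has top degree,
  the defining property of \<open>psi\<close> on the factor of larger degree gives the claim, again up to a term
  covered by \<open>L_wt\<close>. In the remaining degrees the factor or the target vanishes.
\<close>

lemma psi_mult_le: assumes x: "x \<in> M i" and y: "y \<in> M j" and ij: "i \<le> j"
  shows "m (psi i x) (psi j y) - psi (i + j) (pm i j x y) \<in> X (i + j)"
proof -
  have xy: "pm i j x y \<in> M (i + j)" using M.mu_G[OF x y] .
  have zz: "m (psi i x) (psi j y) \<in> Z (i + j)" using mu_Z H_Z psi_H x y by blast
  consider "i = 0" | "0 < i" "i < r" | "r \<le> i" "i + j \<le> 3 * r - 1" | "r \<le> i" "i + j = 4 * r - 1"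
    | "r \<le> i" "3 * r - 1 < i + j" "i + j \<noteq> 4 * r - 1" by linarith
  then show ?thesis
  proof cases
    case 1
    then obtain h where h: "h \<in> H 0" "x = iota 0 h" using x M_lt[of 0] r2 by auto
    then have xc: "x = cc h *\<^sub>R (e, punit r)" "h = cc h *\<^sub>R e" using H_0[of h] r2 by (simp_all add: iota_def rr_def)
    have p0: "psi 0 x = h" using psi_low[of 0 h 0] h(1) r2 vsubspace_0[OF E_subspace] linear_0[OF wt_linear] h(2) by simp
    have "pm i j x y = cc h *\<^sub>R y" unfolding 1 xc(1) P.mu_scale_left P.mu_e[OF M_sub[OF y]] ..
    moreover have "m (psi i x) (psi j y) = cc h *\<^sub>R psi j y"
      using mu_e[OF H_G[OF psi_H[OF y]]] by (subst 1, subst p0, subst xc(2)) (simp add: mu_scale_left)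
    ultimately show ?thesis using 1 vsubspace_0[OF X_subspace] by (simp add: psi_s)
  next
    case 2
    then obtain h where h: "h \<in> H i" "x = iota i h" using x by (auto simp: M_lt)
    have "h = 0" using H_vanish[OF _ h(1)] 2 by simp
    then have "x = 0" using h(2) by (simp add: iota_s)
    then show ?thesis using vsubspace_0[OF X_subspace] by (simp add: psi_s P.mu_0_left mu_0_left)
  next
    case 3
    have lt: "i < 2 * r - 1" "j < 2 * r" "j \<le> 2 * r - 1" "r \<le> j" using 3 ij r2 by linarith+
    obtain a s0 where a0: "a \<in> H i" "s0 \<in> E" "x = iota i a + wt s0" "i \<noteq> 2 * r - 1 \<Longrightarrow> s0 = 0"
      using M_low[of i x] x lt by (metis less_imp_le)
    have a: "a \<in> H i" "x = iota i a" using a0 lt linear_0[OF wt_linear] by auto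
    obtain b t where b: "b \<in> H j" "t \<in> E" "y = iota j b + wt t" "j \<noteq> 2 * r - 1 \<Longrightarrow> t = 0"
      using M_low[of j y] y lt by metis
    have psx: "psi i x = a" using psi_low[of i a 0] a lt vsubspace_0[OF E_subspace] linear_0[OF wt_linear] by simp
    have psy: "psi j y = b" using psi_low[of j b t] b lt by simp
    define l where "l = 4 * r - 1 - (i + j)"
    have l: "i + j + l = 4 * r - 1" "r \<le> l" "l < 2 * r" using 3 lt r2 by (auto simp: l_def)
    show ?thesis
    proof (rule exact_by_pairing[OF l(1) zz xy])
      fix h assume h: "h \<in> H l"
      have t0: "L (pm (i + j) l (pm i j (iota i a) (wt t)) (iota l h)) = 0"
      proof (cases "t = 0")
        case True then show ?thesis using linear_0[OF wt_linear] by (simp add: P.mu_0_left P.mu_0_right L_s)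
      next
        case False
        then have j: "j = 2 * r - 1" using b(4) by blast
        then have il: "i = r" "l = r" using 3 l r2 by auto
        have A: "iota i a \<in> M r" "iota l h \<in> M r" "wt t \<in> M (2 * r - 1)"
          using iota_M[OF a(1)] iota_M[OF h] wt_M[OF b(2)] il by auto
        have B: "pm r r (iota i a) (iota l h) \<in> M (2 * r)" using M.mu_G[OF A(1,2)] by (simp add: mult_2)
        have "pm (i + j) l (pm i j (iota i a) (wt t)) (iota l h)
          = (-1) ^ (r * (2 * r - 1)) *\<^sub>R pm ((2 * r - 1) + r) r (pm (2 * r - 1) r (wt t) (iota i a)) (iota l h)"
          using M.mu_comm[OF A(1) A(3)] by (simp add: il j P.mu_scale_left add.commute)
        also have "pm ((2 * r - 1) + r) r (pm (2 * r - 1) r (wt t) (iota i a)) (iota l h)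
          = pm (2 * r - 1) (2 * r) (wt t) (pm r r (iota i a) (iota l h))"
          using M.mu_assoc[OF A(3,1,2)] by (simp add: mult_2)
        finally show ?thesis using L_wt[OF b(2) B] by (simp add: L_s)
      qed
      have "lam (m (psi (i + j) (pm i j x y)) h) = L (pm (i + j) l (pm i j x y) (iota l h))"
        by (rule psi_high[OF _ l(1) h]) (use 3 lt in simp)
      also have "\<dots> = L (pm (i + j) l (pm i j (iota i a) (iota j b)) (iota l h))"
        using t0 by (simp add: a(2) b(3) P.mu_add_right P.mu_add_left L_s)
      also have "\<dots> = lam (m (m a b) h)"
        by (rule L_iota3) (use 3 lt l r2 in auto)
      finally show "lam (m (m (psi i x) (psi j y)) h) = lam (m (psi (i + j) (pm i j x y)) h)"
        by (simp add: psx psy)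
    qed
  next
    case 4
    have lt: "i \<le> 2 * r - 1" "2 * r \<le> j" "i < 2 * r" using 4 ij r2 by linarith+
    obtain a s where a: "a \<in> H i" "s \<in> E" "x = iota i a + wt s" "i \<noteq> 2 * r - 1 \<Longrightarrow> s = 0"
      using M_low[of i x] x lt by metis
    have psx: "psi i x = a" using psi_low[of i a s] a lt by simp
    have s0: "L (pm i j (wt s) y) = 0"
    proof (cases "i = 2 * r - 1")
      case True
      then have "j = 2 * r" using 4 r2 by simp
      then show ?thesis using L_wt[OF a(2)] y True by simp
    next
      case False
      then show ?thesis using a(4) linear_0[OF wt_linear] by (simp add: P.mu_0_left L_s)
    qed
    have main: "lam (m (psi i x) (psi j y)) = L (pm i j x y)"
    proof -
      have "lam (m (psi i x) (psi j y)) = (-1) ^ (i * j) * lam (m (psi j y) a)"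
        using mm_comm[OF H_G[OF a(1)] H_G[OF psi_H[OF y]]] by (simp add: psx lam_s)
      also have "\<dots> = (-1) ^ (i * j) * L (pm j i y (iota i a))"
        using psi_high[of j i a y] lt 4 a(1) by (simp add: add.commute)
      also have "\<dots> = L (pm i j (iota i a) y)"
        using M.mu_comm[OF iota_M[OF a(1)] y] by (simp add: L_s)
      also have "\<dots> = L (pm i j x y)" using s0 by (simp add: a(3) P.mu_add_left L_s)
      finally show ?thesis .
    qed
    show ?thesis
    proof (rule exact_by_pairing[OF _ zz xy])
      show "i + j + 0 = 4 * r - 1" using 4 by simp
      fix h assume h: "h \<in> H 0"
      have hh: "h = cc h *\<^sub>R e" "iota 0 h = cc h *\<^sub>R (e, punit r)" using H_0[OF h] r2 by (simp_all add: iota_def rr_def)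
      have "lam (m (psi (i + j) (pm i j x y)) h) = L (pm (i + j) 0 (pm i j x y) (iota 0 h))"
        by (rule psi_high[OF _ _ h]) (use 4 lt in auto)
      also have "\<dots> = cc h * L (pm i j x y)"
        unfolding hh(2) P.mu_scale_right M.mu_e_right[OF xy] by (simp add: L_s)
      also have "\<dots> = cc h * lam (m (psi i x) (psi j y))" using main by simp
      also have "\<dots> = lam (m (m (psi i x) (psi j y)) h)"
        by (subst (2) hh(1)) (simp add: mu_scale_right mu_e_right[OF Z_G[OF zz]] lam_s)
      finally show "lam (m (m (psi i x) (psi j y)) h) = lam (m (psi (i + j) (pm i j x y)) h)" by simp
    qed
  next
    case 5
    have "h \<in> H (i + j) \<Longrightarrow> h = 0" for h using 5 H_vanish[of "i + j" h] r2 by simp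
    moreover from this have "psi (i + j) (pm i j x y) = 0" using psi_H[OF xy] by blast
    ultimately show ?thesis using H_zero_X[OF _ zz] by simp
  qed
qed

lemma psi_mult: assumes x: "x \<in> M i" and y: "y \<in> M j"
  shows "m (psi i x) (psi j y) - psi (i + j) (pm i j x y) \<in> X (i + j)"
proof (cases "i \<le> j")
  case False
  then have *: "m (psi j y) (psi i x) - psi (j + i) (pm j i y x) \<in> X (j + i)" using psi_mult_le[OF y x] by simp
  have "m (psi i x) (psi j y) - psi (i + j) (pm i j x y) = (-1) ^ (i * j) *\<^sub>R (m (psi j y) (psi i x) - psi (j + i) (pm j i y x))"
    using mm_comm[OF H_G[OF psi_H[OF x]] H_G[OF psi_H[OF y]]] M.mu_comm[OF x y]
    by (simp add: psi_s scaleR_right_diff_distrib add.commute)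
  then show ?thesis using vsubspace_scale[OF X_subspace *] by (simp add: add.commute)
qed (use psi_mult_le[OF x y] in simp)

lemma psi_iota: assumes h: "h \<in> H i" shows "psi i (iota i h) = h"
proof -
  consider "i < 2 * r" | "2 * r \<le> i" "i \<le> 4 * r - 1" | "i > 4 * r - 1" by linarith
  then show ?thesis
  proof cases
    case 1 then show ?thesis using psi_low[of i h 0] h vsubspace_0[OF E_subspace] linear_0[OF wt_linear] by simp
  next
    case 2
    have "h - psi i (iota i h) = 0"
    proof (rule duality[of i "4 * r - 1 - i"])
      show "i + (4 * r - 1 - i) = 4 * r - 1" using 2 by simp
      then have ij: "i + (4 * r - 1 - i) = 4 * r - 1" .
      show "h - psi i (iota i h) \<in> H i" using h psi_H[OF iota_M[OF h]] H_subspace by (blast intro: vsubspace_diff)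
      fix k assume k: "k \<in> H (4 * r - 1 - i)"
      have "rr i h * rr (4 * r - 1 - i) k = 0" using 2 r2 by (auto simp: rr_def)
      then have "L (pm i (4 * r - 1 - i) (iota i h) (iota (4 * r - 1 - i) k)) = lam (m h k)"
        by (auto simp: L_def pmu_def iota_def Gam_s)
      then show "lam (m (h - psi i (iota i h)) k) = 0"
        using psi_high[OF 2(1) ij k, of "iota i h"] by (simp add: mu_diff_left lam_s)
    qed
    then show ?thesis by simp
  next
    case 3
    then show ?thesis using H_vanish[of i h] h linear_0[OF iota_linear] r2 by (simp add: psi_def)
  qed
qed

text \<open>
  The inclusion of harmonic elements induces all of the cohomology of \<open>M\<close>. In degree \<open>2 r - 1\<close> the
  differential detects the label \<open>s\<close> of \<open>(w s, s)\<close>. In degree \<open>2 r\<close> a cocycle has no \<open>Y\<close>-part, and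
  \<open>SN_dec\<close> splits off the differential of a labelled primitive. In degree \<open>2 r + 1\<close> labels of cocycles
  vanish and primitives can be taken in \<open>Y\<close>; above that the label algebra is acyclic.
\<close>

lemma M_closed: assumes x: "x \<in> M.Z i"
  obtains h where "h \<in> H i" "x - iota i h \<in> M.X i"
proof -
  have xM: "x \<in> M i" and xd: "dd i x = 0" using x by (auto simp: M.Z_def)
  have X0: "0 \<in> M.X i" by (rule vsubspace_0[OF M.X_subspace])
  consider "i < 2 * r - 1" | "i = 2 * r - 1" | "i = 2 * r" | "i > 2 * r" by linarith
  then show ?thesis
  proof cases
    case 1
    then show ?thesis using xM that X0 by (auto simp: M_lt)
  next
    case 2
    obtain h s where *: "h \<in> H i" "s \<in> E" "x = iota i h + wt s"
      using M_low[of i x] xM 2 by (metis order_refl)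
    have d: "dd i x = (ev s, s)" using dd_iota[OF *(1)] dd_wt[OF *(2)] 2 by (simp add: *(3) P.d_add)
    then have "s = 0" using xd by (simp add: zero_prod_def)
    then show ?thesis using that[of h] * X0 linear_0[OF wt_linear] by simp
  next
    case 3
    then obtain s x1 y where s: "s \<in> S" "x1 \<in> N" "y \<in> Y" "x = (ev s + x1 + y, s + tau y)" using xM unfolding 3 M_2r by auto
    have "D y = 0" using xd s Z_d[OF ev_Z] Z_d[OF N_Z] by (simp add: pd_def d_add zero_prod_def)
    then have y0: "y = 0" using Y_Z[OF s(3)] Y_G[OF s(3)] by (simp add: Z_def)
    obtain s' where s': "s' \<in> S" "ev s' \<in> X (2 * r)" "ev (s - s') + x1 \<in> H (2 * r)" "sig (ev (s - s') + x1) = s - s'"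
      using SN_dec[OF s(1,2)] by blast
    have "x = iota i (ev (s - s') + x1) + dd (2 * r - 1) (wt s')"
      using dd_wt[of s'] s' 3 r2 by (simp add: s(4) y0 iota_def rr_def ev_s tau_s E_def)
    moreover have "Suc (2 * r - 1) = i" using 3 r2 by simp
    moreover have "dd (2 * r - 1) (wt s') \<in> M.X (Suc (2 * r - 1))"
      by (rule M.d_X, rule wt_M) (use s' in \<open>simp add: E_def\<close>)
    ultimately show ?thesis using that[of "ev (s - s') + x1"] s' 3 by simp
  next
    case 4
    obtain z t where zt: "x = (z, t)" by (cases x)
    obtain k where k: "i = Suc k" using 4 by (cases i) auto
    have z: "z \<in> Z i" and t: "t \<in> FT r i" "dsc r i *\<^sub>R t = 0" using M_sub[OF xM] xd by (auto simp: zt pd_def zero_prod_def Z_def)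
    obtain h where h: "h \<in> H i" "z - h \<in> X i" using H_dec[OF z] by blast
    then obtain g where g: "g \<in> G k" "z - h = D g" by (auto simp: k X_Suc)
    have ih: "iota i h = (h, 0)" using 4 r2 by (simp add: iota_def rr_def)
    have "\<exists>p\<in>M k. dd k p = (D g, t)"
    proof (cases "k = 2 * r")
      case True
      have t0: "t = 0"
      proof (cases "r dvd Suc i")
        case True then show ?thesis using t(2) by (simp add: dsc_def)
      next
        case False
        have "\<not> r dvd i" using dvd_Suc_excl[OF r2, of "2 * r"] k True by simp
        then show ?thesis using t(1) False by (auto simp: FT_def split: if_splits)
      qed
      obtain y where y: "y \<in> Y" "g - y \<in> Z (2 * r)" using Y_dec g(1) True by blast
      have "D y = D g" using Z_d[OF y(2)] by (simp add: d_diff)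
      moreover have "(y, tau y) \<in> M k" unfolding True M_2r
        using y(1) vsubspace_0[OF S_subspace] vsubspace_0[OF N_subspace] by (force simp: ev_s)
      moreover have "dsc r k = 0" using True dvd_Suc_excl[OF r2, of "2 * r"] by (simp add: dsc_def)
      ultimately show ?thesis using t0 by (intro bexI[of _ "(y, tau y)"]) (simp_all add: pd_def)
    next
      case False
      then have k2: "k > 2 * r" using 4 k by simp
      show ?thesis
      proof (cases "t = 0")
        case True
        then show ?thesis using g M_gt[OF k2] vsubspace_0[OF FT_subspace[of r k]] by (intro bexI[of _ "(g, 0)"]) (auto simp: pd_def)
      next
        case False
        then have "\<not> r dvd Suc i" using t(2) by (auto simp: dsc_def)
        then have "even r" "r dvd i" using t(1) False by (auto simp: FT_def split: if_splits)
        then have "t \<in> FT r k" "dsc r k = 1" using k by (auto simp: FT_def dsc_def)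
        then show ?thesis using g M_gt[OF k2] by (intro bexI[of _ "(g, t)"]) (auto simp: pd_def)
      qed
    qed
    then have "(D g, t) \<in> M.X i" using M.d_X k by metis
    moreover have "x - iota i h = (D g, t)" using g(2) by (simp add: zt ih)
    ultimately show ?thesis using that[OF h(1)] by simp
  qed
qed

lemma iota_Z: "h \<in> H i \<Longrightarrow> iota i h \<in> M.Z i"
  using iota_M dd_iota by (simp add: M.Z_def)

end

section \<open>Poincare duality supplies the data\<close>

text \<open>
  The hypotheses of the theorem for a typed model, without choice of representatives: \<open>phi_inj\<close> is
  injectivity of multiplication by the class of \<open>phi\<close>, and \<open>betti\<close> bounds the dimension of the
  cohomology in degree \<open>r\<close> by three.
\<close>

locale typed_poincare = integrated_gdga G m D e r lam
  for G :: "nat \<Rightarrow> 'v::real_vector set" and m :: "'v \<Rightarrow> 'v \<Rightarrow> 'v" and D :: "'v \<Rightarrow> 'v" and e :: 'v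
    and r :: nat and lam :: "'v \<Rightarrow> real" +
  fixes phi :: 'v
  assumes e_nz: "e \<noteq> 0" and Z_0: "z \<in> Z 0 \<Longrightarrow> \<exists>c. z = c *\<^sub>R e"
    and conn: "0 < i \<Longrightarrow> i < r \<Longrightarrow> z \<in> Z i \<Longrightarrow> z \<in> X i"
    and pdual: "i + j = 4 * r - 1 \<Longrightarrow> z \<in> Z i \<Longrightarrow> (\<And>y. y \<in> Z j \<Longrightarrow> lam (m z y) = 0) \<Longrightarrow> z \<in> X i"
    and high: "i > 4 * r - 1 \<Longrightarrow> z \<in> Z i \<Longrightarrow> z \<in> X i"
    and fin: "\<exists>T. finite T \<and> T \<subseteq> Z i \<and> (\<forall>z\<in>Z i. \<exists>t\<in>span T. z - t \<in> X i)"
    and phi_Z: "phi \<in> Z (2 * r - 1)"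
    and phi_inj: "z \<in> Z r \<Longrightarrow> m phi z \<in> X (3 * r - 1) \<Longrightarrow> z \<in> X r"
    and betti: "\<exists>T. finite T \<and> card T \<le> 3 \<and> T \<subseteq> Z r \<and> (\<forall>z\<in>Z r. \<exists>t\<in>span T. z - t \<in> X r)"
begin

lemmas lam_s = linear_add[OF lam_linear] linear_diff[OF lam_linear] linear_scale[OF lam_linear] linear_0[OF lam_linear]

text \<open>
  The projection along the coboundaries carries spanning sets of the cohomology to spanning sets of any
  space of representatives.
\<close>

lemma complement_span:
  assumes C: "vsubspace C" "C \<subseteq> Z i" "\<And>x. x \<in> C \<Longrightarrow> x \<in> X i \<Longrightarrow> x = 0"
    and dec: "\<And>z. z \<in> Z i \<Longrightarrow> \<exists>h\<in>C. z - h \<in> X i"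
    and T: "finite T" "T \<subseteq> Z i" "\<forall>z\<in>Z i. \<exists>t\<in>span T. z - t \<in> X i"
  shows "\<exists>T'. finite T' \<and> card T' \<le> card T \<and> C = span T'"
proof -
  obtain g where g: "linear g" "\<And>x. x \<in> C \<Longrightarrow> g x = x" "\<And>x. x \<in> X i \<Longrightarrow> g x = 0" "\<And>x. g x \<in> C"
    using exists_projection_along[OF C(1) X_subspace C(3)] by blast
  have "C = span (g ` T)"
  proof
    show "span (g ` T) \<subseteq> C" by (rule real_vector.span_minimal[OF _ C(1)]) (use g in auto)
    show "C \<subseteq> span (g ` T)"
    proof
      fix c assume c: "c \<in> C"
      then obtain t where t: "t \<in> span T" "c - t \<in> X i" using T(3) C(2) by blast
      have "g (c - t) = 0" using g(3) t by blast
      then have "c = g t" using g(2)[OF c] linear_diff[OF g(1), of c t] by simp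
      then show "c \<in> span (g ` T)" using t linear_span_image[OF g(1)] by blast
    qed
  qed
  then show ?thesis using T(1) card_image_le[OF T(1), of g] by blast
qed

text \<open>
  By duality, vanishing in the degrees between \<open>0\<close> and \<open>r\<close> implies vanishing between \<open>3 r - 1\<close> and
  \<open>4 r - 1\<close>.
\<close>

lemma gap: assumes "3 * r - 1 < i" "i < 4 * r - 1" "z \<in> Z i" shows "z \<in> X i"
proof (rule pdual[of i "4 * r - 1 - i"])
  fix y assume "y \<in> Z (4 * r - 1 - i)"
  then have "y \<in> X (4 * r - 1 - i)" using conn[of "4 * r - 1 - i"] assms r2 by auto
  then show "lam (m z y) = 0" using lam_X(2)[of "4 * r - 1 - i" i y z] assms by simp
qed (use assms in auto)

end

text \<open>
  \<open>V\<close> is a space of harmonic representatives in degree \<open>r\<close>.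
\<close>

locale middle_degree = typed_poincare +
  fixes V
  assumes V_subspace: "vsubspace V" and V_Z: "x \<in> V \<Longrightarrow> x \<in> Z r" and V_X: "x \<in> V \<Longrightarrow> x \<in> X r \<Longrightarrow> x = 0"
    and V_dec: "z \<in> Z r \<Longrightarrow> \<exists>h\<in>V. z - h \<in> X r"
begin

definition q where "q a b = lam (m phi (m a b))"

lemma q_bilinear: "bilinear q"
  unfolding q_def by (rule bilinearI) (simp_all add: mu_add_left mu_add_right mu_scale_left mu_scale_right lam_s)

lemmas qs = bilinear_ladd[OF q_bilinear] bilinear_radd[OF q_bilinear] bilinear_lmul[OF q_bilinear] bilinear_rmul[OF q_bilinear]
    bilinear_lsub[OF q_bilinear] bilinear_rsub[OF q_bilinear] bilinear_lneg[OF q_bilinear] bilinear_rneg[OF q_bilinear]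

lemma V_G: "a \<in> V \<Longrightarrow> a \<in> G r" using V_Z Z_G by blast

lemma V_m: "a \<in> V \<Longrightarrow> b \<in> V \<Longrightarrow> m a b \<in> Z (2 * r)"
  using mu_Z[OF V_Z V_Z] by (simp add: mult_2)

text \<open>
  If \<open>q a\<close> vanishes, then \<open>phi a\<close> pairs to zero with all of degree \<open>r\<close> and is exact by duality, hence
  \<open>a\<close> is exact by injectivity of multiplication by \<open>phi\<close>.
\<close>

lemma q_nondeg: assumes a: "a \<in> V" and "\<And>b. b \<in> V \<Longrightarrow> q a b = 0" shows "a = 0"
proof (rule V_X[OF a], rule phi_inj[OF V_Z[OF a]])
  have 3: "2 * r - 1 + r = 3 * r - 1" using r2 by simp
  have pa: "m phi a \<in> Z (3 * r - 1)" using mu_Z[OF phi_Z V_Z[OF a]] 3 by simp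
  show "m phi a \<in> X (3 * r - 1)"
  proof (rule pdual[of _ r])
    show "3 * r - 1 + r = 4 * r - 1" using r2 by simp
    then have 4: "r + (3 * r - 1) = 4 * r - 1" by simp
    fix y assume y: "y \<in> Z r"
    obtain h where h: "h \<in> V" "y - h \<in> X r" using V_dec[OF y] by blast
    have "lam (m (m phi a) (y - h)) = 0" using lam_X(2)[OF 4 h(2) pa] .
    moreover have "m (m phi a) h = m phi (m a h)"
      using mu_assoc[OF Z_G[OF phi_Z] V_G[OF a] V_G[OF h(1)]] .
    ultimately show "lam (m (m phi a) y) = 0" using assms(2)[OF h(1)]
      by (simp add: mu_diff_right lam_s q_def)
  qed (rule pa)
qed

lemma m_VV: "a \<in> V \<Longrightarrow> b \<in> V \<Longrightarrow> m a b = (-1) ^ r *\<^sub>R m b a"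
  using mm_comm[OF V_G V_G, of a b] by (cases "even r") auto

lemma lam_phi_X: "x \<in> X (2 * r) \<Longrightarrow> lam (m phi x) = 0"
  using lam_X(2)[of "2 * r" "2 * r - 1" x phi] phi_Z r2 by simp

lemma V_span: "\<exists>T. finite T \<and> card T \<le> 3 \<and> V = span T"
proof -
  obtain T where T: "finite T" "card T \<le> 3" "T \<subseteq> Z r" "\<forall>z\<in>Z r. \<exists>t\<in>span T. z - t \<in> X r" using betti by blast
  obtain T' where "finite T'" "card T' \<le> card T" "V = span T'"
    using complement_span[OF V_subspace _ V_X V_dec T(1,3,4)] V_Z by blast
  then show ?thesis using T(2) le_trans by blast
qed

text \<open>
  For odd \<open>r\<close> the form \<open>q\<close> is skew. Choose a hyperbolic pair \<open>u, v\<close>. If \<open>V\<close> were larger than their span,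
  the orthogonal complement would contain another hyperbolic pair and the dimension would be at least
  four. So all products are multiples of \<open>m u v\<close>, on which \<open>\<integral> \<phi>\<close> takes the value one, and none but zero
  is exact.
\<close>

lemma odd_products: assumes odd: "odd r" and x: "x \<in> span {m a b |a b. a \<in> V \<and> b \<in> V}" "x \<in> X (2 * r)"
  shows "x = 0"
proof (cases "V = {0}")
  case True
  have "{m a b |a b. a \<in> V \<and> b \<in> V} \<subseteq> {0}" by (auto simp: True mu_0_left)
  then have "span {m a b |a b. a \<in> V \<and> b \<in> V} \<subseteq> span {0}" by (rule real_vector.span_mono)
  then show ?thesis using x by auto
next
  case False
  then obtain u where u: "u \<in> V" "u \<noteq> 0" using vsubspace_0[OF V_subspace] by blast
  have mskew: "m a b = - m b a" if "a \<in> V" "b \<in> V" for a b using m_VV[OF that] odd by simp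
  have m0: "m a a = 0" if "a \<in> V" for a

  proof -
    have "m a a + m a a = 0" by (subst (1) mskew[OF that that]) simp
    then have "2 *\<^sub>R m a a = 0" by (simp only: scaleR_2)
    then show ?thesis by simp
  qed
  have skew: "q a b = - q b a" if "a \<in> V" "b \<in> V" for a b
    unfolding q_def by (subst mskew[OF that]) (simp add: linear_neg[OF mu_linear2] linear_neg[OF lam_linear])
  have q0: "q a a = 0" if "a \<in> V" for a using skew[OF that that] by simp
  obtain v0 where v0: "v0 \<in> V" "q u v0 \<noteq> 0" using q_nondeg[OF u(1)] u(2) by blast
  define v where "v = (1 / q u v0) *\<^sub>R v0"
  have v: "v \<in> V" "q u v = 1" "q v u = -1"
  proof -
    show *: "v \<in> V" unfolding v_def by (rule vsubspace_scale[OF V_subspace v0(1)])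
    show "q u v = 1" using v0(2) by (simp add: v_def qs)
    then show "q v u = -1" using skew[OF * u(1)] by simp
  qed
  \<comment> \<open>The projection to the orthogonal complement of the hyperbolic pair.\<close>
  define P where "P = (\<lambda>w. w - q w v *\<^sub>R u + q w u *\<^sub>R v)"
  have PV: "P w \<in> V" if "w \<in> V" for w
    unfolding P_def using that u v V_subspace by (intro vsubspace_add vsubspace_diff vsubspace_scale)
  have Pq: "q (P w) u = 0" "q (P w) v = 0" "q u (P w) = 0" "q v (P w) = 0" if "w \<in> V" for w
  proof -
    show "q (P w) u = 0" "q (P w) v = 0" using v q0[OF u(1)] q0[OF v(1)] by (simp_all add: P_def qs)
    then show "q u (P w) = 0" "q v (P w) = 0" using skew[OF u(1) PV[OF that]] skew[OF v(1) PV[OF that]] by auto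
  qed
  have P0: "P w = 0" if w: "w \<in> V" for w
  proof (rule ccontr)
    assume "P w \<noteq> 0"
    then obtain w' where w': "w' \<in> V" "q (P w) w' \<noteq> 0" using q_nondeg[OF PV[OF w]] by blast
    have qq: "q (P w) (P w') \<noteq> 0"
    proof -
      have "q (P w) (P w') = q (P w) w'" unfolding P_def[THEN fun_cong, of w'] by (simp add: qs Pq[OF w])
      then show ?thesis using w' by simp
    qed
    have l1: "linear (q a)" and l2: "linear (\<lambda>b. q b a)" for a using q_bilinear by (auto simp: bilinear_def)
    have sp: "x \<notin> span B" if "linear f" "\<And>y. y \<in> B \<Longrightarrow> f y = 0" "f x \<noteq> 0" for f :: "'a \<Rightarrow> real" and B x
      using linear_eq_0_on_span[OF that(1,2), of B x] that(3) by blast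
    have i1: "P w' \<noteq> 0" using qq bilinear_rzero[OF q_bilinear] by auto
    have i2: "P w \<notin> span {P w'}"
      by (rule sp[OF l2[of "P w'"]]) (use q0[OF PV[OF w'(1)]] qq in auto)
    have i3: "v \<notin> span {P w, P w'}"
      by (rule sp[OF l1[of u]]) (use Pq[OF w] Pq[OF w'(1)] v(2) in auto)
    have i4: "u \<notin> span {v, P w, P w'}"
      by (rule sp[OF l2[of v]]) (use Pq[OF w] Pq[OF w'(1)] v(2) q0[OF v(1)] in auto)
    have nb: "x \<notin> B" if "x \<notin> span B" for x and B :: "'a set" using that by (blast intro: real_vector.span_base)
    note ne = nb[OF i4] nb[OF i3] nb[OF i2]
    have ind: "independent {u, v, P w, P w'}"
      using i1 i2 i3 i4 ne by (simp add: real_vector.independent_insert)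
    have "card {u, v, P w, P w'} = 4" using ne by (simp add: card_insert_if)
    moreover obtain T where T: "finite T" "card T \<le> 3" "V = span T" using V_span by blast
    moreover have "{u, v, P w, P w'} \<subseteq> span T" using u v PV[OF w] PV[OF w'(1)] T(3) by simp
    ultimately show False using real_vector.independent_span_bound[OF T(1) ind] by simp
  qed
  have "{m a b |a b. a \<in> V \<and> b \<in> V} \<subseteq> span {m u v}"
  proof
    fix y assume "y \<in> {m a b |a b. a \<in> V \<and> b \<in> V}"
    then obtain a b where ab: "a \<in> V" "b \<in> V" "y = m a b" by blast
    have a: "a = q a v *\<^sub>R u - q a u *\<^sub>R v"
    proof -
      have "P a = a - (q a v *\<^sub>R u - q a u *\<^sub>R v)" by (simp add: P_def)
      then have "a - (q a v *\<^sub>R u - q a u *\<^sub>R v) = 0" using P0[OF ab(1)] by (simp only:)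
      then show ?thesis by (rule eq_iff_diff_eq_0[THEN iffD2])
    qed
    have b: "b = q b v *\<^sub>R u - q b u *\<^sub>R v"
    proof -
      have "P b = b - (q b v *\<^sub>R u - q b u *\<^sub>R v)" by (simp add: P_def)
      then have "b - (q b v *\<^sub>R u - q b u *\<^sub>R v) = 0" using P0[OF ab(2)] by (simp only:)
      then show ?thesis by (rule eq_iff_diff_eq_0[THEN iffD2])
    qed
    have "y = m (q a v *\<^sub>R u - q a u *\<^sub>R v) (q b v *\<^sub>R u - q b u *\<^sub>R v)" unfolding ab(3) by (rule arg_cong2[OF a b])
    also have "\<dots> = (q a u * q b v - q a v * q b u) *\<^sub>R m u v"
      using mskew[OF v(1) u(1)] m0[OF u(1)] m0[OF v(1)]
      by (simp add: mu_diff_left mu_diff_right mu_scale_left mu_scale_right algebra_simps)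
    finally show "y \<in> span {m u v}" by (simp add: real_vector.span_scale real_vector.span_base)
  qed
  then have "x \<in> span {m u v}" using x(1) real_vector.span_minimal[OF _ real_vector.subspace_span] by blast
  then obtain c where c: "x = c *\<^sub>R m u v" by (auto simp: real_vector.span_singleton)
  then have "lam (m phi x) = c" using v(2) by (simp add: mu_scale_right lam_s q_def)
  then show ?thesis using lam_phi_X[OF x(2)] c by simp
qed

text \<open>
  Labels \<open>rho\<close>, evaluation \<open>ev\<close>, quadratic labels \<open>S\<close> and the functional \<open>Gam\<close> relative to a choice \<open>om\<close>
  of primitives: on exact relations \<open>Gam\<close> computes the Massey form, and every bilinear function of a
  quadratic label and a second argument \<open>y\<close> is obtained by pairing with a label \<open>\<tau> y\<close> under \<open>Gam\<close>.
\<close>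

definition alg_data :: "('a \<Rightarrow> 'a) \<Rightarrow> ('a \<Rightarrow> nat \<Rightarrow>\<^sub>0 real) \<Rightarrow> ((nat \<Rightarrow>\<^sub>0 real) \<Rightarrow> 'a) \<Rightarrow> (nat \<Rightarrow>\<^sub>0 real) set
    \<Rightarrow> ((nat \<Rightarrow>\<^sub>0 real) \<Rightarrow> real) \<Rightarrow> bool" where
  "alg_data om rho ev S Gam \<longleftrightarrow> linear rho \<and> linear ev \<and> linear Gam \<and> vsubspace S \<and>
    (\<forall>s\<in>S. ev s \<in> Z (2 * r)) \<and> (\<forall>a\<in>V. \<forall>b\<in>V. rho a * rho b \<in> S) \<and>
    (even r \<longrightarrow> (\<forall>a\<in>V. \<forall>b\<in>V. m a b = ev (rho a * rho b))) \<and>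
    (odd r \<longrightarrow> S = {0} \<and> (\<forall>v. rho v = 0)) \<and>
    (\<forall>s\<in>S. \<forall>t\<in>S. ev s \<in> X (2 * r) \<longrightarrow> ev t \<in> X (2 * r) \<longrightarrow> Gam (s * t) = lam (m (om (ev s)) (ev t))) \<and>
    (\<forall>\<kappa> :: (nat \<Rightarrow>\<^sub>0 real) \<Rightarrow> 'a \<Rightarrow> real. bilinear \<kappa> \<longrightarrow>
      (\<exists>\<tau>. linear \<tau> \<and> (odd r \<longrightarrow> (\<forall>y. \<tau> y = 0)) \<and> (\<forall>s\<in>S. \<forall>y. Gam (s * \<tau> y) = \<kappa> s y)))"

text \<open>
  Diagonalise \<open>q\<close>, label the members of the orthogonal basis by the three variables and let \<open>S\<close> be the
  quadratic polynomials in them. The Massey form on exact relations is symmetric because the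
  differential of \<open>(om s) (om t)\<close> has integral zero. An exact relation satisfies
  \<open>\<Sum> q (a\<^sub>i, a\<^sub>i) c\<^sub>i\<^sub>i = 0\<close>, so \<open>quartic_functional\<close> applies.
\<close>

lemma even_data:
  assumes even: "even r" and om: "linear om" "\<And>x. om x \<in> G (2 * r - 1)" "\<And>x. x \<in> X (2 * r) \<Longrightarrow> D (om x) = x"
  obtains rho ev S Gam where "alg_data om rho ev S Gam"
proof -
  have qsym: "q a b = q b a" if "a \<in> V" "b \<in> V" for a b using m_VV[OF that] even by (simp add: q_def)
  obtain T where T: "finite T" "card T \<le> 3" "V = span T" using V_span by blast
  obtain a where a: "V = span (a ` {..<3::nat})" "\<forall>i<3. \<forall>j<3. i \<noteq> j \<longrightarrow> q (a i) (a j) = 0"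
    using orthogonal_basis[OF q_bilinear T(1,2) T(3)[symmetric] qsym] by blast
  define a0 a1 a2 where "a0 = a 0" and "a1 = a 1" and "a2 = a 2"
  have V3: "V = span {a0, a1, a2}"
    using a(1) by (simp add: a0_def a1_def a2_def numeral_3_eq_3 lessThan_Suc insert_commute numeral_2_eq_2)
  have orth: "q a0 a1 = 0" "q a1 a0 = 0" "q a0 a2 = 0" "q a2 a0 = 0" "q a1 a2 = 0" "q a2 a1 = 0"
    using a(2) by (simp_all add: a0_def a1_def a2_def)
  have aV: "a0 \<in> V" "a1 \<in> V" "a2 \<in> V" by (auto simp: V3 real_vector.span_base)
  have repr: "\<exists>c0 c1 c2. v = c0 *\<^sub>R a0 + c1 *\<^sub>R a1 + c2 *\<^sub>R a2" if vV: "v \<in> V" for v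
  proof -
    obtain c0 where "v - c0 *\<^sub>R a0 \<in> span {a1, a2}" using vV by (auto simp: V3 real_vector.span_insert[of a0])
    moreover then obtain c1 where "v - c0 *\<^sub>R a0 - c1 *\<^sub>R a1 \<in> span {a2}" by (auto simp: real_vector.span_insert[of a1])
    moreover then obtain c2 where "v - c0 *\<^sub>R a0 - c1 *\<^sub>R a1 = c2 *\<^sub>R a2" by (auto simp: real_vector.span_singleton)
    ultimately have "v = c0 *\<^sub>R a0 + c1 *\<^sub>R a1 + c2 *\<^sub>R a2" by (simp add: algebra_simps)
    then show ?thesis by blast
  qed
  have nz: "b = 0" if b: "b \<in> V" "q b b = 0" "b = a0 \<or> b = a1 \<or> b = a2" for b
  proof (rule q_nondeg[OF b(1)])
    fix y assume "y \<in> V"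
    then obtain c0 c1 c2 where "y = c0 *\<^sub>R a0 + c1 *\<^sub>R a1 + c2 *\<^sub>R a2" using repr by blast
    then show "q b y = 0" using b(2,3) orth by (auto simp: qs)
  qed
  define q0 q1 q2 where "q0 = q a0 a0" and "q1 = q a1 a1" and "q2 = q a2 a2"
  have qz: "q0 = 0 \<Longrightarrow> a0 = 0" "q1 = 0 \<Longrightarrow> a1 = 0" "q2 = 0 \<Longrightarrow> a2 = 0"
    using nz aV by (auto simp: q0_def q1_def q2_def)
  have qz': "a0 = 0 \<Longrightarrow> q0 = 0" "a1 = 0 \<Longrightarrow> q1 = 0" "a2 = 0 \<Longrightarrow> q2 = 0"
    using bilinear_lzero[OF q_bilinear] by (auto simp: q0_def q1_def q2_def)
  \<comment> \<open>The exponents \<open>1\<close>, \<open>5\<close>, \<open>25\<close> stand for the three variables. If a basis vector is zero, so is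
    the corresponding \<open>q\<^sub>i\<close>, and division by zero assigns it the label zero.\<close>
  define rho :: "'a \<Rightarrow> nat \<Rightarrow>\<^sub>0 real" where
    "rho = (\<lambda>v. (q v a0 / q0) *\<^sub>R mon 1 + (q v a1 / q1) *\<^sub>R mon 5 + (q v a2 / q2) *\<^sub>R mon 25)"
  have rho: "linear rho" unfolding rho_def
    by (rule linearI) (simp_all add: qs add_divide_distrib scaleR_left_distrib scaleR_right_distrib)
  define ev :: "(nat \<Rightarrow>\<^sub>0 real) \<Rightarrow> 'a" where "ev = (\<lambda>p. Poly_Mapping.lookup p 2 *\<^sub>R m a0 a0 + Poly_Mapping.lookup p 10 *\<^sub>R m a1 a1
     + Poly_Mapping.lookup p 50 *\<^sub>R m a2 a2 + Poly_Mapping.lookup p 6 *\<^sub>R m a0 a1 + Poly_Mapping.lookup p 26 *\<^sub>R m a0 a2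
     + Poly_Mapping.lookup p 30 *\<^sub>R m a1 a2)"
  have ev: "linear ev" unfolding ev_def
    by (rule linearI) (simp_all add: lookup_add scaleR_left_distrib scaleR_right_distrib)
  have ev_quad: "ev (quad c00 c11 c22 c01 c02 c12) = c00 *\<^sub>R m a0 a0 + c11 *\<^sub>R m a1 a1 + c22 *\<^sub>R m a2 a2
     + c01 *\<^sub>R m a0 a1 + c02 *\<^sub>R m a0 a2 + c12 *\<^sub>R m a1 a2" for c00 c11 c22 c01 c02 c12
    by (simp add: ev_def quad_def lookup_add lookup_single)
  \<comment> \<open>Coefficients of squares of zero vectors are excluded: they would break the equation that exact
    relations have to satisfy with nonzero coefficients \<open>p\<^sub>i\<close> below.\<close>
  define S where "S = {quad c00 c11 c22 c01 c02 c12 | c00 c11 c22 c01 c02 c12.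
     (a0 = 0 \<longrightarrow> c00 = 0) \<and> (a1 = 0 \<longrightarrow> c11 = 0) \<and> (a2 = 0 \<longrightarrow> c22 = 0)}"
  have SI: "quad c00 c11 c22 c01 c02 c12 \<in> S" if "a0 = 0 \<Longrightarrow> c00 = 0" "a1 = 0 \<Longrightarrow> c11 = 0" "a2 = 0 \<Longrightarrow> c22 = 0"
    for c00 c11 c22 c01 c02 c12 unfolding S_def using that by blast
  have SE: "\<exists>c00 c11 c22 c01 c02 c12. s = quad c00 c11 c22 c01 c02 c12 \<and>
     (a0 = 0 \<longrightarrow> c00 = 0) \<and> (a1 = 0 \<longrightarrow> c11 = 0) \<and> (a2 = 0 \<longrightarrow> c22 = 0)" if "s \<in> S" for s
    using that unfolding S_def by blast
  have quad_add: "quad c00 c11 c22 c01 c02 c12 + quad d00 d11 d22 d01 d02 d12 =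
    quad (c00 + d00) (c11 + d11) (c22 + d22) (c01 + d01) (c02 + d02) (c12 + d12)" for c00 c11 c22 c01 c02 c12 d00 d11 d22 d01 d02 d12
    by (simp add: quad_def scaleR_left_distrib)
  have quad_scale: "c *\<^sub>R quad c00 c11 c22 c01 c02 c12 =
    quad (c * c00) (c * c11) (c * c22) (c * c01) (c * c02) (c * c12)" for c c00 c11 c22 c01 c02 c12
    by (simp add: quad_def scaleR_right_distrib)
  have S: "vsubspace S"
  proof (rule real_vector.subspaceI)
    have "0 = quad 0 0 0 0 0 0" by (simp add: quad_def)
    then show "0 \<in> S" unfolding S_def by blast
    show "x + y \<in> S" if xy: "x \<in> S" "y \<in> S" for x y
    proof -
      obtain c00 c11 c22 c01 c02 c12 where c: "x = quad c00 c11 c22 c01 c02 c12"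
        "a0 = 0 \<longrightarrow> c00 = 0" "a1 = 0 \<longrightarrow> c11 = 0" "a2 = 0 \<longrightarrow> c22 = 0"
        using SE[OF xy(1)] by blast
      obtain d00 d11 d22 d01 d02 d12 where d: "y = quad d00 d11 d22 d01 d02 d12"
        "a0 = 0 \<longrightarrow> d00 = 0" "a1 = 0 \<longrightarrow> d11 = 0" "a2 = 0 \<longrightarrow> d22 = 0"
        using SE[OF xy(2)] by blast
      show ?thesis unfolding c(1) d(1) quad_add by (rule SI) (use c d in auto)
    qed
    show "c *\<^sub>R x \<in> S" if x: "x \<in> S" for c x
    proof -
      obtain c00 c11 c22 c01 c02 c12 where *: "x = quad c00 c11 c22 c01 c02 c12"
        "a0 = 0 \<longrightarrow> c00 = 0" "a1 = 0 \<longrightarrow> c11 = 0" "a2 = 0 \<longrightarrow> c22 = 0" using SE[OF x] by blast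
      show ?thesis unfolding *(1) quad_scale by (rule SI) (use * in auto)
    qed
  qed
  have evZ: "ev s \<in> Z (2 * r)" for s
    unfolding ev_def by (intro vsubspace_add[OF Z_subspace] vsubspace_scale[OF Z_subspace] V_m aV)
  have rho_repr: "\<exists>c0 c1 c2. v = c0 *\<^sub>R a0 + c1 *\<^sub>R a1 + c2 *\<^sub>R a2 \<and> rho v = c0 *\<^sub>R mon 1 + c1 *\<^sub>R mon 5 + c2 *\<^sub>R mon 25
      \<and> (a0 = 0 \<longrightarrow> c0 = 0) \<and> (a1 = 0 \<longrightarrow> c1 = 0) \<and> (a2 = 0 \<longrightarrow> c2 = 0)" if v: "v \<in> V" for v
  proof -
    obtain c0 c1 c2 where c: "v = c0 *\<^sub>R a0 + c1 *\<^sub>R a1 + c2 *\<^sub>R a2" using repr[OF v] by blast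
    have "q v a0 = c0 * q0" "q v a1 = c1 * q1" "q v a2 = c2 * q2" using orth by (simp_all add: c qs q0_def q1_def q2_def)
    then have "v = (q v a0 / q0) *\<^sub>R a0 + (q v a1 / q1) *\<^sub>R a1 + (q v a2 / q2) *\<^sub>R a2"
      using c qz by (cases "q0 = 0"; cases "q1 = 0"; cases "q2 = 0") simp_all
    then show ?thesis using qz' by (intro exI[of _ "q v a0 / q0"] exI[of _ "q v a1 / q1"] exI[of _ "q v a2 / q2"]) (auto simp: rho_def)
  qed
  have prod: "rho x * rho y \<in> S \<and> m x y = ev (rho x * rho y)" if x: "x \<in> V" and y: "y \<in> V" for x y
  proof -
    obtain c0 c1 c2 where c: "x = c0 *\<^sub>R a0 + c1 *\<^sub>R a1 + c2 *\<^sub>R a2" "rho x = c0 *\<^sub>R mon 1 + c1 *\<^sub>R mon 5 + c2 *\<^sub>R mon 25"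
      "a0 = 0 \<longrightarrow> c0 = 0" "a1 = 0 \<longrightarrow> c1 = 0" "a2 = 0 \<longrightarrow> c2 = 0" using rho_repr[OF x] by blast
    obtain d0 d1 d2 where d: "y = d0 *\<^sub>R a0 + d1 *\<^sub>R a1 + d2 *\<^sub>R a2" "rho y = d0 *\<^sub>R mon 1 + d1 *\<^sub>R mon 5 + d2 *\<^sub>R mon 25"
      using rho_repr[OF y] by blast
    have *: "rho x * rho y = quad (c0 * d0) (c1 * d1) (c2 * d2) (c0 * d1 + c1 * d0) (c0 * d2 + c2 * d0) (c1 * d2 + c2 * d1)"
      unfolding c(2) d(2) by (simp add: quad_def distrib_left distrib_right pm_scale_left pm_scale_right mult_single scaleR_left_distrib mult.commute flip: numeral_2_eq_2)
    have ms: "m a1 a0 = m a0 a1" "m a2 a0 = m a0 a2" "m a2 a1 = m a1 a2"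
      using m_VV[OF aV(2) aV(1)] m_VV[OF aV(3) aV(1)] m_VV[OF aV(3) aV(2)] even by auto
    have "m x y = ev (rho x * rho y)" unfolding * ev_quad
      by (simp add: c(1) d(1) mu_add_left mu_add_right mu_scale_left mu_scale_right ms scaleR_left_distrib scaleR_right_distrib mult.commute)
    moreover have "rho x * rho y \<in> S" unfolding * by (rule SI) (use c(3-5) in auto)
    ultimately show ?thesis by blast
  qed
  define E where "E = {s \<in> S. ev s \<in> X (2 * r)}"
  have E: "vsubspace E" using S X_subspace[of "2 * r"]
    by (auto simp: E_def real_vector.subspace_def linear_add[OF ev] linear_scale[OF ev] linear_0[OF ev])
  \<comment> \<open>The Massey form is extended from exact relations to all labels by a projection.\<close>
  obtain pE where pE: "linear pE" "\<And>x. pE x \<in> E" "\<And>x. x \<in> E \<Longrightarrow> pE x = x" using exists_projection[OF E] by blast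
  define f where "f = (\<lambda>s t. lam (m (om (ev (pE s))) (ev (pE t))))"
  have f: "bilinear f" unfolding f_def
    by (rule bilinearI) (simp_all add: linear_add[OF ev] linear_scale[OF ev] linear_add[OF om(1)] linear_scale[OF om(1)]
        linear_add[OF pE(1)] linear_scale[OF pE(1)] mu_add_left mu_add_right mu_scale_left mu_scale_right lam_s)
  have fsym: "f s t = f t s" for s t
  proof -
    let ?w = "om (ev (pE s))" and ?v = "om (ev (pE t))"
    have dw: "D ?w = ev (pE s)" "D ?v = ev (pE t)" using om(3) pE(2) by (auto simp: E_def)
    have sc: "Suc (2 * r - 1) = 2 * r" "2 * r - 1 + (2 * r - 1) = 4 * r - 2" using r2 by auto
    have "D (m ?w ?v) = m (ev (pE s)) ?v - m ?w (ev (pE t))"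
      using d_mu[OF om(2) om(2), of "ev (pE s)" "ev (pE t)"] r2 dw by simp
    moreover have "m ?w ?v \<in> G (4 * r - 2)" using mu_G[OF om(2) om(2)] sc by metis
    ultimately have "lam (m (ev (pE s)) ?v) = lam (m ?w (ev (pE t)))" using lam_D by (metis lam_s(2) eq_iff_diff_eq_0)
    moreover have "m (ev (pE s)) ?v = m ?v (ev (pE s))" using mm_comm[OF Z_G[OF evZ] om(2)] by simp
    ultimately show ?thesis by (simp add: f_def)
  qed
  \<comment> \<open>Zero basis vectors get a dummy nonzero coefficient; the corresponding \<open>c\<^sub>i\<^sub>i\<close> vanishes on \<open>S\<close>.\<close>
  define p0 p1 p2 where "p0 = (if a0 = 0 then 1 else q0)" and "p1 = (if a1 = 0 then 1 else q1)" and "p2 = (if a2 = 0 then 1 else q2)"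
  have pnz: "p0 \<noteq> 0" "p1 \<noteq> 0" "p2 \<noteq> 0" using qz by (auto simp: p0_def p1_def p2_def)
  have Equad: "\<exists>c00 c11 c22 c01 c02 c12. s = quad c00 c11 c22 c01 c02 c12 \<and> p0 * c00 + p1 * c11 + p2 * c22 = 0" if "s \<in> E" for s
  proof -
    have "s \<in> S" using that by (simp add: E_def)
    then obtain c00 c11 c22 c01 c02 c12 where *: "s = quad c00 c11 c22 c01 c02 c12"
        "a0 = 0 \<longrightarrow> c00 = 0" "a1 = 0 \<longrightarrow> c11 = 0" "a2 = 0 \<longrightarrow> c22 = 0" using SE by blast
    have "lam (m phi (ev s)) = 0" using that lam_phi_X by (simp add: E_def)
    then have "c00 * q0 + c11 * q1 + c22 * q2 = 0"
      using orth by (simp add: *(1) ev_quad mu_add_right mu_scale_right lam_s q_def[symmetric] q0_def q1_def q2_def)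
    then have "p0 * c00 + p1 * c11 + p2 * c22 = 0"
      using *(2-4) by (auto simp: p0_def p1_def p2_def mult.commute)
    then show ?thesis using *(1) by blast
  qed
  show ?thesis
  proof (rule quartic_functional[OF f fsym pnz])
    fix Gam :: "(nat \<Rightarrow>\<^sub>0 real) \<Rightarrow> real" assume Gam: "linear Gam" "\<And>c00 c11 c22 c01 c02 c12 e00 e11 e22 e01 e02 e12.
       p0 * c00 + p1 * c11 + p2 * c22 = 0 \<Longrightarrow> p0 * e00 + p1 * e11 + p2 * e22 = 0 \<Longrightarrow>
       Gam (quad c00 c11 c22 c01 c02 c12 * quad e00 e11 e22 e01 e02 e12) =
       f (quad c00 c11 c22 c01 c02 c12) (quad e00 e11 e22 e01 e02 e12)"
    "\<And>\<kappa> :: (nat \<Rightarrow>\<^sub>0 real) \<Rightarrow> 'a \<Rightarrow> real. bilinear \<kappa> \<Longrightarrow>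
       \<exists>\<tau>. linear \<tau> \<and> (\<forall>c00 c11 c22 c01 c02 c12 y.
          Gam (quad c00 c11 c22 c01 c02 c12 * \<tau> y) = \<kappa> (quad c00 c11 c22 c01 c02 c12) y)"
  have GamE: "Gam (s * t) = lam (m (om (ev s)) (ev t))"
    if "s \<in> S" "t \<in> S" "ev s \<in> X (2 * r)" "ev t \<in> X (2 * r)" for s t
  proof -
    have st: "s \<in> E" "t \<in> E" using that by (auto simp: E_def)
    have "Gam (s * t) = f s t" using Equad[OF st(1)] Equad[OF st(2)] Gam(2) by blast
    then show ?thesis unfolding f_def pE(3)[OF st(1)] pE(3)[OF st(2)] .
  qed
  have tau: "\<exists>\<tau>. linear \<tau> \<and> (odd r \<longrightarrow> (\<forall>y. \<tau> y = 0)) \<and> (\<forall>s\<in>S. \<forall>y. Gam (s * \<tau> y) = \<kappa> s y)"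
    if k: "bilinear \<kappa>" for \<kappa> :: "(nat \<Rightarrow>\<^sub>0 real) \<Rightarrow> 'a \<Rightarrow> real"
  proof -
    obtain \<tau> where \<tau>: "linear \<tau>" "\<And>c00 c11 c22 c01 c02 c12 y.
      Gam (quad c00 c11 c22 c01 c02 c12 * \<tau> y) = \<kappa> (quad c00 c11 c22 c01 c02 c12) y"
      using Gam(3)[OF k] by fast
    have "Gam (s * \<tau> y) = \<kappa> s y" if "s \<in> S" for s y
      using SE[OF that] by (elim exE conjE) (simp add: \<tau>(2))
    then show ?thesis using \<tau>(1) even by (intro exI[of _ \<tau>]) simp
  qed
  have "alg_data om rho ev S Gam" unfolding alg_data_def
  proof (intro conjI)
    show "\<forall>s\<in>S. ev s \<in> Z (2 * r)" using evZ by simp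
    show "\<forall>a\<in>V. \<forall>b\<in>V. rho a * rho b \<in> S" using prod by simp
    show "even r \<longrightarrow> (\<forall>a\<in>V. \<forall>b\<in>V. m a b = ev (rho a * rho b))" using prod by simp
    show "odd r \<longrightarrow> S = {0} \<and> (\<forall>v. rho v = 0)" using even by simp
    show "\<forall>s\<in>S. \<forall>t\<in>S. ev s \<in> X (2 * r) \<longrightarrow> ev t \<in> X (2 * r) \<longrightarrow> Gam (s * t) = lam (m (om (ev s)) (ev t))"
      by (intro ballI impI GamE)
    show "\<forall>\<kappa> :: (nat \<Rightarrow>\<^sub>0 real) \<Rightarrow> 'a \<Rightarrow> real. bilinear \<kappa> \<longrightarrow>
      (\<exists>\<tau>. linear \<tau> \<and> (odd r \<longrightarrow> (\<forall>y. \<tau> y = 0)) \<and> (\<forall>s\<in>S. \<forall>y. Gam (s * \<tau> y) = \<kappa> s y))"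
      by (intro allI impI tau)
    show "linear rho" by (rule rho)
    show "linear ev" by (rule ev)
    show "linear Gam" by (rule Gam(1))
    show "vsubspace S" by (rule S)
  qed
  then show ?thesis by (rule that)
  qed
qed

lemma algebraic_data:
  assumes om: "linear om" "\<And>x. om x \<in> G (2 * r - 1)" "\<And>x. x \<in> X (2 * r) \<Longrightarrow> D (om x) = x"
  obtains rho ev S Gam where "alg_data om rho ev S Gam"
proof (cases "even r")
  case True
  show ?thesis by (rule even_data[OF True om that])
next
  case False
  have \<kappa>: "\<kappa> 0 y = 0" if "bilinear \<kappa>" for \<kappa> :: "(nat \<Rightarrow>\<^sub>0 real) \<Rightarrow> 'a \<Rightarrow> real" and y
    using bilinear_lzero[OF that] .
  have Z0: "0 \<in> Z (2 * r)" by (rule vsubspace_0[OF Z_subspace])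
  have t: "\<exists>\<tau>. linear \<tau> \<and> (odd r \<longrightarrow> (\<forall>y. \<tau> y = 0)) \<and>
      (\<forall>s\<in>{0}. \<forall>y. (\<lambda>_. 0) (s * \<tau> y) = \<kappa> s y)" if "bilinear \<kappa>" for \<kappa> :: "(nat \<Rightarrow>\<^sub>0 real) \<Rightarrow> 'a \<Rightarrow> real"
    by (rule exI[of _ "\<lambda>_. 0"]) (simp add: \<kappa>[OF that] linear_zero)
  have "alg_data om (\<lambda>_. 0) (\<lambda>_. 0) {0} (\<lambda>_. 0)" unfolding alg_data_def
  proof (intro conjI)
    show "\<forall>\<kappa> :: (nat \<Rightarrow>\<^sub>0 real) \<Rightarrow> 'a \<Rightarrow> real. bilinear \<kappa> \<longrightarrow> (\<exists>\<tau>. linear \<tau> \<and> (odd r \<longrightarrow> (\<forall>y. \<tau> y = 0)) \<and>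
      (\<forall>s\<in>{0}. \<forall>y. (\<lambda>_. 0) (s * \<tau> y) = \<kappa> s y))" using t by (intro allI impI)
    show "linear (\<lambda>_ :: 'a. 0 :: nat \<Rightarrow>\<^sub>0 real)" "linear (\<lambda>_ :: nat \<Rightarrow>\<^sub>0 real. 0 :: 'a)" "linear (\<lambda>_ :: nat \<Rightarrow>\<^sub>0 real. 0 :: real)"
      by (rule linear_zero)+
    show "vsubspace {0 :: nat \<Rightarrow>\<^sub>0 real}" by simp
    show "\<forall>s\<in>{0 :: nat \<Rightarrow>\<^sub>0 real}. 0 \<in> Z (2 * r)" using Z0 by simp
    show "\<forall>a\<in>V. \<forall>b\<in>V. (0 :: nat \<Rightarrow>\<^sub>0 real) * 0 \<in> {0}" by simp
    show "even r \<longrightarrow> (\<forall>a\<in>V. \<forall>b\<in>V. m a b = 0)" using False by simp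
    show "odd r \<longrightarrow> {0 :: nat \<Rightarrow>\<^sub>0 real} = {0} \<and> (\<forall>v :: 'a. (0 :: nat \<Rightarrow>\<^sub>0 real) = 0)" by simp
    show "\<forall>s\<in>{0 :: nat \<Rightarrow>\<^sub>0 real}. \<forall>t\<in>{0 :: nat \<Rightarrow>\<^sub>0 real}. 0 \<in> X (2 * r) \<longrightarrow> 0 \<in> X (2 * r) \<longrightarrow> 0 = lam (m (om 0) 0)"
      by (simp add: mu_0_right lam_s)
  qed
  then show ?thesis by (rule that)
qed

text \<open>
  Choose primitives \<open>om\<close> and the algebraic data, then harmonic spaces that contain \<open>V\<close> in degree \<open>r\<close> and,
  in degree \<open>2 r\<close>, representatives of all products. The primitive \<open>om (ev s)\<close> is corrected by a harmonic
  element \<open>gm s\<close> of degree \<open>2 r - 1\<close>, found by duality, so that its pairings with all harmonic elements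
  of degree \<open>2 r\<close> become those prescribed by \<open>Gam\<close>.
\<close>

lemma formality_data_exists:
  obtains H cc rho ev S Gam sig w Y N tau where "formality_data G m D e r lam H cc rho ev S Gam sig w Y N tau"
proof -
  have r': "Suc (2 * r - 1) = 2 * r" "2 * r - 1 + 2 * r = 4 * r - 1" "2 * r + (2 * r - 1) = 4 * r - 1" using r2 by auto
  have X2: "X (2 * r) = D ` G (2 * r - 1)"
  proof -
    have "X (Suc (2 * r - 1)) = D ` G (2 * r - 1)" by (simp add: X_def)
    then show ?thesis by (simp only: r'(1))
  qed
  have "\<exists>om. range om \<subseteq> G (2 * r - 1) \<and> linear om \<and> (\<forall>v\<in>D ` G (2 * r - 1). D (om v) = v)"
    by (rule linear_exists_right_inverse_on[OF d_linear G_subspace[of "2 * r - 1"]])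
  then obtain om where om0: "range om \<subseteq> G (2 * r - 1) \<and> linear om \<and> (\<forall>v\<in>D ` G (2 * r - 1). D (om v) = v)"
    by (elim exE) (rule that)
  have om1: "linear om" using om0 by (elim conjE)
  have om2: "om x \<in> G (2 * r - 1)" for x by (rule subsetD[OF conjunct1[OF om0]]) (rule rangeI)
  have om3: "D (om x) = x" if x: "x \<in> X (2 * r)" for x
    by (rule bspec[OF conjunct2[OF conjunct2[OF om0]]]) (use x in \<open>simp only: X2\<close>)
  note om = om1 om2 om3
  obtain rho ev S Gam where AD: "alg_data om rho ev S Gam"
    by (rule algebraic_data[OF om1 om2 om3])
  note AD' = AD[unfolded alg_data_def]
  note a1 = conjunct1[OF AD'] and b1 = conjunct2[OF AD']
  note a2 = conjunct1[OF b1] and b2 = conjunct2[OF b1]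
  note a3 = conjunct1[OF b2] and b3 = conjunct2[OF b2]
  note S = conjunct1[OF b3] and b4 = conjunct2[OF b3]
  note evZ = bspec[OF conjunct1[OF b4]] and b5 = conjunct2[OF b4]
  note rhoS = bspec[OF bspec[OF conjunct1[OF b5]]] and b6 = conjunct2[OF b5]
  note even = bspec[OF bspec[OF mp[OF conjunct1[OF b6]]]] and b7 = conjunct2[OF b6]
  note odd = conjunct1[OF mp[OF conjunct1[OF b7]]] spec[OF conjunct2[OF mp[OF conjunct1[OF b7]]]] and b8 = conjunct2[OF b7]
  note Gam0 = mp[OF mp[OF bspec[OF bspec[OF conjunct1[OF b8]]]]] and tau = mp[OF spec[OF conjunct2[OF b8]]]
  note lin = a1 a2 a3
  have Gam: "Gam (s * t) = lam (m (om (ev s)) (ev t))" if "s \<in> S" "t \<in> S" "ev s \<in> X (2 * r)" "ev t \<in> X (2 * r)" for s t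
    by (rule Gam0) (fact that)+
  note evs = linear_add[OF lin(2)] linear_diff[OF lin(2)] linear_scale[OF lin(2)] linear_0[OF lin(2)]
  note Gams = linear_add[OF lin(3)] linear_diff[OF lin(3)] linear_scale[OF lin(3)] linear_0[OF lin(3)]
  define E where "E = {s \<in> S. ev s \<in> X (2 * r)}"
  have E: "vsubspace E" using S X_subspace[of "2 * r"] by (auto simp: E_def real_vector.subspace_def evs)
  have ES: "E \<subseteq> S" by (auto simp: E_def)
  \<comment> \<open>A complement of the exact relations, on which evaluation is injective in cohomology.\<close>
  obtain S1 where S1: "vsubspace S1" "S1 \<subseteq> S" "\<And>x. x \<in> E \<Longrightarrow> x \<in> S1 \<Longrightarrow> x = 0" "\<And>s. s \<in> S \<Longrightarrow> \<exists>c\<in>S1. s - c \<in> E"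
    using exists_complement[OF E S ES] by metis
  \<comment> \<open>What products force into the harmonic space of degree \<open>2 r\<close>; for even \<open>r\<close> products are only
    prescribed up to exact relations.\<close>
  define D0 where "D0 = (if even r then ev ` S1 else span {m a b |a b. a \<in> V \<and> b \<in> V})"
  have D0: "vsubspace D0" using linear_subspace_image[OF lin(2) S1(1)] by (simp add: D0_def)
  have "span {m a b |a b. a \<in> V \<and> b \<in> V} \<subseteq> Z (2 * r)"
    by (rule real_vector.span_minimal[OF _ Z_subspace]) (use V_m in auto)
  then have D0Z: "D0 \<subseteq> Z (2 * r)" using evZ S1(2) by (auto simp: D0_def)
  have D0X: "x = 0" if d: "x \<in> D0" "x \<in> X (2 * r)" for x
  proof (cases "even r")
    case True
    then obtain s where s: "s \<in> S1" "x = ev s" using d(1) by (auto simp: D0_def)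
    then have "s \<in> E" using S1(2) d(2) by (auto simp: E_def)
    then have "s = 0" using S1(3) s(1) by blast
    then show ?thesis using s(2) evs(4) by simp
  next
    case False
    then show ?thesis using odd_products[of x] d by (simp add: D0_def)
  qed
  define Q where "Q = (\<lambda>i C. vsubspace C \<and> C \<subseteq> Z i \<and> (\<forall>x. x \<in> C \<longrightarrow> x \<in> X i \<longrightarrow> x = 0) \<and> (\<forall>z\<in>Z i. \<exists>h\<in>C. z - h \<in> X i)
      \<and> (i = r \<longrightarrow> C = V) \<and> (i = 2 * r \<longrightarrow> D0 \<subseteq> C))"
  have Qex: "\<exists>C. Q i C" for i
  proof -
    consider "i = r" | "i = 2 * r" | "i \<noteq> r" "i \<noteq> 2 * r" by blast
    then show ?thesis
    proof cases
      case 1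
      then show ?thesis using V_subspace V_Z V_X V_dec r2 by (intro exI[of _ V]) (auto simp: Q_def)
    next
      case 2
      have "X (2 * r) \<inter> D0 \<subseteq> {0}" using D0X by auto
      then obtain C where "vsubspace C" "D0 \<subseteq> C" "C \<subseteq> Z (2 * r)" "\<And>x. x \<in> X (2 * r) \<Longrightarrow> x \<in> C \<Longrightarrow> x = 0"
        "\<And>w. w \<in> Z (2 * r) \<Longrightarrow> \<exists>c\<in>C. w - c \<in> X (2 * r)"
        using exists_complement_containing[OF X_subspace[of "2 * r"] Z_subspace[of "2 * r"] D0 X_Z[of "2 * r"] D0Z] by metis
      then show ?thesis using 2 r2 by (intro exI[of _ C]) (auto simp: Q_def)
    next
      case 3
      obtain C where "vsubspace C" "C \<subseteq> Z i" "\<And>x. x \<in> X i \<Longrightarrow> x \<in> C \<Longrightarrow> x = 0"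
        "\<And>w. w \<in> Z i \<Longrightarrow> \<exists>c\<in>C. w - c \<in> X i"
        using exists_complement[OF X_subspace[of i] Z_subspace[of i] X_Z[of i]] by metis
      then show ?thesis using 3 by (intro exI[of _ C]) (auto simp: Q_def)
    qed
  qed
  define H where "H = (\<lambda>i. SOME C. Q i C)"
  have HH: "Q i (H i)" for i unfolding H_def by (rule someI_ex[OF Qex])
  note hh = HH[unfolded Q_def]
  note H1 = conjunct1[OF hh] and c1 = conjunct2[OF hh]
  note HZ = conjunct1[OF c1] and c2 = conjunct2[OF c1]
  note H3 = mp[OF mp[OF spec[OF conjunct1[OF c2]]]] and c3 = conjunct2[OF c2]
  note H4 = bspec[OF conjunct1[OF c3]] and c4 = conjunct2[OF c3]
  note H5 = mp[OF conjunct1[OF c4] refl] and H6 = mp[OF conjunct2[OF c4] refl]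
  have H2: "x \<in> H i \<Longrightarrow> x \<in> Z i" for i x using HZ by (rule subsetD)
  note H = H1 H2 H3 H4 H5 H6
  have evS1: "vsubspace (ev ` S1)" "ev ` S1 \<subseteq> H (2 * r)"
  proof -
    show "vsubspace (ev ` S1)" by (rule linear_subspace_image[OF lin(2) S1(1)])
    show "ev ` S1 \<subseteq> H (2 * r)"
    proof (cases "even r")
      case True then show ?thesis using H(6) by (simp add: D0_def)
    next
      case False
      then show ?thesis using odd(1) S1(2) vsubspace_0[OF H(1)] evs(4) by auto
    qed
  qed
  obtain N where N: "vsubspace N" "N \<subseteq> H (2 * r)" "\<And>x. x \<in> ev ` S1 \<Longrightarrow> x \<in> N \<Longrightarrow> x = 0" "\<And>h. h \<in> H (2 * r) \<Longrightarrow> \<exists>c\<in>N. h - c \<in> ev ` S1"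
    using exists_complement[OF evS1(1) H(1) evS1(2)] by metis
  have ev_inj: "inj_on ev S1"
  proof (rule inj_onI)
    fix x y assume xy: "x \<in> S1" "y \<in> S1" "ev x = ev y"
    then have "x - y \<in> S1" using S1(1) by (blast intro: vsubspace_diff)
    moreover from this have "x - y \<in> E" using S1(2) xy(3) vsubspace_0[OF X_subspace] by (auto simp: E_def evs)
    ultimately have "x - y = 0" using S1(3) by blast
    then show "x = y" by simp
  qed
  obtain g where g: "range g \<subseteq> S1" "linear g" "\<And>s. s \<in> S1 \<Longrightarrow> g (ev s) = s"
    using linear_exists_left_inverse_on[OF lin(2) S1(1) ev_inj] by blast
  obtain pr where pr: "linear pr" "\<And>x. x \<in> ev ` S1 \<Longrightarrow> pr x = x" "\<And>x. x \<in> N \<Longrightarrow> pr x = 0" "\<And>x. pr x \<in> ev ` S1"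
    using exists_projection_along[OF evS1(1) N(1) N(3)] by metis
  define sig where "sig = (\<lambda>x. g (pr x))"
  have sig: "linear sig" unfolding sig_def using linear_compose[OF pr(1) g(2)] by (simp add: o_def)
  note sigs = linear_add[OF sig] linear_diff[OF sig] linear_scale[OF sig] linear_0[OF sig]
  have sigS1: "sig x \<in> S1" for x using g(1) by (auto simp: sig_def)
  have sig_ev: "sig (ev s) = s" if "s \<in> S1" for s using that pr(2) g(3) by (simp add: sig_def)
  have sigN: "sig x = 0" if "x \<in> N" for x using pr(3)[OF that] linear_0[OF g(2)] by (simp add: sig_def)
  have ev_sig: "ev (sig x) = pr x" for x using pr(4)[of x] g(3) by (auto simp: sig_def)
  have sig_dec: "h - ev (sig h) \<in> N" if h: "h \<in> H (2 * r)" for h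
  proof -
    obtain c where c: "c \<in> N" "h - c \<in> ev ` S1" using N(4)[OF h] by blast
    have "h - c = pr (h - c)" using pr(2) c by simp
    also have "\<dots> = pr h" using pr(3)[OF c(1)] linear_diff[OF pr(1)] by simp
    finally have "h - ev (sig h) = c" by (simp add: ev_sig algebra_simps)
    then show ?thesis using c by simp
  qed
  have "independent {e}" using e_nz by simp
  then obtain cc where cc: "linear cc" "cc e = (1::real)" using linear_independent_extend[of "{e}" "\<lambda>_. 1"] by auto
  have dual: "x = 0" if ij: "i + j = 4 * r - 1" and x: "x \<in> H i" and y: "\<And>y. y \<in> H j \<Longrightarrow> lam (m x y) = 0" for i j x
  proof (rule H(3)[OF x], rule pdual[OF ij H(2)[OF x]])
    fix y assume "y \<in> Z j"
    then obtain h where h: "h \<in> H j" "y - h \<in> X j" using H(4) by blast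
    have "j + i = 4 * r - 1" using ij by simp
    from lam_X(2)[OF this h(2) H(2)[OF x]] show "lam (m x y) = 0" using that(3)[OF h(1)] by (simp add: mu_diff_right lam_s)
  qed
  have Hfin: "\<exists>T. finite T \<and> H i \<subseteq> span T" for i
  proof -
    obtain T where T: "finite T" "T \<subseteq> Z i" "\<forall>z\<in>Z i. \<exists>t\<in>span T. z - t \<in> X i" using fin[of i] by blast
    obtain T' where "finite T'" "card T' \<le> card T" "H i = span T'"
      using complement_span[OF H(1)[of i] HZ[of i] H(3) H(4) T] by metis
    then show ?thesis by blast
  qed
  have van: "x = 0" if u: "\<not> (i = 0 \<or> r \<le> i \<and> i \<le> 3 * r - 1 \<or> i = 4 * r - 1)" "x \<in> H i" for i x
  proof (rule H(3)[OF u(2)])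
    consider "0 < i" "i < r" | "3 * r - 1 < i" "i < 4 * r - 1" | "i > 4 * r - 1" using u(1) by linarith
    then show "x \<in> X i"
    proof cases
      case 1 then show ?thesis by (rule conn[OF _ _ H(2)[OF u(2)]])
    next
      case 2 then show ?thesis by (rule gap[OF _ _ H(2)[OF u(2)]])
    next
      case 3 then show ?thesis by (rule high[OF _ H(2)[OF u(2)]])
    qed
  qed
  have H0: "x = cc x *\<^sub>R e" if u: "x \<in> H 0" for x
  proof -
    obtain c where c: "x = c *\<^sub>R e" using Z_0[OF H(2)[OF u]] by (elim exE) (rule that)
    have "cc x = c" unfolding c linear_scale[OF cc(1)] cc(2) by simp
    then show ?thesis using c by simp
  qed
  have eH: "e \<in> H 0"
  proof -
    obtain h where h: "h \<in> H 0" "e - h \<in> X 0" using H(4)[OF e_Z] by (elim bexE) (rule that)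
    then have "e = h" by (simp add: X_def)
    then show ?thesis using h(1) by simp
  qed
  have HG: "x \<in> H i \<Longrightarrow> x \<in> G i" for x i by (rule Z_G[OF H(2)])
  obtain T2 where T2: "finite T2" "H (2 * r) \<subseteq> span T2" using Hfin[of "2 * r"] by blast
  have sep: "h = 0" if h: "h \<in> H (2 * r)" and z: "\<And>z. z \<in> H (2 * r - 1) \<Longrightarrow> lam (m z h) = 0" for h
  proof (rule dual[OF r'(3) h])
    fix y assume y: "y \<in> H (2 * r - 1)"
    show "lam (m h y) = 0" using mm_comm[OF HG[OF h] HG[OF y]] z[OF y] by (simp add: lam_s)
  qed
  have k: "bilinear (\<lambda>s h. Gam (s * sig h) - lam (m (om (ev s)) h))"
    by (rule bilinearI) (simp_all add: distrib_left distrib_right pm_scale_left pm_scale_right Gams sigs evs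
      linear_add[OF om(1)] linear_scale[OF om(1)] mu_add_left mu_add_right mu_scale_left mu_scale_right lam_s right_diff_distrib)
  obtain gm where gm: "linear gm" "\<And>s. gm s \<in> H (2 * r - 1)"
    "\<And>s h. h \<in> H (2 * r) \<Longrightarrow> lam (m (gm s) h) = Gam (s * sig h) - lam (m (om (ev s)) h)"
  proof (rule dual_operator[OF lam_bilinear H(1)[of "2 * r - 1"] T2 H(1) sep k])
    fix \<gamma> assume "linear \<gamma>" "\<And>s. \<gamma> s \<in> H (2 * r - 1)"
      "\<And>s h. h \<in> H (2 * r) \<Longrightarrow> lam (m (\<gamma> s) h) = Gam (s * sig h) - lam (m (om (ev s)) h)"
    then show ?thesis by (rule that)
  qed
  define w where "w = (\<lambda>s. om (ev s) + gm s)"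
  have w: "linear w" unfolding w_def
    by (rule linearI) (simp_all add: evs linear_add[OF om(1)] linear_scale[OF om(1)] linear_add[OF gm(1)] linear_scale[OF gm(1)] scaleR_right_distrib)
  have wG: "w s \<in> G (2 * r - 1)" for s unfolding w_def by (rule vsubspace_add[OF G_subspace om(2) HG[OF gm(2)]])
  have wD: "D (w s) = ev s" if "ev s \<in> X (2 * r)" for s
    using om(3)[OF that] Z_d[OF H(2)[OF gm(2)]] by (simp add: w_def d_add)
  have wH: "lam (m (w s) h) = Gam (s * sig h)" if "h \<in> H (2 * r)" for s h
    using gm(3)[OF that] by (simp add: w_def mu_add_left lam_s)
  have wS: "lam (m (w s) (ev t)) = Gam (s * t)" if s: "s \<in> S" "ev s \<in> X (2 * r)" and t: "t \<in> S" for s t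
  proof -
    obtain t1 where t1: "t1 \<in> S1" "t - t1 \<in> E" using S1(4)[OF t] by blast
    have "lam (m (gm s) (ev (t - t1))) = 0"
      using lam_X(2)[OF r'(3) _ H(2)[OF gm(2)]] t1(2) by (simp add: E_def)
    then have "lam (m (w s) (ev (t - t1))) = Gam (s * (t - t1))"
      using Gam[of s "t - t1"] s t1(2) by (simp add: w_def mu_add_left lam_s E_def)
    moreover have "ev t1 \<in> H (2 * r)" using evS1(2) t1(1) by blast
    then have "lam (m (w s) (ev t1)) = Gam (s * t1)" using wH sig_ev[OF t1(1)] by simp
    ultimately show ?thesis by (simp add: evs mu_diff_right lam_s right_diff_distrib Gams)
  qed
  have wN: "lam (m (w s) x) = 0" if "x \<in> N" for s x using wH[of x s] that N(2) sigN Gams(4) by auto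
  obtain Y where Y: "vsubspace Y" "Y \<subseteq> G (2 * r)" "\<And>x. x \<in> Z (2 * r) \<Longrightarrow> x \<in> Y \<Longrightarrow> x = 0" "\<And>x. x \<in> G (2 * r) \<Longrightarrow> \<exists>y\<in>Y. x - y \<in> Z (2 * r)"
  proof (rule exists_complement[OF Z_subspace[of "2 * r"] G_subspace[of "2 * r"]])
    show "Z (2 * r) \<subseteq> G (2 * r)" using Z_G by blast
    fix C assume "vsubspace C" "C \<subseteq> G (2 * r)" "\<And>x. x \<in> Z (2 * r) \<Longrightarrow> x \<in> C \<Longrightarrow> x = 0"
      "\<And>x. x \<in> G (2 * r) \<Longrightarrow> \<exists>y\<in>C. x - y \<in> Z (2 * r)"
    then show ?thesis by (rule that)
  qed
  have "bilinear (\<lambda>s y. lam (m (w s) y))"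
    by (rule bilinearI) (simp_all add: linear_add[OF w] linear_scale[OF w] mu_add_left mu_add_right mu_scale_left mu_scale_right lam_s)
  from tau[OF this] obtain ta where ta0: "linear ta \<and> (odd r \<longrightarrow> (\<forall>y. ta y = 0)) \<and> (\<forall>s\<in>S. \<forall>y. Gam (s * ta y) = lam (m (w s) y))" by (elim exE) (rule that)
  have ta: "linear ta" "\<And>y. odd r \<Longrightarrow> ta y = 0" "\<And>s y. s \<in> S \<Longrightarrow> Gam (s * ta y) = lam (m (w s) y)" using ta0 by simp_all
  have rhoN: "m a b - ev (rho a * rho b) \<in> N" if ab: "a \<in> V" "b \<in> V" for a b
  proof (cases "even r")
    case True then show ?thesis using even[OF True ab] vsubspace_0[OF N(1)] by simp
  next
    case False
    then have "m a b \<in> D0" using ab by (auto simp: D0_def intro!: real_vector.span_base)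
    then have "m a b \<in> H (2 * r)" using H(6) by blast
    then obtain c where c: "c \<in> N" "m a b - c \<in> ev ` S1" using N(4) by blast
    have "ev ` S1 \<subseteq> {0}" using S1(2) odd(1)[OF False] by (auto simp: evs)
    then have "m a b = c" using c(2) by auto
    then show ?thesis using c(1) odd(2)[OF False] by (simp add: evs)
  qed
  have SN: "\<exists>s'\<in>S. ev s' \<in> X (2 * r) \<and> ev (s - s') + x \<in> H (2 * r) \<and> sig (ev (s - s') + x) = s - s'"
    if s: "s \<in> S" and x: "x \<in> N" for s x
  proof -
    obtain c where c: "c \<in> S1" "s - c \<in> E" using S1(4)[OF s] by blast
    have "ev c + x \<in> H (2 * r)" using evS1(2) c(1) N(2) x H(1) by (blast intro: vsubspace_add)
    moreover have "sig (ev c + x) = c" using sig_ev[OF c(1)] sigN[OF x] by (simp add: sigs)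
    ultimately show ?thesis using c(2) by (intro bexI[of _ "s - c"]) (auto simp: E_def)
  qed
  have "formality_data G m D e r lam H cc rho ev S Gam sig w Y N ta"
  proof (rule formality_data.intro[OF integrated_gdga_axioms], rule formality_data_axioms.intro)
    fix i j :: nat and x y s t h a b z
    show "vsubspace (H i)" "cc e = 1" "e \<in> H 0" "vsubspace S" "vsubspace N" "vsubspace Y" by (fact H(1) cc(2) eH S N(1) Y(1))+
    show "linear cc" "linear rho" "linear ev" "linear Gam" "linear sig" "linear w" "linear ta"
      by (fact cc(1) lin sig w ta(1))+
    show "z \<in> Z i \<Longrightarrow> \<exists>h\<in>H i. z - h \<in> X i" by (rule H(4))
    show "x \<in> H i \<Longrightarrow> x \<in> X i \<Longrightarrow> x = 0" by (rule H(3))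
    show "x \<in> H i \<Longrightarrow> x \<in> Z i" by (rule H(2))
    show "\<not> (i = 0 \<or> r \<le> i \<and> i \<le> 3 * r - 1 \<or> i = 4 * r - 1) \<Longrightarrow> x \<in> H i \<Longrightarrow> x = 0" by (rule van)
    show "\<exists>T. finite T \<and> H i \<subseteq> span T" by (rule Hfin)
    show "i + j = 4 * r - 1 \<Longrightarrow> x \<in> H i \<Longrightarrow> (\<And>y. y \<in> H j \<Longrightarrow> lam (m x y) = 0) \<Longrightarrow> x = 0" by (rule dual)
    show "x \<in> H 0 \<Longrightarrow> x = cc x *\<^sub>R e" by (rule H0)
    show "odd r \<Longrightarrow> s \<in> S \<Longrightarrow> s = 0" "odd r \<Longrightarrow> rho a = 0" "odd r \<Longrightarrow> ta y = 0" using odd ta(2) by auto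
    show "s \<in> S \<Longrightarrow> ev s \<in> Z (2 * r)" by (rule evZ)
    show "a \<in> H r \<Longrightarrow> b \<in> H r \<Longrightarrow> rho a * rho b \<in> S" unfolding H(5) by (rule rhoS)
    show "a \<in> H r \<Longrightarrow> b \<in> H r \<Longrightarrow> m a b - ev (rho a * rho b) \<in> N" unfolding H(5) by (rule rhoN)
    show "x \<in> N \<Longrightarrow> x \<in> H (2 * r)" using N(2) by blast
    show "sig h \<in> S" using sigS1 S1(2) by blast
    show "h \<in> H (2 * r) \<Longrightarrow> h - ev (sig h) \<in> N" by (rule sig_dec)
    show "w s \<in> G (2 * r - 1)" by (rule wG)
    show "ev s \<in> X (2 * r) \<Longrightarrow> D (w s) = ev s" by (rule wD)
    show "s \<in> S \<Longrightarrow> ev s \<in> X (2 * r) \<Longrightarrow> t \<in> S \<Longrightarrow> lam (m (w s) (ev t)) = Gam (s * t)" by (rule wS)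
    show "x \<in> N \<Longrightarrow> lam (m (w s) x) = 0" by (rule wN)
    show "y \<in> Y \<Longrightarrow> y \<in> G (2 * r)" using Y(2) by blast
    show "y \<in> Y \<Longrightarrow> y \<in> Z (2 * r) \<Longrightarrow> y = 0" using Y(3) by blast
    show "x \<in> G (2 * r) \<Longrightarrow> \<exists>y\<in>Y. x - y \<in> Z (2 * r)" by (rule Y(4))
    show "s \<in> S \<Longrightarrow> lam (m (w s) y) = Gam (s * ta y)" using ta(3) by simp
    show "s \<in> S \<Longrightarrow> x \<in> N \<Longrightarrow> \<exists>s'\<in>S. ev s' \<in> X (2 * r) \<and> ev (s - s') + x \<in> H (2 * r) \<and> sig (ev (s - s') + x) = s - s'"
      by (rule SN)
  qed
  then show ?thesis by (rule that)
qed

end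

lemma (in typed_poincare) formality_data_ex:
  obtains H cc rho ev S Gam sig w Y N tau where "formality_data G m D e r lam H cc rho ev S Gam sig w Y N tau"
proof -
  obtain V where "vsubspace V" "V \<subseteq> Z r" "\<And>x. x \<in> X r \<Longrightarrow> x \<in> V \<Longrightarrow> x = 0"
        "\<And>w. w \<in> Z r \<Longrightarrow> \<exists>c\<in>V. w - c \<in> X r"
    using exists_complement[OF X_subspace[of r] Z_subspace[of r] X_Z[of r]] by metis
  then interpret middle_degree G m D e r lam phi V by unfold_locales auto
  show ?thesis by (rule formality_data_exists) (rule that)
qed

section \<open>The record of a graded algebra\<close>

lemma (in abelian_group) finsum_additive:
  assumes p: "\<And>x y. x \<in> carrier G \<Longrightarrow> y \<in> carrier G \<Longrightarrow> p (x \<oplus> y) = p x \<oplus>\<^bsub>B\<^esub> p y" "p \<zero> = \<zero>\<^bsub>B\<^esub>"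
    and B: "abelian_group B" and pc: "\<And>x. x \<in> carrier G \<Longrightarrow> p x \<in> carrier B"
    and f: "f \<in> I \<rightarrow> carrier G" and fin: "finite I"
  shows "p (finsum G f I) = finsum B (\<lambda>i. p (f i)) I"
proof -
  interpret B: abelian_group B by fact
  show ?thesis using fin f
    by (induction I rule: finite_induct) (use p pc in \<open>simp_all add: Pi_iff\<close>)
qed

text \<open>
  Unique decomposition into homogeneous parts follows from additive projections that act as Kronecker
  deltas on the graded pieces.
\<close>

lemma direct_sum_from_projections:
  fixes A :: "('k, 'a, 'e) dgca_scheme" (structure)
  assumes A: "abelian_group A" and sub: "\<And>i. grade A i \<subseteq> carrier A"
    and p: "\<And>i x. x \<in> carrier A \<Longrightarrow> p i x \<in> grade A i" "\<And>i x. x \<in> grade A i \<Longrightarrow> p i x = x"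
      "\<And>i j x. x \<in> grade A j \<Longrightarrow> i \<noteq> j \<Longrightarrow> p i x = \<zero>"
      "\<And>i x y. x \<in> carrier A \<Longrightarrow> y \<in> carrier A \<Longrightarrow> p i (x \<oplus> y) = p i x \<oplus> p i y"
    and fin: "\<And>x. x \<in> carrier A \<Longrightarrow> finite {i. p i x \<noteq> \<zero>}"
    and sum: "\<And>x. x \<in> carrier A \<Longrightarrow> x = (\<Oplus>i\<in>{i. p i x \<noteq> \<zero>}. p i x)"
    and x: "x \<in> carrier A"
  shows "\<exists>!f. is_decomposition A f x"
proof
  interpret A: abelian_group A by fact
  show "is_decomposition A (\<lambda>i. p i x) x" unfolding is_decomposition_def using p(1) fin sum x by auto
  fix f assume f: "is_decomposition A f x"
  let ?I = "{i. f i \<noteq> \<zero>}"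
  have fg: "\<And>i. f i \<in> grade A i" and fI: "finite ?I" and fx: "x = (\<Oplus>i\<in>?I. f i)"
    using f by (auto simp: is_decomposition_def)
  have fc: "f i \<in> carrier A" for i using fg sub by blast
  have pc: "y \<in> carrier A \<Longrightarrow> p j y \<in> carrier A" for j y using p(1) sub by blast
  have p0: "p j \<zero> = \<zero>" for j
  proof -
    have "p j \<zero> \<oplus> p j \<zero> = p j \<zero>" using p(4)[of "\<zero>" "\<zero>" j] by simp
    then show ?thesis using pc[of "\<zero>" j] by (metis A.add.l_cancel_one A.zero_closed)
  qed
  show "f = (\<lambda>i. p i x)"
  proof
    fix j
    have "p j x = (\<Oplus>i\<in>?I. p j (f i))"
      unfolding fx using A.finsum_additive[where B = A and p = "p j" and f = f and I = ?I] p(4) p0 A pc fc fI by simp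
    also have "\<dots> = (\<Oplus>i\<in>?I. if j = i then f i else \<zero>)"
      by (rule A.finsum_cong') (use p(2) p(3)[OF fg] fg fc in auto)
    also have "\<dots> = f j"
    proof (cases "j \<in> ?I")
      case True then show ?thesis using A.finsum_singleton[OF True fI, of f] fc by simp
    next
      case False
      have "(\<Oplus>i\<in>?I. if j = i then f i else \<zero>) = (\<Oplus>i\<in>?I. \<zero>)" by (rule A.finsum_cong') (use False in auto)
      then show ?thesis using False by simp
    qed
    finally show "f j = p j x" by simp
  qed
qed

definition tcar :: "(nat \<Rightarrow> 'v::real_vector set) \<Rightarrow> (nat \<Rightarrow> 'v) set" where
  "tcar G = {f. (\<forall>i. f i \<in> G i) \<and> finite {i. f i \<noteq> 0}}"

text \<open>
  The direct sum of the graded pieces, realised as finitely supported sequences with the convolution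
  product.
\<close>

definition total :: "(nat \<Rightarrow> 'v::real_vector set) \<Rightarrow> (nat \<Rightarrow> nat \<Rightarrow> 'v \<Rightarrow> 'v \<Rightarrow> 'v) \<Rightarrow> (nat \<Rightarrow> 'v \<Rightarrow> 'v) \<Rightarrow> 'v \<Rightarrow> (real, nat \<Rightarrow> 'v) dgca" where
  "total G mu d e = \<lparr>carrier = tcar G, monoid.mult = (\<lambda>f g k. \<Sum>i=0..k. mu i (k - i) (f i) (g (k - i))),
     one = (\<lambda>i. if i = 0 then e else 0), zero = (\<lambda>_. 0), add = (\<lambda>f g i. f i + g i), smult = (\<lambda>c f i. c *\<^sub>R f i),
     grade = (\<lambda>i. {f \<in> tcar G. \<forall>j. j \<noteq> i \<longrightarrow> f j = 0}), diff = (\<lambda>f k. case k of 0 \<Rightarrow> 0 | Suc j \<Rightarrow> d j (f j))\<rparr>"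

lemma total_simps [simp]:
  "carrier (total G mu d e) = tcar G"
  "monoid.mult (total G mu d e) f g = (\<lambda>k. \<Sum>i=0..k. mu i (k - i) (f i) (g (k - i)))"
  "one (total G mu d e) = (\<lambda>i. if i = 0 then e else 0)"
  "zero (total G mu d e) = (\<lambda>_. 0)"
  "add (total G mu d e) f g = (\<lambda>i. f i + g i)"
  "smult (total G mu d e) c f = (\<lambda>i. c *\<^sub>R f i)"
  "grade (total G mu d e) i = {f \<in> tcar G. \<forall>j. j \<noteq> i \<longrightarrow> f j = 0}"
  "diff (total G mu d e) f = (\<lambda>k. case k of 0 \<Rightarrow> 0 | Suc j \<Rightarrow> d j (f j))"
  by (simp_all add: total_def fun_eq_iff)

definition single :: "nat \<Rightarrow> 'v::real_vector \<Rightarrow> nat \<Rightarrow> 'v" where "single i x = (\<lambda>j. if j = i then x else 0)"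

lemma grade_single: "f \<in> grade (total G mu d e) i \<Longrightarrow> f = single i (f i) \<and> f i \<in> G i"
  by (auto simp: single_def tcar_def fun_eq_iff)

context gdga
begin

abbreviation "T \<equiv> total G mu d e"

lemma G_0: "0 \<in> G i" by (rule vsubspace_0[OF G_subspace])

lemma single_tcar: "x \<in> G i \<Longrightarrow> single i x \<in> tcar G"
  using G_0 by (auto simp: tcar_def single_def)

lemma single_grade: "x \<in> G i \<Longrightarrow> single i x \<in> grade T i"
  using single_tcar by (auto simp: single_def)

lemma tcar_add: "f \<in> tcar G \<Longrightarrow> g \<in> tcar G \<Longrightarrow> (\<lambda>i. f i + g i) \<in> tcar G"
proof -
  assume a: "f \<in> tcar G" "g \<in> tcar G"
  have "{i. f i + g i \<noteq> 0} \<subseteq> {i. f i \<noteq> 0} \<union> {i. g i \<noteq> 0}" by auto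
  then show ?thesis using a G_subspace by (auto simp: tcar_def intro: vsubspace_add finite_subset)
qed

lemma tcar_scale: "f \<in> tcar G \<Longrightarrow> (\<lambda>i. c *\<^sub>R f i) \<in> tcar G"
proof -
  assume a: "f \<in> tcar G"
  have "{i. c *\<^sub>R f i \<noteq> 0} \<subseteq> {i. f i \<noteq> 0}" by auto
  then show ?thesis using a G_subspace by (auto simp: tcar_def intro: vsubspace_scale finite_subset)
qed

lemma tcar_0: "(\<lambda>_. 0) \<in> tcar G" by (simp add: tcar_def G_0)

lemma tcar_mult: assumes "f \<in> tcar G" "g \<in> tcar G" shows "(\<lambda>k. \<Sum>i=0..k. mu i (k - i) (f i) (g (k - i))) \<in> tcar G"
proof -
  have "(\<Sum>i=0..k. mu i (k - i) (f i) (g (k - i))) \<in> G k" for k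
  proof (rule vsubspace_sum[OF G_subspace])
    fix i assume "i \<in> {0..k}"
    then show "mu i (k - i) (f i) (g (k - i)) \<in> G k"
      using mu_G[of "f i" i "g (k - i)" "k - i"] assms by (auto simp: tcar_def)
  qed
  moreover have "{k. (\<Sum>i=0..k. mu i (k - i) (f i) (g (k - i))) \<noteq> 0} \<subseteq> (\<lambda>(i, j). i + j) ` ({i. f i \<noteq> 0} \<times> {i. g i \<noteq> 0})"
  proof
    fix k assume "k \<in> {k. (\<Sum>i=0..k. mu i (k - i) (f i) (g (k - i))) \<noteq> 0}"
    then obtain i where i: "i \<in> {0..k}" "mu i (k - i) (f i) (g (k - i)) \<noteq> 0" by (metis (mono_tags, lifting) mem_Collect_eq sum.neutral)
    then have "f i \<noteq> 0" "g (k - i) \<noteq> 0" using mu_0_left mu_0_right by auto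
    then show "k \<in> (\<lambda>(i, j). i + j) ` ({i. f i \<noteq> 0} \<times> {i. g i \<noteq> 0})" using i(1) by (intro image_eqI[of _ _ "(i, k - i)"]) auto
  qed
  ultimately show ?thesis using assms by (auto simp: tcar_def intro: finite_subset)
qed

lemma tcar_diff: assumes "f \<in> tcar G" shows "(\<lambda>k. case k of 0 \<Rightarrow> 0 | Suc j \<Rightarrow> d j (f j)) \<in> tcar G"
proof -
  have "{k. (case k of 0 \<Rightarrow> 0 | Suc j \<Rightarrow> d j (f j)) \<noteq> 0} \<subseteq> Suc ` {i. f i \<noteq> 0}"
  proof
    fix k assume "k \<in> {k. (case k of 0 \<Rightarrow> 0 | Suc j \<Rightarrow> d j (f j)) \<noteq> 0}"
    then show "k \<in> Suc ` {i. f i \<noteq> 0}" using d_0 by (cases k) auto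
  qed
  then show ?thesis using assms d_G G_0 by (auto simp: tcar_def intro: finite_subset split: nat.splits)
qed

lemma T_abelian: "abelian_group T"
proof (rule abelian_groupI)
  show "\<exists>y\<in>carrier T. y \<oplus>\<^bsub>T\<^esub> x = \<zero>\<^bsub>T\<^esub>" if "x \<in> carrier T" for x
    using tcar_scale[of x "-1"] that by (intro bexI[of _ "\<lambda>i. (-1) *\<^sub>R x i"]) auto
qed (auto simp: tcar_add tcar_0 add_ac)

lemma T_minus: assumes "x \<in> tcar G" shows "\<ominus>\<^bsub>T\<^esub> x = (\<lambda>i. - x i)"
proof -
  interpret abelian_group T by (rule T_abelian)
  have "(\<lambda>i. - x i) \<in> carrier T" using tcar_scale[OF assms, of "-1"] by simp
  then show ?thesis using assms by (intro minus_equality) auto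
qed

lemma T_finsum: assumes "finite I" "\<And>i. i \<in> I \<Longrightarrow> F i \<in> tcar G" shows "finsum T F I = (\<lambda>j. \<Sum>i\<in>I. F i j)"
proof -
  interpret abelian_group T by (rule T_abelian)
  show ?thesis using assms by (induction I rule: finite_induct) (simp_all add: Pi_iff fun_eq_iff)
qed

lemma T_mult_assoc: assumes f: "f \<in> tcar G" and g: "g \<in> tcar G" and h: "h \<in> tcar G"
  shows "(f \<otimes>\<^bsub>T\<^esub> g) \<otimes>\<^bsub>T\<^esub> h = f \<otimes>\<^bsub>T\<^esub> (g \<otimes>\<^bsub>T\<^esub> h)"
proof
  fix n
  have G: "f i \<in> G i" "g i \<in> G i" "h i \<in> G i" for i using f g h by (auto simp: tcar_def)
  have "((f \<otimes>\<^bsub>T\<^esub> g) \<otimes>\<^bsub>T\<^esub> h) n = (\<Sum>j=0..n. \<Sum>i=0..j. mu j (n - j) (mu i (j - i) (f i) (g (j - i))) (h (n - j)))"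
    by (simp add: mu_sum_left)
  also have "\<dots> = (\<Sum>j=0..n. \<Sum>i=0..j. mu i (j - i + (n - j)) (f i) (mu (j - i) (n - j) (g (j - i)) (h (n - j))))"
  proof (intro sum.cong refl)
    fix j i assume "j \<in> {0..n}" "i \<in> {0..j}"
    then show "mu j (n - j) (mu i (j - i) (f i) (g (j - i))) (h (n - j)) =
      mu i (j - i + (n - j)) (f i) (mu (j - i) (n - j) (g (j - i)) (h (n - j)))"
      using mu_assoc[OF G(1)[of i] G(2)[of "j - i"] G(3)[of "n - j"]] by simp
  qed
  \<comment> \<open>The reindexing is the one behind associativity of power series multiplication.\<close>
  also have "\<dots> = (\<Sum>j=0..n. \<Sum>i=0..n - j. mu j (i + (n - j - i)) (f j) (mu i (n - j - i) (g i) (h (n - j - i))))"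
    by (rule fps_mult_assoc_lemma[of "\<lambda>i a b. mu i (a + b) (f i) (mu a b (g a) (h b))"])
  also have "\<dots> = (f \<otimes>\<^bsub>T\<^esub> (g \<otimes>\<^bsub>T\<^esub> h)) n" by (simp add: mu_sum_right)
  finally show "((f \<otimes>\<^bsub>T\<^esub> g) \<otimes>\<^bsub>T\<^esub> h) n = (f \<otimes>\<^bsub>T\<^esub> (g \<otimes>\<^bsub>T\<^esub> h)) n" .
qed

lemma T_mult_single: assumes "x \<in> G i" "y \<in> G j" shows "single i x \<otimes>\<^bsub>T\<^esub> single j y = single (i + j) (mu i j x y)"
proof
  fix k
  have "(single i x \<otimes>\<^bsub>T\<^esub> single j y) k = (\<Sum>l=0..k. if l = i then mu i (k - i) x (single j y (k - i)) else 0)"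
    unfolding total_simps by (rule sum.cong) (auto simp: single_def mu_0_left)
  also have "\<dots> = (if i \<le> k then mu i (k - i) x (single j y (k - i)) else 0)" by simp
  also have "\<dots> = single (i + j) (mu i j x y) k" by (auto simp: single_def mu_0_right)
  finally show "(single i x \<otimes>\<^bsub>T\<^esub> single j y) k = single (i + j) (mu i j x y) k" .
qed

lemma T_mult_one: assumes "f \<in> tcar G" shows "\<one>\<^bsub>T\<^esub> \<otimes>\<^bsub>T\<^esub> f = f" "f \<otimes>\<^bsub>T\<^esub> \<one>\<^bsub>T\<^esub> = f"
proof -
  have G: "f i \<in> G i" for i using assms by (auto simp: tcar_def)
  show "\<one>\<^bsub>T\<^esub> \<otimes>\<^bsub>T\<^esub> f = f"
  proof
    fix k
    have "(\<one>\<^bsub>T\<^esub> \<otimes>\<^bsub>T\<^esub> f) k = (\<Sum>i=0..k. if i = 0 then mu 0 k e (f k) else 0)"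
      unfolding total_simps by (rule sum.cong) (auto simp: mu_0_left)
    then show "(\<one>\<^bsub>T\<^esub> \<otimes>\<^bsub>T\<^esub> f) k = f k" using mu_e[OF G] by simp
  qed
  show "f \<otimes>\<^bsub>T\<^esub> \<one>\<^bsub>T\<^esub> = f"
  proof
    fix k
    have "(f \<otimes>\<^bsub>T\<^esub> \<one>\<^bsub>T\<^esub>) k = (\<Sum>i=0..k. if i = k then mu k 0 (f k) e else 0)"
      unfolding total_simps by (rule sum.cong) (auto simp: mu_0_right)
    then show "(f \<otimes>\<^bsub>T\<^esub> \<one>\<^bsub>T\<^esub>) k = f k" using mu_e_right[OF G] by simp
  qed
qed

lemma T_one: "\<one>\<^bsub>T\<^esub> \<in> tcar G" using single_tcar[OF e_G] by (simp add: single_def)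

lemma T_ring: "ring T"
proof (rule ringI)
  show "abelian_group T" by (rule T_abelian)
  show "Group.monoid T"
    by (rule monoidI) (use T_mult_assoc T_mult_one T_one tcar_mult in \<open>simp_all add: total_simps(1)\<close>)
qed (simp_all add: mu_add_left mu_add_right sum.distrib)

lemma T_module: "Module.module class_ring T"
proof (rule moduleI)
  show "cring (class_ring :: real ring)" by (rule class_cring.cring_axioms)
  show "abelian_group T" by (rule T_abelian)
qed (auto simp: tcar_scale scaleR_left_distrib scaleR_right_distrib)

lemma T_vectorspace: "vectorspace class_ring T"
  by (rule vectorspace.intro) (rule T_module, rule class_field)

lemma T_grade_subspace: "VectorSpace.subspace class_ring (grade T i) T"
proof (rule VectorSpace.subspace.intro)
  show "vectorspace class_ring T" by (rule T_vectorspace)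
  show "submodule class_ring (grade T i) T"
    by (rule submodule.intro) (use T_module tcar_add tcar_scale tcar_0 in auto)
qed

lemma T_direct_sum: assumes "x \<in> carrier T" shows "\<exists>!f. is_decomposition T f x"
proof (rule direct_sum_from_projections[where p = "\<lambda>i f. single i (f i)", OF T_abelian _ _ _ _ _ _ _ assms])
  show "grade T i \<subseteq> carrier T" for i by auto
  show "single i (x i) \<in> grade T i" if "x \<in> carrier T" for i x using single_grade that by (auto simp: tcar_def)
  show "single i (x i) = x" if "x \<in> grade T i" for i x using grade_single[OF that] by simp
  show "single i (x i) = \<zero>\<^bsub>T\<^esub>" if "x \<in> grade T j" "i \<noteq> j" for i j x using that by (auto simp: single_def)
  show "single i ((x \<oplus>\<^bsub>T\<^esub> y) i) = single i (x i) \<oplus>\<^bsub>T\<^esub> single i (y i)" for i x y by (auto simp: single_def)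
  have s0: "single i (x i) \<noteq> \<zero>\<^bsub>T\<^esub> \<longleftrightarrow> x i \<noteq> 0" for i x by (auto simp: single_def fun_eq_iff)
  show f: "finite {i. single i (x i) \<noteq> \<zero>\<^bsub>T\<^esub>}" if "x \<in> carrier T" for x using that unfolding s0 by (simp add: tcar_def)
  show "x = (\<Oplus>\<^bsub>T\<^esub>i\<in>{i. single i (x i) \<noteq> \<zero>\<^bsub>T\<^esub>}. single i (x i))" if "x \<in> carrier T" for x
  proof -
    have "(\<Oplus>\<^bsub>T\<^esub>i\<in>{i. single i (x i) \<noteq> \<zero>\<^bsub>T\<^esub>}. single i (x i)) = (\<lambda>j. \<Sum>i\<in>{i. x i \<noteq> 0}. single i (x i) j)"
      unfolding s0 by (rule T_finsum) (use that single_tcar in \<open>auto simp: tcar_def\<close>)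
    also have "\<dots> = x"
    proof
      fix j
      have "(\<Sum>i\<in>{i. x i \<noteq> 0}. single i (x i) j) = (\<Sum>i\<in>{i. x i \<noteq> 0}. if i = j then x j else 0)"
        by (rule sum.cong) (auto simp: single_def)
      then show "(\<Sum>i\<in>{i. x i \<noteq> 0}. single i (x i) j) = x j" using that by (auto simp: tcar_def)
    qed
    finally show ?thesis by simp
  qed
qed

lemma T_diff_single: "x \<in> G i \<Longrightarrow> diff T (single i x) = single (Suc i) (d i x)"
  by (auto simp: single_def fun_eq_iff d_0 split: nat.splits)

lemma ksign_T: "x \<in> tcar G \<Longrightarrow> ksign T n x = (\<lambda>i. (-1) ^ n *\<^sub>R x i)"
  by (auto simp: ksign_def T_minus)

lemma class_ring_char_zero: assumes "0 < (m::nat)" shows "[m] \<cdot>\<^bsub>class_ring\<^esub> \<one>\<^bsub>class_ring\<^esub> \<noteq> \<zero>\<^bsub>(class_ring :: real ring)\<^esub>"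
proof -
  have "[m] \<cdot>\<^bsub>class_ring\<^esub> (1::real) = real m" for m :: nat
    by (induction m) (simp_all add: add_pow_def nat_pow_def)
  then show ?thesis using assms by simp
qed

lemma T_dgca: "dgca class_ring T"
proof (rule dgca.intro)
  show "vectorspace class_ring T" by (rule T_vectorspace)
  show "ring T" by (rule T_ring)
  show "dgca_axioms class_ring T"
  proof (rule dgca_axioms.intro)
    show "0 < (m::nat) \<Longrightarrow> [m] \<cdot>\<^bsub>class_ring\<^esub> \<one>\<^bsub>class_ring\<^esub> \<noteq> \<zero>\<^bsub>(class_ring :: real ring)\<^esub>" for m
      by (rule class_ring_char_zero)
    show "VectorSpace.subspace class_ring (grade T i) T" for i by (rule T_grade_subspace)
    show "x \<in> carrier T \<Longrightarrow> \<exists>!f. is_decomposition T f x" for x by (rule T_direct_sum)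
    show "\<one>\<^bsub>T\<^esub> \<in> grade T 0" using T_one by auto
    fix i j and x y assume "x \<in> grade T i" "y \<in> grade T j"
    then have x: "x = single i (x i)" "x i \<in> G i" and y: "y = single j (y j)" "y j \<in> G j" using grade_single by blast+
    have xy: "x \<otimes>\<^bsub>T\<^esub> y = single (i + j) (mu i j (x i) (y j))"
      using T_mult_single[OF x(2) y(2)] x(1) y(1) by metis
    have yx: "y \<otimes>\<^bsub>T\<^esub> x = single (j + i) (mu j i (y j) (x i))"
      using T_mult_single[OF y(2) x(2)] x(1) y(1) by metis
    show "x \<otimes>\<^bsub>T\<^esub> y \<in> grade T (i + j)" unfolding xy by (rule single_grade[OF mu_G[OF x(2) y(2)]])
    show "x \<otimes>\<^bsub>T\<^esub> y = ksign T (i * j) (y \<otimes>\<^bsub>T\<^esub> x)"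
      unfolding xy yx ksign_T[OF single_tcar[OF mu_G[OF y(2) x(2)]]] mu_comm[OF x(2) y(2)]
      by (auto simp: single_def fun_eq_iff)
    have dx: "diff T x = single (Suc i) (d i (x i))" using T_diff_single[OF x(2)] x(1) by metis
    have dy: "diff T y = single (Suc j) (d j (y j))" using T_diff_single[OF y(2)] y(1) by metis
    have e1: "diff T x \<otimes>\<^bsub>T\<^esub> y = single (Suc (i + j)) (mu (Suc i) j (d i (x i)) (y j))"
      unfolding dx using T_mult_single[OF d_G[OF x(2)] y(2)] y(1) by (metis add_Suc)
    have e2: "x \<otimes>\<^bsub>T\<^esub> diff T y = single (Suc (i + j)) (mu i (Suc j) (x i) (d j (y j)))"
      unfolding dy using T_mult_single[OF x(2) d_G[OF y(2)]] x(1) by (metis add_Suc_right)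
    have tc: "single (Suc (i + j)) (mu i (Suc j) (x i) (d j (y j))) \<in> tcar G"
      using single_tcar[OF mu_G[OF x(2) d_G[OF y(2)]]] by simp
    show "diff T (x \<otimes>\<^bsub>T\<^esub> y) = (diff T x \<otimes>\<^bsub>T\<^esub> y) \<oplus>\<^bsub>T\<^esub> ksign T i (x \<otimes>\<^bsub>T\<^esub> diff T y)"
      unfolding e1 e2 ksign_T[OF tc] xy T_diff_single[OF mu_G[OF x(2) y(2)]] d_mu[OF x(2) y(2)]
      by (auto simp: single_def fun_eq_iff)
  next
    show "diff T \<in> LinearCombinations.module_hom class_ring T T"
      using tcar_diff by (auto simp: LinearCombinations.module_hom_def d_add d_scale fun_eq_iff split: nat.splits)
    show "diff T x \<in> grade T (Suc i)" if "x \<in> grade T i" for x i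
      using grade_single[OF that] T_diff_single single_grade d_G by metis
    show "diff T (diff T x) = \<zero>\<^bsub>T\<^esub>" if "x \<in> carrier T" for x
      using that by (auto simp: fun_eq_iff d_0 d_d tcar_def split: nat.splits)
  qed (auto simp: mu_scale_left mu_scale_right scaleR_sum_right)
qed

end

section \<open>Isomorphisms of differential graded algebras\<close>

text \<open>
  Isomorphisms are described by equations on the carrier, without requiring the target to be a DGCA:
  \<open>iso_dgca\<close> then transports that property along the isomorphism.
\<close>

definition dgca_iso :: "(real, 'a) dgca \<Rightarrow> (real, 'b) dgca \<Rightarrow> ('a \<Rightarrow> 'b) \<Rightarrow> bool" where
  "dgca_iso A B f \<longleftrightarrow> bij_betw f (carrier A) (carrier B) \<and>
    (\<forall>x\<in>carrier A. \<forall>y\<in>carrier A. f (x \<oplus>\<^bsub>A\<^esub> y) = f x \<oplus>\<^bsub>B\<^esub> f y) \<and>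
    (\<forall>x\<in>carrier A. \<forall>y\<in>carrier A. f (x \<otimes>\<^bsub>A\<^esub> y) = f x \<otimes>\<^bsub>B\<^esub> f y) \<and>
    f \<one>\<^bsub>A\<^esub> = \<one>\<^bsub>B\<^esub> \<and> f \<zero>\<^bsub>A\<^esub> = \<zero>\<^bsub>B\<^esub> \<and> (\<forall>c. \<forall>x\<in>carrier A. f (c \<odot>\<^bsub>A\<^esub> x) = c \<odot>\<^bsub>B\<^esub> f x) \<and>
    (\<forall>i. f ` grade A i = grade B i) \<and> (\<forall>x\<in>carrier A. f (diff A x) = diff B (f x))"

lemma decomposition_transport:
  fixes A :: "(real, 'a) dgca" and B :: "(real, 'b) dgca"
  assumes A: "abelian_group A" and B: "abelian_group B" and sub: "\<And>i. grade A i \<subseteq> carrier A"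
    and bij: "bij_betw f (carrier A) (carrier B)"
    and add: "\<And>x y. x \<in> carrier A \<Longrightarrow> y \<in> carrier A \<Longrightarrow> f (x \<oplus>\<^bsub>A\<^esub> y) = f x \<oplus>\<^bsub>B\<^esub> f y"
    and z: "f \<zero>\<^bsub>A\<^esub> = \<zero>\<^bsub>B\<^esub>" and gr: "\<And>i x. x \<in> grade A i \<Longrightarrow> f x \<in> grade B i"
    and h: "is_decomposition A h x"
  shows "is_decomposition B (\<lambda>i. f (h i)) (f x)"
proof -
  interpret A: abelian_group A by fact
  interpret B: abelian_group B by fact
  have hg: "h i \<in> grade A i" and fin: "finite {i. h i \<noteq> \<zero>\<^bsub>A\<^esub>}" and x: "x = (\<Oplus>\<^bsub>A\<^esub>i\<in>{i. h i \<noteq> \<zero>\<^bsub>A\<^esub>}. h i)" for i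
    using h by (auto simp: is_decomposition_def)
  have hc: "h i \<in> carrier A" for i using hg sub by blast
  have fc: "f y \<in> carrier B" if "y \<in> carrier A" for y using bij that by (auto simp: bij_betw_def)
  have "f (h i) = \<zero>\<^bsub>B\<^esub> \<longleftrightarrow> h i = \<zero>\<^bsub>A\<^esub>" for i
    using bij hc[of i] z by (metis A.zero_closed bij_betw_def inj_onD)
  then have eq: "{i. f (h i) \<noteq> \<zero>\<^bsub>B\<^esub>} = {i. h i \<noteq> \<zero>\<^bsub>A\<^esub>}" by simp
  have "f x = (\<Oplus>\<^bsub>B\<^esub>i\<in>{i. h i \<noteq> \<zero>\<^bsub>A\<^esub>}. f (h i))"
    unfolding x by (rule A.finsum_additive[where B = B and p = f]) (use add z B fc hc fin in auto)
  then show ?thesis unfolding is_decomposition_def eq using hg gr fin by auto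
qed

lemma dgca_grade_sub: "dgca class_ring A \<Longrightarrow> grade A i \<subseteq> carrier A"
  using dgca.grade_subspace[of class_ring A i] by (simp add: VectorSpace.subspace_def submodule_def)

lemma dgca_iso_inv:
  assumes A: "dgca class_ring A" and iso: "dgca_iso A B f"
  shows "dgca_iso B A (inv_into (carrier A) f)"
proof -
  interpret A: dgca class_ring A by fact
  let ?g = "inv_into (carrier A) f"
  have bij: "bij_betw f (carrier A) (carrier B)" using iso by (simp add: dgca_iso_def)
  have gf: "?g (f x) = x" if "x \<in> carrier A" for x using bij_betw_inv_into_left[OF bij that] .
  have fg: "f (?g y) = y" if "y \<in> carrier B" for y using bij_betw_inv_into_right[OF bij that] .
  have gc: "?g y \<in> carrier A" if "y \<in> carrier B" for y using bij_betw_inv_into[OF bij] that by (auto simp: bij_betw_def)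
  have sub: "grade A i \<subseteq> carrier A" for i by (rule dgca_grade_sub[OF A])
  have dc: "diff A x \<in> carrier A" if "x \<in> carrier A" for x using A.diff_linear that by (auto simp: LinearCombinations.module_hom_def)
  show ?thesis unfolding dgca_iso_def
  proof (intro conjI ballI allI)
    show "bij_betw ?g (carrier B) (carrier A)" by (rule bij_betw_inv_into[OF bij])
    show "?g \<one>\<^bsub>B\<^esub> = \<one>\<^bsub>A\<^esub>" "?g \<zero>\<^bsub>B\<^esub> = \<zero>\<^bsub>A\<^esub>"
      using iso gf[of "\<one>\<^bsub>A\<^esub>"] gf[of "\<zero>\<^bsub>A\<^esub>"] by (auto simp: dgca_iso_def)
    show "?g ` grade B i = grade A i" for i
    proof -
      have "grade B i = f ` grade A i" using iso by (simp add: dgca_iso_def)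
      moreover have "?g ` f ` grade A i = (\<lambda>x. x) ` grade A i" unfolding image_image
        by (rule image_cong) (use gf sub in auto)
      ultimately show ?thesis by simp
    qed
    fix x assume x: "x \<in> carrier B"
    show "?g (c \<odot>\<^bsub>B\<^esub> x) = c \<odot>\<^bsub>A\<^esub> ?g x" for c
      using gf[of "c \<odot>\<^bsub>A\<^esub> ?g x"] iso gc[OF x] fg[OF x] by (simp add: dgca_iso_def)
    show "?g (diff B x) = diff A (?g x)" using gf[OF dc[OF gc[OF x]]] iso gc[OF x] fg[OF x] by (simp add: dgca_iso_def)
    fix y assume y: "y \<in> carrier B"
    show "?g (x \<oplus>\<^bsub>B\<^esub> y) = ?g x \<oplus>\<^bsub>A\<^esub> ?g y"
      using gf[of "?g x \<oplus>\<^bsub>A\<^esub> ?g y"] iso gc[OF x] gc[OF y] fg[OF x] fg[OF y] by (simp add: dgca_iso_def)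
    show "?g (x \<otimes>\<^bsub>B\<^esub> y) = ?g x \<otimes>\<^bsub>A\<^esub> ?g y"
      using gf[of "?g x \<otimes>\<^bsub>A\<^esub> ?g y"] iso gc[OF x] gc[OF y] fg[OF x] fg[OF y] by (simp add: dgca_iso_def)
  qed
qed

lemma iso_dgca:
  assumes A: "dgca class_ring A" and iso: "dgca_iso A B f"
  shows "dgca class_ring B"
proof -
  interpret A: dgca class_ring A by fact
  define g where "g = inv_into (carrier A) f"
  have giso: "dgca_iso B A g" unfolding g_def by (rule dgca_iso_inv[OF A iso])
  have bij: "bij_betw f (carrier A) (carrier B)" and bijg: "bij_betw g (carrier B) (carrier A)"
    using iso giso by (simp_all add: dgca_iso_def)
  have gf: "g (f x) = x" if "x \<in> carrier A" for x unfolding g_def using bij_betw_inv_into_left[OF bij that] .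
  have fg: "f (g y) = y" if "y \<in> carrier B" for y unfolding g_def using bij_betw_inv_into_right[OF bij that] .
  have gc: "g y \<in> carrier A" if "y \<in> carrier B" for y using bijg that by (auto simp: bij_betw_def)
  have fc: "f y \<in> carrier B" if "y \<in> carrier A" for y using bij that by (auto simp: bij_betw_def)
  have sub: "grade A i \<subseteq> carrier A" for i by (rule dgca_grade_sub[OF A])
  have dc: "diff A x \<in> carrier A" if "x \<in> carrier A" for x using A.diff_linear that by (auto simp: LinearCombinations.module_hom_def)
  have addB: "x \<oplus>\<^bsub>B\<^esub> y = f (g x \<oplus>\<^bsub>A\<^esub> g y)" and multB: "x \<otimes>\<^bsub>B\<^esub> y = f (g x \<otimes>\<^bsub>A\<^esub> g y)"
    if "x \<in> carrier B" "y \<in> carrier B" for x y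
    using iso gc[OF that(1)] gc[OF that(2)] fg[OF that(1)] fg[OF that(2)] by (simp_all add: dgca_iso_def)
  have smB: "c \<odot>\<^bsub>B\<^esub> x = f (c \<odot>\<^bsub>A\<^esub> g x)" and dB: "diff B x = f (diff A (g x))" if "x \<in> carrier B" for c x
    using iso gc[OF that] fg[OF that] by (simp_all add: dgca_iso_def)
  have oneB: "\<one>\<^bsub>B\<^esub> = f \<one>\<^bsub>A\<^esub>" and zeroB: "\<zero>\<^bsub>B\<^esub> = f \<zero>\<^bsub>A\<^esub>" using iso by (simp_all add: dgca_iso_def)
  have grB: "grade B i = f ` grade A i" for i using iso by (simp add: dgca_iso_def)
  have smc: "c \<odot>\<^bsub>A\<^esub> x \<in> carrier A" if "x \<in> carrier A" for c x using that by simp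
  note S = addB multB smB dB oneB zeroB gf fg gc fc dc
  have abB: "abelian_group B"
  proof (rule abelian_groupI)
    show "x \<oplus>\<^bsub>B\<^esub> y = y \<oplus>\<^bsub>B\<^esub> x" if "x \<in> carrier B" "y \<in> carrier B" for x y
      using that by (simp add: S A.M.a_comm[OF gc gc])
    show "\<exists>y\<in>carrier B. y \<oplus>\<^bsub>B\<^esub> x = \<zero>\<^bsub>B\<^esub>" if "x \<in> carrier B" for x
      using that by (intro bexI[of _ "f (\<ominus>\<^bsub>A\<^esub> g x)"]) (simp_all add: S A.M.l_neg)
  qed (simp_all add: S A.M.a_assoc)
  have ringB: "ring B"
  proof (rule ringI, rule abB)
    show "Group.monoid B" by (rule monoidI) (simp_all add: S A.A.m_assoc)
  qed (simp_all add: S A.A.l_distr A.A.r_distr)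
  have modB: "Module.module class_ring B"
  proof (rule moduleI)
    show "cring (class_ring :: real ring)" by (rule class_cring.cring_axioms)
    show "abelian_group B" by (rule abB)
  qed (use A.smult_l_distr A.smult_r_distr A.smult_assoc1 A.smult_one in \<open>simp_all add: S smc\<close>)
  have vsB: "vectorspace class_ring B" by (rule vectorspace.intro) (rule modB, rule class_field)
  have abA: "abelian_group A" by (rule A.M.abelian_group_axioms)
  have minusB: "\<ominus>\<^bsub>B\<^esub> f x = f (\<ominus>\<^bsub>A\<^esub> x)" if "x \<in> carrier A" for x
    by (rule abelian_group.minus_equality[OF abB]) (use that in \<open>simp_all add: S A.M.l_neg\<close>)
  have ksB: "ksign B n (f x) = f (ksign A n x)" if "x \<in> carrier A" for n x using minusB[OF that] by (simp add: ksign_def)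
  have ksc: "ksign A n x \<in> carrier A" if "x \<in> carrier A" for n x using that by (simp add: ksign_def)
  show ?thesis
  proof (rule dgca.intro[OF vsB ringB], rule dgca_axioms.intro)
    show "0 < (m::nat) \<Longrightarrow> [m] \<cdot>\<^bsub>class_ring\<^esub> \<one>\<^bsub>class_ring\<^esub> \<noteq> \<zero>\<^bsub>(class_ring :: real ring)\<^esub>" for m
      by (rule A.char_zero)
    show "c \<odot>\<^bsub>B\<^esub> x \<otimes>\<^bsub>B\<^esub> y = c \<odot>\<^bsub>B\<^esub> (x \<otimes>\<^bsub>B\<^esub> y)" "x \<otimes>\<^bsub>B\<^esub> (c \<odot>\<^bsub>B\<^esub> y) = c \<odot>\<^bsub>B\<^esub> (x \<otimes>\<^bsub>B\<^esub> y)"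
      if "c \<in> carrier class_ring" "x \<in> carrier B" "y \<in> carrier B" for c x y
      using that A.smult_mult_left[of c "g x" "g y"] A.smult_mult_right[of c "g x" "g y"] by (simp_all add: S smc)
    show "VectorSpace.subspace class_ring (grade B i) B" for i
    proof (rule VectorSpace.subspace.intro[OF vsB], rule submodule.intro[OF modB])
      have sA: "submodule class_ring (grade A i) A" using A.grade_subspace[of i] by (simp add: VectorSpace.subspace_def)
      show "grade B i \<subseteq> carrier B" using sub fc by (auto simp: grB)
      show "\<zero>\<^bsub>B\<^esub> \<in> grade B i" using submodule.zero_closed[OF sA] zeroB grB by auto
      show "x \<oplus>\<^bsub>B\<^esub> y \<in> grade B i" if xy: "x \<in> grade B i" "y \<in> grade B i" for x y
      proof -
        obtain x' y' where *: "x' \<in> grade A i" "y' \<in> grade A i" "x = f x'" "y = f y'" using xy by (auto simp: grB)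
        have "x \<oplus>\<^bsub>B\<^esub> y = f (x' \<oplus>\<^bsub>A\<^esub> y')" using * sub[of i] by (auto simp: S subset_iff)
        then show ?thesis using submodule.m_closed[OF sA *(1,2)] grB by blast
      qed
      show "c \<odot>\<^bsub>B\<^esub> x \<in> grade B i" if c: "c \<in> carrier class_ring" and x: "x \<in> grade B i" for c x
      proof -
        obtain x' where *: "x' \<in> grade A i" "x = f x'" using x by (auto simp: grB)
        have "c \<odot>\<^bsub>B\<^esub> x = f (c \<odot>\<^bsub>A\<^esub> x')" using * sub[of i] by (auto simp: S subset_iff)
        then show ?thesis using submodule.smult_closed[OF sA c *(1)] grB by blast
      qed
    qed
    have gsubB: "grade B i \<subseteq> carrier B" for i using sub fc by (auto simp: grB)
    show "\<exists>!h. is_decomposition B h x" if x: "x \<in> carrier B" for x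
    proof -
      obtain h where h: "is_decomposition A h (g x)" "\<And>k. is_decomposition A k (g x) \<Longrightarrow> k = h"
        using A.direct_sum[OF gc[OF x]] by blast
      show ?thesis
      proof (rule ex1I[of _ "\<lambda>i. f (h i)"])
        show "is_decomposition B (\<lambda>i. f (h i)) x"
          using decomposition_transport[OF abA abB sub bij _ _ _ h(1)] iso fg[OF x] by (force simp: dgca_iso_def)
        fix k assume k: "is_decomposition B k x"
        have "is_decomposition A (\<lambda>i. g (k i)) (g x)"
        proof (rule decomposition_transport[OF abB abA gsubB bijg _ _ _ k])
          show "g y \<in> grade A i" if y: "y \<in> grade B i" for i y
          proof -
            have "g ` grade B i = grade A i" using giso by (simp add: dgca_iso_def)
            then show ?thesis using y by blast
          qed
        qed (use giso in \<open>simp_all add: dgca_iso_def\<close>)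
        then have "h = (\<lambda>i. g (k i))" using h(2) by blast
        moreover have "f (g (k i)) = k i" for i using k gsubB fg by (auto simp: is_decomposition_def)
        ultimately show "k = (\<lambda>i. f (h i))" by auto
      qed
    qed
    show "\<one>\<^bsub>B\<^esub> \<in> grade B 0" using A.one_grade by (simp add: oneB grB)
    show "diff B \<in> LinearCombinations.module_hom class_ring B B"
      using A.diff_linear by (auto simp: LinearCombinations.module_hom_def S smc)
    show "diff B x \<in> grade B (Suc i)" if u: "x \<in> grade B i" for x i
    proof -
      obtain x' where *: "x' \<in> grade A i" "x = f x'" using u by (auto simp: grB)
      have "diff B x = f (diff A x')" using * sub[of i] by (auto simp: S subset_iff)
      then show ?thesis using A.diff_grade[OF *(1)] grB by blast
    qed
    show "diff B (diff B x) = \<zero>\<^bsub>B\<^esub>" if "x \<in> carrier B" for x using that A.diff_diff by (simp add: S)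
    fix x y i j assume xy: "x \<in> grade B i" "y \<in> grade B j"
    obtain x' y' where *: "x' \<in> grade A i" "y' \<in> grade A j" "x = f x'" "y = f y'" using xy by (auto simp: grB)
    have c: "x' \<in> carrier A" "y' \<in> carrier A" using * sub by blast+
    show "x \<otimes>\<^bsub>B\<^esub> y \<in> grade B (i + j)" using A.mult_grade[OF *(1,2)] c by (simp add: * S grB)
    show "x \<otimes>\<^bsub>B\<^esub> y = ksign B (i * j) (y \<otimes>\<^bsub>B\<^esub> x)"
      using A.graded_comm[OF *(1,2)] c by (simp add: * S ksB)
    show "diff B (x \<otimes>\<^bsub>B\<^esub> y) = diff B x \<otimes>\<^bsub>B\<^esub> y \<oplus>\<^bsub>B\<^esub> ksign B i (x \<otimes>\<^bsub>B\<^esub> diff B y)"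
      using A.leibniz[OF *(1,2)] c by (simp add: * S ksB ksc)
  qed
qed

text \<open>
  Every element of the direct sum is a finite sum of homogeneous ones.
\<close>

lemma (in gdga) total_induct [consumes 1, case_names zero single add]:
  assumes f: "f \<in> tcar G" and "P (\<lambda>_. 0)" and "\<And>i x. x \<in> G i \<Longrightarrow> P (single i x)"
    and "\<And>f g. f \<in> tcar G \<Longrightarrow> g \<in> tcar G \<Longrightarrow> P f \<Longrightarrow> P g \<Longrightarrow> P (\<lambda>i. f i + g i)"
  shows "P f"
proof -
  have "finite S \<Longrightarrow> \<forall>f\<in>tcar G. {i. f i \<noteq> 0} \<subseteq> S \<longrightarrow> P f" for S
  proof (induction S rule: finite_induct)
    case empty
    show ?case
    proof (intro ballI impI)
      fix f assume "f \<in> tcar G" "{i. f i \<noteq> 0} \<subseteq> {}"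
      then have "f = (\<lambda>_. 0)" by auto
      then show "P f" using assms(2) by simp
    qed
  next
    case (insert s S)
    show ?case
    proof (intro ballI impI)
      fix f assume f: "f \<in> tcar G" "{i. f i \<noteq> 0} \<subseteq> insert s S"
      define g where "g = (\<lambda>i. if i = s then 0 else f i)"
      have "{i. g i \<noteq> 0} \<subseteq> {i. f i \<noteq> 0}" by (auto simp: g_def)
      then have g: "g \<in> tcar G" using f(1) G_0 by (auto simp: tcar_def g_def intro: finite_subset)
      have "{i. g i \<noteq> 0} \<subseteq> S" using f(2) by (auto simp: g_def)
      then have "P g" using insert.IH g by blast
      have fs: "f s \<in> G s" using f(1) by (simp add: tcar_def)
      have "f = (\<lambda>i. single s (f s) i + g i)" by (auto simp: single_def g_def)
      then show "P f" using assms(4)[OF single_tcar[OF fs] g assms(3)[OF fs] \<open>P g\<close>] by simp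
    qed
  qed
  from this[of "{i. f i \<noteq> 0}"] show ?thesis using f by (simp add: tcar_def)
qed

section \<open>Models of arbitrary differential graded algebras\<close>

text \<open>
  Degreewise isomorphisms that respect products, differentials and units assemble to an isomorphism.
  The compatibilities extend from homogeneous elements by \<open>total_induct\<close>; bijectivity is uniqueness and
  existence of homogeneous decompositions.
\<close>

lemma (in gdga) total_iso:
  fixes A :: "(real, 'b) dgca" and p :: "nat \<Rightarrow> 'v \<Rightarrow> 'b"
  assumes A: "dgca class_ring A"
    and bij: "\<And>i. bij_betw (p i) (G i) (grade A i)"
    and add: "\<And>i x y. x \<in> G i \<Longrightarrow> y \<in> G i \<Longrightarrow> p i (x + y) = p i x \<oplus>\<^bsub>A\<^esub> p i y"
    and scale: "\<And>i c x. x \<in> G i \<Longrightarrow> p i (c *\<^sub>R x) = c \<odot>\<^bsub>A\<^esub> p i x"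
    and mult: "\<And>i j x y. x \<in> G i \<Longrightarrow> y \<in> G j \<Longrightarrow> p (i + j) (mu i j x y) = p i x \<otimes>\<^bsub>A\<^esub> p j y"
    and diff: "\<And>i x. x \<in> G i \<Longrightarrow> p (Suc i) (d i x) = diff A (p i x)"
    and one: "p 0 e = \<one>\<^bsub>A\<^esub>"
  shows "dgca_iso T A (\<lambda>f. finsum A (\<lambda>i. p i (f i)) {i. f i \<noteq> 0})"
proof -
  interpret A: dgca class_ring A by fact
  define Pi where "Pi = (\<lambda>f. finsum A (\<lambda>i. p i (f i)) {i. f i \<noteq> 0})"
  have pg: "p i x \<in> grade A i" if "x \<in> G i" for i x using bij[of i] that by (auto simp: bij_betw_def)
  have pc: "p i x \<in> carrier A" if "x \<in> G i" for i x using pg[OF that] dgca_grade_sub[OF A] by blast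
  have p0: "p i 0 = \<zero>\<^bsub>A\<^esub>" for i using scale[OF G_0, of i 0] A.smult_l_null[OF pc[OF G_0]] by simp
  have p00: "p i x = \<zero>\<^bsub>A\<^esub> \<longleftrightarrow> x = 0" if "x \<in> G i" for i x
    using bij[of i] that G_0[of i] p0[of i] by (metis bij_betw_def inj_onD)
  have tG: "f i \<in> G i" if "f \<in> tcar G" for f i using that by (simp add: tcar_def)
  have sup: "Pi f = finsum A (\<lambda>i. p i (f i)) S" if "f \<in> tcar G" "finite S" "{i. f i \<noteq> 0} \<subseteq> S" for f S
    unfolding Pi_def
    by (rule A.M.add.finprod_mono_neutral_cong_left) (use that pc tG p0 in auto)
  have Pi_single: "Pi (single i x) = p i x" if x: "x \<in> G i" for i x
  proof -
    have "{j. single i x j \<noteq> 0} \<subseteq> {i}" by (auto simp: single_def)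
    then have "Pi (single i x) = finsum A (\<lambda>j. p j (single i x j)) {i}" by (intro sup single_tcar x) simp_all
    also have "\<dots> = p i (single i x i)" using pc[OF x] by (simp add: single_def)
    finally show ?thesis by (simp add: single_def)
  qed
  have Pi_c: "Pi f \<in> carrier A" if "f \<in> tcar G" for f
    unfolding Pi_def by (rule A.M.finsum_closed) (use that pc tG in auto)
  have Pi_0: "Pi (\<lambda>_. 0) = \<zero>\<^bsub>A\<^esub>" by (simp add: Pi_def)
  have Pi_add: "Pi (\<lambda>i. f i + g i) = Pi f \<oplus>\<^bsub>A\<^esub> Pi g" if f: "f \<in> tcar G" and g: "g \<in> tcar G" for f g
  proof -
    let ?S = "{i. f i \<noteq> 0} \<union> {i. g i \<noteq> 0}"
    have fin: "finite ?S" using f g by (simp add: tcar_def)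
    have "Pi (\<lambda>i. f i + g i) = finsum A (\<lambda>i. p i (f i + g i)) ?S" by (rule sup[OF tcar_add[OF f g] fin]) auto
    also have "\<dots> = finsum A (\<lambda>i. p i (f i) \<oplus>\<^bsub>A\<^esub> p i (g i)) ?S"
      by (rule A.M.finsum_cong') (use f g tG pc add in auto)
    also have "\<dots> = finsum A (\<lambda>i. p i (f i)) ?S \<oplus>\<^bsub>A\<^esub> finsum A (\<lambda>i. p i (g i)) ?S"
      by (rule A.M.finsum_addf) (use f g tG pc in auto)
    also have "\<dots> = Pi f \<oplus>\<^bsub>A\<^esub> Pi g" using sup[OF f fin] sup[OF g fin] by simp
    finally show ?thesis .
  qed
  have Pi_scale: "Pi (\<lambda>i. c *\<^sub>R f i) = c \<odot>\<^bsub>A\<^esub> Pi f" if f: "f \<in> tcar G" for c f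
  proof -
    let ?S = "{i. f i \<noteq> 0}"
    have fin: "finite ?S" using f by (simp add: tcar_def)
    have "Pi (\<lambda>i. c *\<^sub>R f i) = finsum A (\<lambda>i. p i (c *\<^sub>R f i)) ?S" by (rule sup[OF tcar_scale[OF f] fin]) auto
    also have "\<dots> = finsum A (\<lambda>i. c \<odot>\<^bsub>A\<^esub> p i (f i)) ?S"
      by (rule A.M.finsum_cong') (use f tG pc scale in auto)
    also have "\<dots> = c \<odot>\<^bsub>A\<^esub> finsum A (\<lambda>i. p i (f i)) ?S"
      by (rule A.finsum_smult_ldistr[symmetric]) (use f fin tG pc in auto)
    also have "\<dots> = c \<odot>\<^bsub>A\<^esub> Pi f" using sup[OF f fin] by simp
    finally show ?thesis .
  qed
  have tm: "f \<otimes>\<^bsub>T\<^esub> g \<in> tcar G" if "f \<in> tcar G" "g \<in> tcar G" for f g using tcar_mult[OF that] by simp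
  have M1: "Pi (single i x \<otimes>\<^bsub>T\<^esub> g) = p i x \<otimes>\<^bsub>A\<^esub> Pi g" if x: "x \<in> G i" and g: "g \<in> tcar G" for i x g
    using g
  proof (induction g rule: total_induct)
    case zero
    have "single i x \<otimes>\<^bsub>T\<^esub> (\<lambda>_. 0) = (\<lambda>_. 0)" by (simp add: mu_0_right)
    then show ?case using pc[OF x] by (simp only: Pi_0 A.A.r_null)
  next
    case (single j y)
    show ?case by (simp only: T_mult_single[OF x single] Pi_single[OF mu_G[OF x single]] Pi_single[OF single] mult[OF x single])
  next
    case (add g h)
    have "single i x \<otimes>\<^bsub>T\<^esub> (\<lambda>k. g k + h k) = (\<lambda>k. (single i x \<otimes>\<^bsub>T\<^esub> g) k + (single i x \<otimes>\<^bsub>T\<^esub> h) k)"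
      by (simp add: mu_add_right sum.distrib)
    then show ?case
      using add pc[OF x] Pi_c by (simp only: Pi_add tm single_tcar[OF x] A.A.r_distr)
  qed
  have Pi_mult: "Pi (f \<otimes>\<^bsub>T\<^esub> g) = Pi f \<otimes>\<^bsub>A\<^esub> Pi g" if f: "f \<in> tcar G" and g: "g \<in> tcar G" for f g
    using f
  proof (induction f rule: total_induct)
    case zero
    have "(\<lambda>_. 0) \<otimes>\<^bsub>T\<^esub> g = (\<lambda>_. 0)" by (simp add: mu_0_left)
    then show ?case using Pi_c[OF g] by (simp only: Pi_0 A.A.l_null)
  next
    case (single j y)
    show ?case by (simp only: M1[OF single g] Pi_single[OF single])
  next
    case (add f h)
    have "(\<lambda>k. f k + h k) \<otimes>\<^bsub>T\<^esub> g = (\<lambda>k. (f \<otimes>\<^bsub>T\<^esub> g) k + (h \<otimes>\<^bsub>T\<^esub> g) k)"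
      by (simp add: mu_add_left sum.distrib)
    then show ?case
      using add Pi_c g by (simp only: Pi_add tm A.A.l_distr)
  qed
  note dA = LinearCombinations.module_hom_add[OF A.diff_linear] LinearCombinations.module_hom_smult[OF A.diff_linear]
  have d0: "diff A \<zero>\<^bsub>A\<^esub> = \<zero>\<^bsub>A\<^esub>" using diff[OF G_0, of 0] by (simp add: d_0 p0)
  have td: "diff T f \<in> tcar G" if "f \<in> tcar G" for f using tcar_diff[OF that] by simp
  have Pi_diff: "Pi (diff T f) = diff A (Pi f)" if f: "f \<in> tcar G" for f
    using f
  proof (induction f rule: total_induct)
    case zero
    have "diff T (\<lambda>_. 0) = (\<lambda>_. 0)" by (auto simp: d_0 split: nat.splits)
    then show ?case by (simp only: Pi_0 d0)
  next
    case (single j y)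
    show ?case by (simp only: T_diff_single[OF single] Pi_single[OF single] Pi_single[OF d_G[OF single]] diff[OF single])
  next
    case (add f h)
    have "diff T (\<lambda>k. f k + h k) = (\<lambda>k. diff T f k + diff T h k)" by (auto simp: d_add split: nat.splits)
    then show ?case using add Pi_c by (simp only: Pi_add td dA(1))
  qed
  have dec: "is_decomposition A (\<lambda>i. p i (f i)) (Pi f)" if f: "f \<in> tcar G" for f
  proof -
    have "p i (f i) \<noteq> \<zero>\<^bsub>A\<^esub> \<longleftrightarrow> f i \<noteq> 0" for i using p00[OF tG[OF f]] by simp
    then show ?thesis using f pg[OF tG[OF f]] by (simp add: is_decomposition_def Pi_def tcar_def)
  qed
  have bijPi: "bij_betw Pi (tcar G) (carrier A)"
    unfolding bij_betw_def
  proof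
    show "inj_on Pi (tcar G)"
    proof (rule inj_onI)
      fix f g assume fg: "f \<in> tcar G" "g \<in> tcar G" "Pi f = Pi g"
      have "(\<lambda>i. p i (f i)) = (\<lambda>i. p i (g i))"
        using A.direct_sum[OF Pi_c[OF fg(1)]] dec[OF fg(1)] dec[OF fg(2)] fg(3) by auto
      then have pp: "p i (f i) = p i (g i)" for i by (rule fun_cong)
      show "f = g"
      proof
        fix i show "f i = g i" using bij[of i] pp[of i] tG[OF fg(1), of i] tG[OF fg(2), of i] by (auto simp: bij_betw_def inj_on_def)
      qed
    qed
    show "Pi ` tcar G = carrier A"
    proof
      show "Pi ` tcar G \<subseteq> carrier A" using Pi_c by blast
      show "carrier A \<subseteq> Pi ` tcar G"
      proof
        fix x assume "x \<in> carrier A"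
        then obtain h where h: "is_decomposition A h x" using A.direct_sum by blast
        define f where "f = (\<lambda>i. inv_into (G i) (p i) (h i))"
        have hg: "h i \<in> grade A i" for i using h by (simp add: is_decomposition_def)
        have fG: "f i \<in> G i" and pf: "p i (f i) = h i" for i
          using bij_betw_inv_into[OF bij[of i]] bij_betw_inv_into_right[OF bij[of i] hg] hg by (auto simp: f_def bij_betw_def)
        have f0: "f i \<noteq> 0 \<longleftrightarrow> h i \<noteq> \<zero>\<^bsub>A\<^esub>" for i using p00[OF fG[of i]] pf[of i] by simp
        have "f \<in> tcar G" using fG h by (simp add: tcar_def f0 is_decomposition_def)
        moreover have "x = Pi f" using h by (simp add: Pi_def f0 pf is_decomposition_def)
        ultimately show "x \<in> Pi ` tcar G" by blast
      qed
    qed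
  qed
  have gr: "Pi ` grade T i = grade A i" for i
  proof
    show "Pi ` grade T i \<subseteq> grade A i"
    proof
      fix y assume "y \<in> Pi ` grade T i"
      then obtain f where f: "f \<in> grade T i" "y = Pi f" by blast
      note g = grade_single[OF f(1)]
      have "y = p i (f i)" using f(2) g Pi_single[OF conjunct2[OF g]] by metis
      then show "y \<in> grade A i" using pg g by simp
    qed
    show "grade A i \<subseteq> Pi ` grade T i"
    proof
      fix y assume "y \<in> grade A i"
      then obtain x where x: "x \<in> G i" "y = p i x" using bij[of i] by (auto simp: bij_betw_def)
      then show "y \<in> Pi ` grade T i" using Pi_single[OF x(1)] single_grade[OF x(1)] by (intro image_eqI[of _ _ "single i x"]) simp_all
    qed
  qed
  have "(\<lambda>i. if i = 0 then e else 0) = single 0 e" by (simp add: single_def)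
  then have Pi_one: "Pi (\<lambda>i. if i = 0 then e else 0) = \<one>\<^bsub>A\<^esub>" using Pi_single[OF e_G] one by simp
  have "dgca_iso T A Pi"
    unfolding dgca_iso_def
  proof (intro conjI ballI allI)
    fix x y assume "x \<in> carrier T" "y \<in> carrier T"
    then show "Pi (x \<otimes>\<^bsub>T\<^esub> y) = Pi x \<otimes>\<^bsub>A\<^esub> Pi y" by (intro Pi_mult) simp_all
  next
    fix x assume "x \<in> carrier T"
    then show "Pi (diff T x) = diff A (Pi x)" by (intro Pi_diff) simp
  qed (use bijPi gr Pi_add Pi_scale Pi_0 Pi_one in simp_all)
  then show ?thesis by (simp add: Pi_def)
qed

text \<open>
  The carrier of a record is only a vector space relative to a set, so a type of class
  \<open>real_vector\<close> has to be found into which it embeds. The free vector space on the elements of the type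
  serves: evaluation of formal linear combinations maps it onto the carrier, and a complement \<open>C\<close> of the
  kernel is a copy of the carrier. Products and differentials are transported by the inverse \<open>sg\<close>;
  being defined through evaluation, they are linear on the whole free space.
\<close>

lemma dgca_model:
  fixes A :: "(real, 'a) dgca"
  assumes A: "dgca class_ring A"
  shows "\<exists>(G :: nat \<Rightarrow> ('a \<Rightarrow>\<^sub>0 real) set) m D e Pi. gdga G (\<lambda>_ _. m) (\<lambda>_. D) e \<and> dgca_iso (total G (\<lambda>_ _. m) (\<lambda>_. D) e) A Pi"
proof -
  interpret A: dgca class_ring A by fact
  have s1: "(a + b) \<odot>\<^bsub>A\<^esub> x = a \<odot>\<^bsub>A\<^esub> x \<oplus>\<^bsub>A\<^esub> b \<odot>\<^bsub>A\<^esub> x" "(a * b) \<odot>\<^bsub>A\<^esub> x = a \<odot>\<^bsub>A\<^esub> (b \<odot>\<^bsub>A\<^esub> x)"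
    "0 \<odot>\<^bsub>A\<^esub> x = \<zero>\<^bsub>A\<^esub>" "1 \<odot>\<^bsub>A\<^esub> x = x" "a \<odot>\<^bsub>A\<^esub> x \<in> carrier A"
    if "x \<in> carrier A" for a b x
    using that A.smult_l_distr[of a b x] A.smult_assoc1[of a b x] A.smult_l_null[of x] A.smult_one[of x] by simp_all
  \<comment> \<open>Formal combinations may involve elements outside the carrier; these are sent to zero.\<close>
  define prj where "prj = (\<lambda>a. if a \<in> carrier A then a else \<zero>\<^bsub>A\<^esub>)"
  have prj: "prj a \<in> carrier A" for a by (simp add: prj_def)
  define ev where "ev = (\<lambda>v :: 'a \<Rightarrow>\<^sub>0 real. finsum A (\<lambda>a. Poly_Mapping.lookup v a \<odot>\<^bsub>A\<^esub> prj a) (Poly_Mapping.keys v))"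
  have sup: "ev v = finsum A (\<lambda>a. Poly_Mapping.lookup v a \<odot>\<^bsub>A\<^esub> prj a) S" if "finite S" "Poly_Mapping.keys v \<subseteq> S" for v S
    unfolding ev_def
    by (rule A.M.add.finprod_mono_neutral_cong_left) (use that s1[OF prj] in \<open>auto simp: not_in_keys_iff_lookup_eq_zero\<close>)
  have ev_c: "ev v \<in> carrier A" for v unfolding ev_def by (rule A.M.finsum_closed) (use s1[OF prj] in auto)
  have ev_add: "ev (v + w) = ev v \<oplus>\<^bsub>A\<^esub> ev w" for v w
  proof -
    let ?S = "Poly_Mapping.keys v \<union> Poly_Mapping.keys w"
    have "ev (v + w) = finsum A (\<lambda>a. (Poly_Mapping.lookup v a \<odot>\<^bsub>A\<^esub> prj a) \<oplus>\<^bsub>A\<^esub> (Poly_Mapping.lookup w a \<odot>\<^bsub>A\<^esub> prj a)) ?S"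
      using sup[of ?S "v + w"] Poly_Mapping.keys_add[of v w] by (simp add: lookup_add s1[OF prj])
    also have "\<dots> = ev v \<oplus>\<^bsub>A\<^esub> ev w"
      using A.M.finsum_addf[of "\<lambda>a. Poly_Mapping.lookup v a \<odot>\<^bsub>A\<^esub> prj a" ?S "\<lambda>a. Poly_Mapping.lookup w a \<odot>\<^bsub>A\<^esub> prj a"]
        sup[of ?S v] sup[of ?S w] s1[OF prj] by simp
    finally show ?thesis .
  qed
  have ev_scale: "ev (c *\<^sub>R v) = c \<odot>\<^bsub>A\<^esub> ev v" for c v
  proof -
    let ?S = "Poly_Mapping.keys v"
    have "Poly_Mapping.keys (c *\<^sub>R v) \<subseteq> ?S" by (auto simp: in_keys_iff pm_lookup_scaleR)
    then have "ev (c *\<^sub>R v) = finsum A (\<lambda>a. c \<odot>\<^bsub>A\<^esub> (Poly_Mapping.lookup v a \<odot>\<^bsub>A\<^esub> prj a)) ?S"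
      using sup[of ?S "c *\<^sub>R v"] by (simp add: pm_lookup_scaleR s1[OF prj])
    also have "\<dots> = c \<odot>\<^bsub>A\<^esub> ev v" unfolding ev_def
      by (rule A.finsum_smult_ldistr[symmetric]) (use s1[OF prj] in auto)
    finally show ?thesis .
  qed
  have ev_single: "ev (Poly_Mapping.single a 1) = a" if "a \<in> carrier A" for a
    using sup[of "{a}" "Poly_Mapping.single a 1"] s1[OF that] that by (simp add: prj_def)
  have ev_0: "ev 0 = \<zero>\<^bsub>A\<^esub>" by (simp add: ev_def)
  define N where "N = {v. ev v = \<zero>\<^bsub>A\<^esub>}"
  have N: "vsubspace N" by (auto simp: N_def real_vector.subspace_def ev_0 ev_add ev_scale)
  obtain C where C: "vsubspace C" "\<And>x. x \<in> N \<Longrightarrow> x \<in> C \<Longrightarrow> x = 0" "\<And>w. \<exists>c\<in>C. w - c \<in> N"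
  proof (rule exists_complement[OF N real_vector.subspace_UNIV subset_UNIV])
    fix C assume c: "vsubspace C" "\<And>x. x \<in> N \<Longrightarrow> x \<in> C \<Longrightarrow> x = 0" "\<And>w. w \<in> UNIV \<Longrightarrow> \<exists>c\<in>C. w - c \<in> N"
    show ?thesis by (rule that[OF c(1)]) (rule c(2), assumption+, rule c(3), rule UNIV_I)
  qed
  have ev_diff: "ev (v - w) = \<zero>\<^bsub>A\<^esub> \<longleftrightarrow> ev v = ev w" for v w
  proof -
    have "ev v = ev (v - w) \<oplus>\<^bsub>A\<^esub> ev w" using ev_add[of "v - w" w] by simp
    then show ?thesis using ev_c by (metis A.M.l_zero A.M.add.r_cancel_one')
  qed
  have inj: "inj_on ev C"
  proof (rule inj_onI)
    fix x y assume "x \<in> C" "y \<in> C" "ev x = ev y"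
    then have "x - y \<in> C" "x - y \<in> N" using vsubspace_diff[OF C(1)] ev_diff by (simp_all add: N_def)
    then have "x - y = 0" by (intro C(2))
    then show "x = y" by simp
  qed
  have surj: "ev ` C = carrier A"
  proof
    show "ev ` C \<subseteq> carrier A" using ev_c by blast
    show "carrier A \<subseteq> ev ` C"
    proof
      fix a assume a: "a \<in> carrier A"
      obtain c where c: "c \<in> C" "Poly_Mapping.single a 1 - c \<in> N" using C(3)[of "Poly_Mapping.single a 1"] by blast
      then have "ev c = a" using ev_diff[of "Poly_Mapping.single a 1" c] ev_single[OF a] by (simp add: N_def)
      then show "a \<in> ev ` C" using c(1) by blast
    qed
  qed
  define sg where "sg = inv_into C ev"
  have sgC: "sg y \<in> C" and ev_sg: "ev (sg y) = y" if "y \<in> carrier A" for y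
    using that surj inv_into_into[of y ev C] f_inv_into_f[of y ev C] by (simp_all add: sg_def)
  have sg_ev: "sg (ev x) = x" if "x \<in> C" for x using inv_into_f_f[OF inj that] by (simp add: sg_def)
  have sg_add: "sg (y \<oplus>\<^bsub>A\<^esub> z) = sg y + sg z" if "y \<in> carrier A" "z \<in> carrier A" for y z
    using that sg_ev[of "sg y + sg z"] vsubspace_add[OF C(1) sgC sgC] by (simp add: ev_add ev_sg)
  have sg_scale: "sg (c \<odot>\<^bsub>A\<^esub> y) = c *\<^sub>R sg y" if "y \<in> carrier A" for c y
    using that sg_ev[of "c *\<^sub>R sg y"] vsubspace_scale[OF C(1) sgC] by (simp add: ev_scale ev_sg)
  have sg_minus: "sg (\<ominus>\<^bsub>A\<^esub> y) = - sg y" if "y \<in> carrier A" for y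
  proof -
    have "sg \<zero>\<^bsub>A\<^esub> = 0" using sg_ev[OF vsubspace_0[OF C(1)]] ev_0 by simp
    then have "sg (\<ominus>\<^bsub>A\<^esub> y) + sg y = 0" using sg_add[of "\<ominus>\<^bsub>A\<^esub> y" y] that by (simp add: A.M.l_neg)
    then show ?thesis by (simp add: add_eq_0_iff2)
  qed
  have sg_ks: "sg (ksign A n y) = (-1) ^ n *\<^sub>R sg y" if "y \<in> carrier A" for n y
    using sg_minus[OF that] by (simp add: ksign_def)
  define m where "m = (\<lambda>v w. sg (ev v \<otimes>\<^bsub>A\<^esub> ev w))"
  define D where "D = (\<lambda>v. sg (diff A (ev v)))"
  define e where "e = sg \<one>\<^bsub>A\<^esub>"
  define G where "G = (\<lambda>i. {v \<in> C. ev v \<in> grade A i})"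
  note dA = LinearCombinations.module_hom_add[OF A.diff_linear] LinearCombinations.module_hom_smult[OF A.diff_linear]
  have dc: "diff A x \<in> carrier A" if "x \<in> carrier A" for x
    using LinearCombinations.module_hom_closed[OF A.diff_linear] that by blast
  have ev_m: "ev (m v w) = ev v \<otimes>\<^bsub>A\<^esub> ev w" for v w by (simp add: m_def ev_sg ev_c)
  have ev_D: "ev (D v) = diff A (ev v)" for v by (simp add: D_def ev_sg ev_c dc)
  have mC: "m v w \<in> C" and DC: "D v \<in> C" for v w by (simp_all add: m_def D_def sgC ev_c dc)
  have gsub: "submodule class_ring (grade A i) A" for i using A.grade_subspace[of i] by (simp add: VectorSpace.subspace_def)
  have eqC: "x = y" if "x \<in> C" "y \<in> C" "ev x = ev y" for x y using inj that by (auto simp: inj_on_def)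
  have gd: "gdga G (\<lambda>_ _. m) (\<lambda>_. D) e"
  proof (rule gdga.intro)
    show "vsubspace (G i)" for i
      using C(1) submodule.zero_closed[OF gsub[of i]] submodule.m_closed[OF gsub[of i]] submodule.smult_closed[OF gsub[of i]]
      by (auto simp: G_def real_vector.subspace_def ev_0 ev_add ev_scale)
    show "bilinear m"
      by (rule bilinearI) (simp_all add: m_def ev_add ev_scale A.A.l_distr A.A.r_distr ev_c sg_add sg_scale A.smult_mult_left A.smult_mult_right)
    show "linear D"
      by (rule linearI) (simp_all add: D_def ev_add ev_scale dA ev_c dc sg_add sg_scale)
    show "e \<in> G 0" using A.one_grade by (simp add: G_def e_def sgC ev_sg)
    fix i j k x y z assume x: "x \<in> G i" and y: "y \<in> G j" and z: "z \<in> G k"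
    show "m x y \<in> G (i + j)" using x y A.mult_grade by (simp add: G_def mC ev_m)
    show "m (m x y) z = m x (m y z)" unfolding m_def by (simp add: ev_sg ev_c A.A.m_assoc)
    show "m x y = (-1) ^ (i * j) *\<^sub>R m y x"
      using x y A.graded_comm[of "ev x" i "ev y" j] sg_ks[of "ev y \<otimes>\<^bsub>A\<^esub> ev x" "i * j"] by (simp add: G_def m_def ev_c)
    show "D (m x y) = m (D x) y + (-1) ^ i *\<^sub>R m x (D y)"
    proof -
      have "diff A (ev x \<otimes>\<^bsub>A\<^esub> ev y) = (diff A (ev x) \<otimes>\<^bsub>A\<^esub> ev y) \<oplus>\<^bsub>A\<^esub> ksign A i (ev x \<otimes>\<^bsub>A\<^esub> diff A (ev y))"
        using x y by (intro A.leibniz[where j = j]) (simp_all add: G_def)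
      moreover have "ksign A i (ev x \<otimes>\<^bsub>A\<^esub> diff A (ev y)) \<in> carrier A" by (simp add: ksign_def ev_c dc)
      ultimately show ?thesis
        by (simp add: D_def m_def ev_sg ev_c dc sg_add sg_ks)
    qed
  next
    fix i x assume x: "x \<in> G i"
    show "D x \<in> G (Suc i)" using x A.diff_grade by (simp add: G_def DC ev_D)
    show "m e x = x" using x sg_ev by (simp add: m_def e_def ev_sg ev_c G_def)
    show "D (D x) = 0"
      by (rule eqC[OF DC vsubspace_0[OF C(1)]]) (simp add: ev_D A.diff_diff ev_c ev_0)
  qed
  interpret g: gdga G "\<lambda>_ _. m" "\<lambda>_. D" e by (rule gd)
  have "dgca_iso (total G (\<lambda>_ _. m) (\<lambda>_. D) e) A (\<lambda>f. finsum A (\<lambda>i. (\<lambda>_. ev) i (f i)) {i. f i \<noteq> 0})"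
  proof (rule g.total_iso[OF A])
    show "bij_betw ((\<lambda>_. ev) i) (G i) (grade A i)" for i
    proof -
      have "inj_on ev (G i)" using inj by (auto simp: G_def inj_on_def)
      moreover have "ev ` G i = grade A i"
        using dgca_grade_sub[OF A, of i] surj by (auto simp: G_def image_iff)
      ultimately show ?thesis by (simp add: bij_betw_def)
    qed
  qed (simp_all add: ev_add ev_scale ev_m ev_D e_def ev_sg)
  then show ?thesis using gd by (intro exI conjI)
qed

section \<open>Cohomology of a modelled algebra\<close>

text \<open>
  A DGCA record together with an isomorphism from the direct sum of a typed model.
\<close>

locale gdga_model = gdga G mu d e
  for G :: "nat \<Rightarrow> 'v::real_vector set" and mu d e +
  fixes A :: "(real, 'b) dgca" and Pi :: "(nat \<Rightarrow> 'v) \<Rightarrow> 'b"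
  assumes iso: "dgca_iso T A Pi"
begin

lemma A_dgca: "dgca class_ring A" by (rule iso_dgca[OF T_dgca iso])

sublocale A: dgca class_ring A by (rule A_dgca)

lemma Pi_bij: "bij_betw Pi (tcar G) (carrier A)" using iso by (simp add: dgca_iso_def)

lemma Pi_c: "f \<in> tcar G \<Longrightarrow> Pi f \<in> carrier A" using Pi_bij by (auto simp: bij_betw_def)

lemma Pi_surj: assumes "x \<in> carrier A" obtains f where "f \<in> tcar G" "x = Pi f"
  using Pi_bij assms by (auto simp: bij_betw_def)

lemma Pi_eq: "f \<in> tcar G \<Longrightarrow> g \<in> tcar G \<Longrightarrow> Pi f = Pi g \<longleftrightarrow> f = g"
  using Pi_bij by (auto simp: bij_betw_def inj_on_def)

lemma Pi_add: "f \<in> tcar G \<Longrightarrow> g \<in> tcar G \<Longrightarrow> Pi (\<lambda>i. f i + g i) = Pi f \<oplus>\<^bsub>A\<^esub> Pi g"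
  using iso by (simp add: dgca_iso_def)

lemma Pi_mult: assumes "f \<in> tcar G" "g \<in> tcar G" shows "Pi (f \<otimes>\<^bsub>T\<^esub> g) = Pi f \<otimes>\<^bsub>A\<^esub> Pi g"
proof -
  have "\<forall>f\<in>carrier T. \<forall>g\<in>carrier T. Pi (f \<otimes>\<^bsub>T\<^esub> g) = Pi f \<otimes>\<^bsub>A\<^esub> Pi g" using iso unfolding dgca_iso_def by blast
  then show ?thesis using assms by simp
qed

lemma Pi_scale: "f \<in> tcar G \<Longrightarrow> Pi (\<lambda>i. c *\<^sub>R f i) = c \<odot>\<^bsub>A\<^esub> Pi f"
  using iso by (simp add: dgca_iso_def)

lemma Pi_0: "Pi (\<lambda>_. 0) = \<zero>\<^bsub>A\<^esub>" using iso by (simp add: dgca_iso_def)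

lemma Pi_one: "Pi (single 0 e) = \<one>\<^bsub>A\<^esub>" using iso by (simp add: dgca_iso_def single_def)

lemma Pi_diff: assumes "f \<in> tcar G" shows "diff A (Pi f) = Pi (diff T f)"
proof -
  have "\<forall>f\<in>carrier T. Pi (diff T f) = diff A (Pi f)" using iso unfolding dgca_iso_def by blast
  then show ?thesis using assms by simp
qed

lemma Pi_grade: "grade A i = (\<lambda>x. Pi (single i x)) ` G i"
proof -
  have "grade A i = Pi ` grade T i" using iso unfolding dgca_iso_def by blast
  moreover have "grade T i = single i ` G i"
    using grade_single[of _ G mu d e i] single_grade[of _ i] by (auto simp: image_iff simp del: total_simps)
  ultimately show ?thesis by (simp add: image_image)
qed

lemma tcar_diff2: "f \<in> tcar G \<Longrightarrow> g \<in> tcar G \<Longrightarrow> (\<lambda>i. f i - g i) \<in> tcar G"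
  using tcar_add[of f "\<lambda>i. (-1) *\<^sub>R g i"] tcar_scale[of g "-1"] by simp

lemma Pi_minus: assumes "f \<in> tcar G" "g \<in> tcar G" shows "Pi (\<lambda>i. f i - g i) = Pi f \<ominus>\<^bsub>A\<^esub> Pi g"
proof -
  have "Pi (\<lambda>i. f i - g i) \<oplus>\<^bsub>A\<^esub> Pi g = Pi f" using Pi_add[OF tcar_diff2[OF assms] assms(2)] by simp
  then show ?thesis using Pi_c[OF assms(1)] Pi_c[OF assms(2)] Pi_c[OF tcar_diff2[OF assms]]
    by (metis A.M.add.inv_solve_right A.M.minus_eq)
qed

lemma tZ: "f \<in> tcar Z \<Longrightarrow> f \<in> tcar G" and tX: "f \<in> tcar X \<Longrightarrow> f \<in> tcar G" and tXZ: "f \<in> tcar X \<Longrightarrow> f \<in> tcar Z"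
  using Z_G X_G X_Z[THEN subsetD] by (auto simp: tcar_def)

text \<open>
  Since the differential is graded, being a cocycle or a coboundary can be tested in each degree.
\<close>

lemma cocycles_Pi: "cocycles A = Pi ` tcar Z"
proof -
  have "diff A (Pi f) = \<zero>\<^bsub>A\<^esub> \<longleftrightarrow> f \<in> tcar Z" if f: "f \<in> tcar G" for f
  proof -
    have "diff T f \<in> tcar G" using tcar_diff[OF f] by simp
    then have "diff A (Pi f) = \<zero>\<^bsub>A\<^esub> \<longleftrightarrow> diff T f = (\<lambda>_. 0)"
      unfolding Pi_diff[OF f] Pi_0[symmetric] by (rule Pi_eq[OF _ tcar_0])
    also have "\<dots> \<longleftrightarrow> (\<forall>i. d i (f i) = 0)"
    proof
      assume a: "diff T f = (\<lambda>_. 0)"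
      show "\<forall>i. d i (f i) = 0"
      proof
        fix i show "d i (f i) = 0" using fun_cong[OF a, of "Suc i"] by simp
      qed
    qed (auto split: nat.splits)
    also have "\<dots> \<longleftrightarrow> f \<in> tcar Z" using f by (auto simp: tcar_def Z_def)
    finally show ?thesis .
  qed
  then show ?thesis using Pi_c tZ by (auto simp: cocycles_def elim!: Pi_surj)
qed

lemma coboundaries_Pi: "coboundaries A = Pi ` tcar X"
proof
  show "coboundaries A \<subseteq> Pi ` tcar X"
  proof
    fix y assume "y \<in> coboundaries A"
    then obtain f where f: "f \<in> tcar G" "y = Pi (diff T f)"
      unfolding coboundaries_def using Pi_surj Pi_diff by (metis imageE)
    have "diff T f \<in> tcar X" using tcar_diff[OF f(1)] f(1)
      by (auto simp: tcar_def X_def split: nat.splits)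
    then show "y \<in> Pi ` tcar X" using f(2) by blast
  qed
  show "Pi ` tcar X \<subseteq> coboundaries A"
  proof
    fix y assume "y \<in> Pi ` tcar X"
    then obtain g where g: "g \<in> tcar X" "y = Pi g" by blast
    have "\<exists>u. u \<in> G i \<and> g (Suc i) = d i u \<and> (g (Suc i) = 0 \<longrightarrow> u = 0)" for i
    proof (cases "g (Suc i) = 0")
      case True then show ?thesis using G_0 d_0 by auto
    next
      case False
      have "g (Suc i) \<in> X (Suc i)" using g(1) by (simp add: tcar_def)
      then show ?thesis using False by (auto simp: X_Suc)
    qed
    then have "\<exists>f. \<forall>i. f i \<in> G i \<and> g (Suc i) = d i (f i) \<and> (g (Suc i) = 0 \<longrightarrow> f i = 0)" by (intro choice allI)
    then obtain f where f: "\<forall>i. f i \<in> G i \<and> g (Suc i) = d i (f i) \<and> (g (Suc i) = 0 \<longrightarrow> f i = 0)" by (elim exE)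
    have "finite {i. g i \<noteq> 0}" using g(1) by (simp add: tcar_def)
    then have "finite (Suc -` {i. g i \<noteq> 0})" by (rule finite_vimageI) simp
    moreover have "{i. f i \<noteq> 0} \<subseteq> Suc -` {i. g i \<noteq> 0}"
    proof
      fix i assume "i \<in> {i. f i \<noteq> 0}"
      then have "g (Suc i) \<noteq> 0" using spec[OF f, of i] by blast
      then show "i \<in> Suc -` {i. g i \<noteq> 0}" by simp
    qed
    ultimately have ft: "f \<in> tcar G" using f by (auto simp: tcar_def intro: finite_subset)
    have "g 0 \<in> X 0" using g(1) by (simp add: tcar_def)
    then have "g 0 = 0" by (simp add: X_def)
    have "diff T f = g"
    proof
      fix k show "diff T f k = g k" using \<open>g 0 = 0\<close> f by (cases k) simp_all
    qed
    then show "y \<in> coboundaries A" unfolding coboundaries_def g(2) using Pi_diff[OF ft] Pi_c[OF ft] by (metis imageI)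
  qed
qed

lemma tcar_mult_XZ: assumes "f \<in> tcar X" "g \<in> tcar Z" shows "f \<otimes>\<^bsub>T\<^esub> g \<in> tcar X"
proof -
  have "f \<otimes>\<^bsub>T\<^esub> g \<in> tcar G" using tcar_mult[OF tX tZ] assms by simp
  moreover have "(f \<otimes>\<^bsub>T\<^esub> g) k \<in> X k" for k unfolding total_simps
  proof (rule vsubspace_sum[OF X_subspace])
    fix i assume "i \<in> {0..k}"
    then show "mu i (k - i) (f i) (g (k - i)) \<in> X k"
      using mu_X_left[of "f i" i "g (k - i)" "k - i"] assms by (simp add: tcar_def)
  qed
  ultimately show ?thesis by (simp add: tcar_def)
qed

lemma tcar_mult_ZX: assumes "f \<in> tcar Z" "g \<in> tcar X" shows "f \<otimes>\<^bsub>T\<^esub> g \<in> tcar X"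
proof -
  have "f \<otimes>\<^bsub>T\<^esub> g \<in> tcar G" using tcar_mult[OF tZ tX] assms by simp
  moreover have "(f \<otimes>\<^bsub>T\<^esub> g) k \<in> X k" for k unfolding total_simps
  proof (rule vsubspace_sum[OF X_subspace])
    fix i assume "i \<in> {0..k}"
    then show "mu i (k - i) (f i) (g (k - i)) \<in> X k"
      using mu_X_right[of "f i" i "g (k - i)" "k - i"] assms by (simp add: tcar_def)
  qed
  ultimately show ?thesis by (simp add: tcar_def)
qed

lemma tcar_mult_Z: assumes "f \<in> tcar Z" "g \<in> tcar Z" shows "f \<otimes>\<^bsub>T\<^esub> g \<in> tcar Z"
proof -
  have "f \<otimes>\<^bsub>T\<^esub> g \<in> tcar G" using tcar_mult[OF tZ tZ] assms by simp
  moreover have "(f \<otimes>\<^bsub>T\<^esub> g) k \<in> Z k" for k unfolding total_simps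
  proof (rule vsubspace_sum[OF Z_subspace])
    fix i assume "i \<in> {0..k}"
    then show "mu i (k - i) (f i) (g (k - i)) \<in> Z k"
      using mu_Z[of "f i" i "g (k - i)" "k - i"] assms by (simp add: tcar_def)
  qed
  ultimately show ?thesis by (simp add: tcar_def)
qed

lemma tcar_sub_add: assumes "\<And>i. vsubspace (K i)" "f \<in> tcar K" "g \<in> tcar K" shows "(\<lambda>i. f i + g i) \<in> tcar K"
proof -
  have "{i. f i + g i \<noteq> 0} \<subseteq> {i. f i \<noteq> 0} \<union> {i. g i \<noteq> 0}" by auto
  then show ?thesis using assms by (auto simp: tcar_def intro: vsubspace_add finite_subset)
qed

lemma tcar_sub_scale: assumes "\<And>i. vsubspace (K i)" "f \<in> tcar K" shows "(\<lambda>i. c *\<^sub>R f i) \<in> tcar K"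
proof -
  have "{i. c *\<^sub>R f i \<noteq> 0} \<subseteq> {i. f i \<noteq> 0}" by auto
  then show ?thesis using assms by (auto simp: tcar_def intro: vsubspace_scale finite_subset)
qed

text \<open>
  The cohomology class of an element of the carrier.
\<close>

abbreviation "cl \<equiv> (\<lambda>x. coboundaries A +>\<^bsub>A\<^esub> x)"

lemma cob_subgroup: "abelian_subgroup (coboundaries A) A"
proof (rule abelian_subgroupI3)
  show "abelian_group A" by (rule A.M.abelian_group_axioms)
  show "additive_subgroup (coboundaries A) A"
  proof (rule additive_subgroup.intro, rule subgroup.intro)
    show "coboundaries A \<subseteq> carrier (add_monoid A)" using coboundaries_Pi Pi_c tX by auto
    fix x assume "x \<in> coboundaries A"
    then obtain f where f: "f \<in> tcar X" "x = Pi f" by (auto simp: coboundaries_Pi)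
    have xc: "x \<in> carrier A" using f Pi_c tX by simp
    have "x \<oplus>\<^bsub>A\<^esub> Pi (\<lambda>i. (-1) *\<^sub>R f i) = \<zero>\<^bsub>A\<^esub>"
      unfolding f(2) Pi_add[OF tX[OF f(1)] tcar_scale[OF tX[OF f(1)]], symmetric] by (simp add: Pi_0)
    then have "\<ominus>\<^bsub>A\<^esub> x = Pi (\<lambda>i. (-1) *\<^sub>R f i)"
      using A.M.minus_unique[of x] A.M.minus_equality A.M.a_comm xc Pi_c[OF tcar_scale[OF tX[OF f(1)], of "-1"]] by metis
    then show "inv\<^bsub>add_monoid A\<^esub> x \<in> coboundaries A"
      unfolding a_inv_def[symmetric] coboundaries_Pi using tcar_sub_scale[OF X_subspace f(1), of "-1"] by simp
    fix y assume "y \<in> coboundaries A"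
    then obtain g where g: "g \<in> tcar X" "y = Pi g" by (auto simp: coboundaries_Pi)
    show "x \<otimes>\<^bsub>add_monoid A\<^esub> y \<in> coboundaries A"
      using tcar_sub_add[OF X_subspace f(1) g(1)] Pi_add[OF tX[OF f(1)] tX[OF g(1)]] f(2) g(2)
      by (simp add: coboundaries_Pi image_iff) metis
  next
    have "(\<lambda>_. 0) \<in> tcar X" using vsubspace_0[OF X_subspace] by (simp add: tcar_def)
    then show "\<one>\<^bsub>add_monoid A\<^esub> \<in> coboundaries A" using Pi_0 by (simp add: coboundaries_Pi image_iff) metis
  qed
qed

lemma cl_mem: assumes "x \<in> carrier A" "y \<in> carrier A" shows "y \<in> cl x \<longleftrightarrow> y \<ominus>\<^bsub>A\<^esub> x \<in> coboundaries A"
  using abelian_subgroup.a_rcos_module[OF cob_subgroup assms] by (simp add: A.M.minus_eq)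

lemma cl_self: "x \<in> carrier A \<Longrightarrow> x \<in> cl x"
  by (rule abelian_subgroup.a_rcos_self[OF cob_subgroup])

lemma cl_repr: "y \<in> cl x \<Longrightarrow> x \<in> carrier A \<Longrightarrow> cl x = cl y"
  by (rule abelian_subgroup.a_repr_independence'[OF cob_subgroup])

lemma cl_carrier: "y \<in> cl x \<Longrightarrow> x \<in> carrier A \<Longrightarrow> y \<in> carrier A"
  by (rule abelian_subgroup.a_elemrcos_carrier[OF cob_subgroup])

lemma cl_eq: assumes "x \<in> carrier A" "y \<in> carrier A" shows "cl x = cl y \<longleftrightarrow> x \<ominus>\<^bsub>A\<^esub> y \<in> coboundaries A"
  using cl_mem[OF assms(2,1)] cl_self[OF assms(1)] cl_repr[OF _ assms(2), of x] by auto

lemma cl_Pi_eq: assumes "f \<in> tcar G" "g \<in> tcar G" shows "cl (Pi f) = cl (Pi g) \<longleftrightarrow> (\<lambda>i. f i - g i) \<in> tcar X"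
proof -
  have "Pi h \<in> Pi ` tcar X \<longleftrightarrow> h \<in> tcar X" if "h \<in> tcar G" for h
    using Pi_eq[OF that tX] by (auto simp: image_iff)
  then show ?thesis
    using cl_eq[OF Pi_c[OF assms(1)] Pi_c[OF assms(2)]] tcar_diff2[OF assms] by (simp add: Pi_minus[OF assms, symmetric] coboundaries_Pi)
qed

lemma cl_mem_Pi: assumes "y \<in> cl (Pi f)" "f \<in> tcar G"
  obtains g where "g \<in> tcar G" "y = Pi g" "(\<lambda>i. g i - f i) \<in> tcar X"
proof -
  have y: "y \<in> carrier A" by (rule cl_carrier[OF assms(1) Pi_c[OF assms(2)]])
  obtain g where g: "g \<in> tcar G" "y = Pi g" using Pi_surj[OF y] .
  have "cl (Pi f) = cl (Pi g)" using cl_repr[OF assms(1) Pi_c[OF assms(2)]] g(2) by simp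
  then have "(\<lambda>i. g i - f i) \<in> tcar X" using cl_Pi_eq[OF g(1) assms(2)] by simp
  then show ?thesis using that g by blast
qed

lemma coh_carrier: "carrier (cohomology A) = (\<lambda>f. cl (Pi f)) ` tcar Z"
proof -
  have "carrier (cohomology A) = cl ` cocycles A"
    by (auto simp: cohomology_def cohomology_ring_def FactRing_def A_RCOSETS_def RCOSETS_def a_r_coset_def r_coset_def)
  then show ?thesis by (simp add: cocycles_Pi image_image)
qed

lemma coh_zero: "\<zero>\<^bsub>cohomology A\<^esub> = coboundaries A" and coh_diff: "diff (cohomology A) Y = coboundaries A"
  by (simp_all add: cohomology_def cohomology_ring_def FactRing_def)

lemma coh_one: "\<one>\<^bsub>cohomology A\<^esub> = cl (Pi (single 0 e))"
  by (simp add: cohomology_def cohomology_ring_def FactRing_def a_r_coset_def r_coset_def Pi_one)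

lemma cl_0: "cl (Pi (\<lambda>_. 0)) = coboundaries A"
proof -
  have "coboundaries A \<subseteq> carrier A" using coboundaries_Pi Pi_c tX by auto
  then show ?thesis unfolding Pi_0 by (rule A.M.a_coset_add_zero)
qed

lemma coh_add: assumes f: "f \<in> tcar G" and g: "g \<in> tcar G"
  shows "cl (Pi f) \<oplus>\<^bsub>cohomology A\<^esub> cl (Pi g) = cl (Pi (\<lambda>i. f i + g i))"
proof -
  have "cl (Pi f) \<oplus>\<^bsub>cohomology A\<^esub> cl (Pi g) = cl (Pi f) <+>\<^bsub>A\<^esub> cl (Pi g)"
    by (simp add: cohomology_def cohomology_ring_def FactRing_def set_add_def set_mult_def)
  also have "\<dots> = cl (Pi f \<oplus>\<^bsub>A\<^esub> Pi g)"
    by (rule abelian_subgroup.a_rcos_sum[OF cob_subgroup Pi_c[OF f] Pi_c[OF g]])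
  finally show ?thesis by (simp add: Pi_add[OF f g])
qed

text \<open>
  The product of cosets is defined as the union over all representatives; changing the representatives
  changes the product by a coboundary, so the union consists of a single coset.
\<close>

lemma coh_mult: assumes f: "f \<in> tcar Z" and g: "g \<in> tcar Z"
  shows "cl (Pi f) \<otimes>\<^bsub>cohomology A\<^esub> cl (Pi g) = cl (Pi (f \<otimes>\<^bsub>T\<^esub> g))"
proof -
  have e: "cl (Pi f) \<otimes>\<^bsub>cohomology A\<^esub> cl (Pi g) = (\<Union>a\<in>cl (Pi f). \<Union>b\<in>cl (Pi g). cl (a \<otimes>\<^bsub>A\<^esub> b))"
    by (simp add: cohomology_def cohomology_ring_def FactRing_def rcoset_mult_def a_r_coset_def r_coset_def)
  have "cl (a \<otimes>\<^bsub>A\<^esub> b) = cl (Pi (f \<otimes>\<^bsub>T\<^esub> g))" if a: "a \<in> cl (Pi f)" and b: "b \<in> cl (Pi g)" for a b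
  proof -
    obtain f' where f': "f' \<in> tcar G" "a = Pi f'" "(\<lambda>i. f' i - f i) \<in> tcar X" using cl_mem_Pi[OF a tZ[OF f]] .
    obtain g' where g': "g' \<in> tcar G" "b = Pi g'" "(\<lambda>i. g' i - g i) \<in> tcar X" using cl_mem_Pi[OF b tZ[OF g]] .
    have "f' = (\<lambda>i. (f' i - f i) + f i)" by simp
    then have f'Z: "f' \<in> tcar Z" using tcar_sub_add[OF Z_subspace tXZ[OF f'(3)] f] by simp
    have "(\<lambda>i. (f' \<otimes>\<^bsub>T\<^esub> g') i - (f \<otimes>\<^bsub>T\<^esub> g) i) =
      (\<lambda>i. (f' \<otimes>\<^bsub>T\<^esub> (\<lambda>i. g' i - g i)) i + ((\<lambda>i. f' i - f i) \<otimes>\<^bsub>T\<^esub> g) i)"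
      by (simp add: mu_diff_left mu_diff_right sum_subtractf)
    also have "\<dots> \<in> tcar X" by (rule tcar_sub_add[OF X_subspace tcar_mult_ZX[OF f'Z g'(3)] tcar_mult_XZ[OF f'(3) g]])
    finally have *: "(\<lambda>i. (f' \<otimes>\<^bsub>T\<^esub> g') i - (f \<otimes>\<^bsub>T\<^esub> g) i) \<in> tcar X" .
    have t: "f' \<otimes>\<^bsub>T\<^esub> g' \<in> tcar G" "f \<otimes>\<^bsub>T\<^esub> g \<in> tcar G"
      using tcar_mult[OF f'(1) g'(1)] tcar_mult[OF tZ[OF f] tZ[OF g]] by simp_all
    show ?thesis unfolding f'(2) g'(2) Pi_mult[OF f'(1) g'(1), symmetric] using cl_Pi_eq[OF t] * by blast
  qed
  then show ?thesis unfolding e using cl_self[OF Pi_c[OF tZ[OF f]]] cl_self[OF Pi_c[OF tZ[OF g]]] by blast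
qed

lemma coh_smult: assumes f: "f \<in> tcar G"
  shows "c \<odot>\<^bsub>cohomology A\<^esub> cl (Pi f) = cl (Pi (\<lambda>i. c *\<^sub>R f i))"
proof -
  have e: "c \<odot>\<^bsub>cohomology A\<^esub> cl (Pi f) = (\<Union>a\<in>cl (Pi f). cl (c \<odot>\<^bsub>A\<^esub> a))"
    by (simp add: cohomology_def)
  have "cl (c \<odot>\<^bsub>A\<^esub> a) = cl (Pi (\<lambda>i. c *\<^sub>R f i))" if a: "a \<in> cl (Pi f)" for a
  proof -
    obtain f' where f': "f' \<in> tcar G" "a = Pi f'" "(\<lambda>i. f' i - f i) \<in> tcar X" using cl_mem_Pi[OF a f] .
    have "(\<lambda>i. c *\<^sub>R f' i - c *\<^sub>R f i) \<in> tcar X"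
      using tcar_sub_scale[OF X_subspace f'(3), of c] by (simp add: scaleR_diff_right)
    then show ?thesis unfolding f'(2) Pi_scale[OF f'(1), symmetric]
      using cl_Pi_eq[OF tcar_scale[OF f'(1)] tcar_scale[OF f]] by blast
  qed
  then show ?thesis unfolding e using cl_self[OF Pi_c[OF f]] by blast
qed

lemma single_tZ: "x \<in> Z i \<Longrightarrow> single i x \<in> tcar Z"
  using vsubspace_0[OF Z_subspace] by (auto simp: tcar_def single_def)

lemma coh_grade: "grade (cohomology A) i = (\<lambda>x. cl (Pi (single i x))) ` Z i"
proof -
  have "cocycles A \<inter> grade A i = (\<lambda>x. Pi (single i x)) ` Z i"
  proof
    show "cocycles A \<inter> grade A i \<subseteq> (\<lambda>x. Pi (single i x)) ` Z i"
    proof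
      fix y assume y: "y \<in> cocycles A \<inter> grade A i"
      obtain f where f: "f \<in> tcar Z" "y = Pi f" using y by (auto simp: cocycles_Pi)
      obtain x where x: "x \<in> G i" "y = Pi (single i x)" using y by (auto simp: Pi_grade)
      have "f = single i x" using Pi_eq[OF tZ[OF f(1)] single_tcar[OF x(1)]] f x by simp
      then have "f i = x" by (simp add: single_def)
      then have "x \<in> Z i" using f(1) by (auto simp: tcar_def)
      then show "y \<in> (\<lambda>x. Pi (single i x)) ` Z i" using x by blast
    qed
    show "(\<lambda>x. Pi (single i x)) ` Z i \<subseteq> cocycles A \<inter> grade A i"
      using single_tZ Z_G by (auto simp: cocycles_Pi Pi_grade)
  qed
  then show ?thesis by (simp add: cohomology_def image_image)
qed

end

text \<open>
  \<open>H i\<close> represents the cohomology in degree \<open>i\<close>, and \<open>P i\<close> is the projection along coboundaries.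
\<close>

locale harmonic_model = gdga_model +
  fixes H :: "nat \<Rightarrow> 'a set" and P :: "nat \<Rightarrow> 'a \<Rightarrow> 'a"
  assumes H_subspace: "vsubspace (H i)" and H_Z: "x \<in> H i \<Longrightarrow> x \<in> Z i" and H_X: "x \<in> H i \<Longrightarrow> x \<in> X i \<Longrightarrow> x = 0"
    and P_linear: "linear (P i)" and P_H: "x \<in> Z i \<Longrightarrow> P i x \<in> H i" and P_id: "x \<in> H i \<Longrightarrow> P i x = x"
    and P_X: "x \<in> Z i \<Longrightarrow> x - P i x \<in> X i"
begin

text \<open>
  The cup product of harmonic elements: project the product of the representatives.
\<close>

definition "hmu = (\<lambda>i j x y. P (i + j) (mu i j x y))"

lemma P_exact: assumes "x \<in> X i" shows "P i x = 0"
proof (rule H_X)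
  have z: "x \<in> Z i" using assms X_Z by blast
  show "P i x \<in> H i" by (rule P_H[OF z])
  have "x - (x - P i x) \<in> X i" by (rule vsubspace_diff[OF X_subspace assms P_X[OF z]])
  then show "P i x \<in> X i" by simp
qed

lemma P_eq: assumes "x - y \<in> X i" shows "P i x = P i y"
  using P_exact[OF assms] linear_diff[OF P_linear] by simp

lemma e_H: "e \<in> H 0"
proof -
  have "e - P 0 e \<in> X 0" by (rule P_X[OF e_Z])
  then have "e = P 0 e" by (simp add: X_def)
  then show ?thesis using P_H[OF e_Z] by simp
qed

text \<open>
  Associativity holds because projecting an intermediate product changes it by a coboundary, and the
  product of a coboundary with a cocycle is projected to zero.
\<close>

lemma H_gdga: "gdga H hmu (\<lambda>_ _. 0) e"
proof (rule gdga.intro)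
  show "vsubspace (H i)" for i by (rule H_subspace)
  show "bilinear (hmu i j)" for i j
    by (rule bilinearI) (simp_all add: hmu_def mu_add_left mu_add_right mu_scale_left mu_scale_right
      linear_add[OF P_linear] linear_scale[OF P_linear])
  show "linear (\<lambda>_ :: 'a. 0 :: 'a)" by (rule linear_zero)
  show "e \<in> H 0" by (rule e_H)
  fix i j k x y z assume x: "x \<in> H i" and y: "y \<in> H j" and z: "z \<in> H k"
  note xZ = H_Z[OF x] and yZ = H_Z[OF y] and zZ = H_Z[OF z]
  show "hmu i j x y \<in> H (i + j)" unfolding hmu_def by (rule P_H[OF mu_Z[OF xZ yZ]])
  show "hmu (i + j) k (hmu i j x y) z = hmu i (j + k) x (hmu j k y z)"
  proof -
    have "mu (i + j) k (mu i j x y) z - mu (i + j) k (P (i + j) (mu i j x y)) z \<in> X (i + j + k)"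
      unfolding mu_diff_left[symmetric] by (rule mu_X_left[OF P_X[OF mu_Z[OF xZ yZ]] zZ])
    then have "P (i + j + k) (mu (i + j) k (P (i + j) (mu i j x y)) z) = P (i + j + k) (mu (i + j) k (mu i j x y) z)"
      by (rule P_eq[symmetric])
    moreover have "mu i (j + k) x (mu j k y z) - mu i (j + k) x (P (j + k) (mu j k y z)) \<in> X (i + (j + k))"
      unfolding mu_diff_right[symmetric] by (rule mu_X_right[OF xZ P_X[OF mu_Z[OF yZ zZ]]])
    then have "P (i + (j + k)) (mu i (j + k) x (P (j + k) (mu j k y z))) = P (i + (j + k)) (mu i (j + k) x (mu j k y z))"
      by (rule P_eq[symmetric])
    ultimately show ?thesis by (simp add: hmu_def mu_assoc[OF Z_G[OF xZ] Z_G[OF yZ] Z_G[OF zZ]] add.assoc)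
  qed
  show "hmu i j x y = (-1) ^ (i * j) *\<^sub>R hmu j i y x"
    unfolding hmu_def mu_comm[OF Z_G[OF xZ] Z_G[OF yZ]] linear_scale[OF P_linear] by (simp add: add.commute)
  show "0 = hmu (Suc i) j 0 y + (-1) ^ i *\<^sub>R hmu i (Suc j) x 0"
    by (simp add: hmu_def mu_0_left mu_0_right linear_0[OF P_linear])
next
  fix i x assume x: "x \<in> H i"
  show "hmu 0 i e x = x" by (simp add: hmu_def mu_e[OF Z_G[OF H_Z[OF x]]] P_id[OF x])
  show "0 \<in> H (Suc i)" by (rule vsubspace_0[OF H_subspace])
  show "(0 :: 'a) = 0" by simp
qed

abbreviation "TH \<equiv> total H hmu (\<lambda>_ _. 0) e"

lemma tH: "f \<in> tcar H \<Longrightarrow> f \<in> tcar Z" using H_Z by (auto simp: tcar_def)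

lemma coh_iso: "dgca_iso TH (cohomology A) (\<lambda>f. cl (Pi f))"
proof -
  interpret h: gdga H hmu "\<lambda>_ _. 0" e by (rule H_gdga)
  have inj: "inj_on (\<lambda>f. cl (Pi f)) (tcar H)"
  proof (rule inj_onI)
    fix f g assume fg: "f \<in> tcar H" "g \<in> tcar H" "cl (Pi f) = cl (Pi g)"
    then have "(\<lambda>i. f i - g i) \<in> tcar X" using cl_Pi_eq[OF tZ[OF tH] tZ[OF tH]] by blast
    then have x: "f i - g i \<in> X i" for i by (simp add: tcar_def)
    have "f i - g i \<in> H i" for i using fg by (auto simp: tcar_def intro: vsubspace_diff[OF H_subspace])
    then have "f i - g i = 0" for i using H_X x by blast
    then show "f = g" by (simp add: fun_eq_iff)
  qed
  have surj: "\<exists>h\<in>tcar H. cl (Pi f) = cl (Pi h)" if f: "f \<in> tcar Z" for f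
  proof -
    have fZ: "f i \<in> Z i" for i using f by (simp add: tcar_def)
    have "{i. P i (f i) \<noteq> 0} \<subseteq> {i. f i \<noteq> 0}" using linear_0[OF P_linear] by auto
    then have h: "(\<lambda>i. P i (f i)) \<in> tcar H" using f P_H[OF fZ] by (auto simp: tcar_def intro: finite_subset)
    have "(\<lambda>i. f i - P i (f i)) \<in> tcar X" using P_X[OF fZ] tcar_diff2[OF tZ[OF f] tZ[OF tH[OF h]]] by (simp add: tcar_def)
    then show ?thesis using cl_Pi_eq[OF tZ[OF f] tZ[OF tH[OF h]]] h by blast
  qed
  have TH_mult: "cl (Pi (f \<otimes>\<^bsub>TH\<^esub> g)) = cl (Pi f) \<otimes>\<^bsub>cohomology A\<^esub> cl (Pi g)" if f: "f \<in> tcar H" and g: "g \<in> tcar H" for f g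
  proof -
    have z: "f \<otimes>\<^bsub>T\<^esub> g \<in> tcar Z" by (rule tcar_mult_Z[OF tH[OF f] tH[OF g]])
    have h: "f \<otimes>\<^bsub>TH\<^esub> g \<in> tcar H" using h.tcar_mult[OF f g] by simp
    have eq: "(f \<otimes>\<^bsub>TH\<^esub> g) k = P k ((f \<otimes>\<^bsub>T\<^esub> g) k)" for k
      unfolding total_simps linear_sum[OF P_linear] by (rule sum.cong) (auto simp: hmu_def)
    have zk: "(f \<otimes>\<^bsub>T\<^esub> g) k \<in> Z k" for k using z by (simp add: tcar_def)
    have "(\<lambda>i. (f \<otimes>\<^bsub>T\<^esub> g) i - (f \<otimes>\<^bsub>TH\<^esub> g) i) \<in> tcar X"
      unfolding tcar_def mem_Collect_eq
    proof (intro conjI allI)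
      show "(f \<otimes>\<^bsub>T\<^esub> g) i - (f \<otimes>\<^bsub>TH\<^esub> g) i \<in> X i" for i unfolding eq by (rule P_X[OF zk])
      show "finite {i. (f \<otimes>\<^bsub>T\<^esub> g) i - (f \<otimes>\<^bsub>TH\<^esub> g) i \<noteq> 0}" using tcar_diff2[OF tZ[OF z] tZ[OF tH[OF h]]] unfolding tcar_def by blast
    qed
    then have "cl (Pi (f \<otimes>\<^bsub>T\<^esub> g)) = cl (Pi (f \<otimes>\<^bsub>TH\<^esub> g))" using cl_Pi_eq[OF tZ[OF z] tZ[OF tH[OF h]]] by blast
    then show ?thesis using coh_mult[OF tH[OF f] tH[OF g]] by metis
  qed
  have gr: "(\<lambda>f. cl (Pi f)) ` grade TH i = grade (cohomology A) i" for i
  proof -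
    have "grade TH i = single i ` H i"
      using grade_single[of _ H hmu "\<lambda>_ _. 0" e i] h.single_grade[of _ i] by (auto simp: image_iff simp del: total_simps)
    moreover have "(\<lambda>x. cl (Pi (single i x))) ` H i = (\<lambda>x. cl (Pi (single i x))) ` Z i"
    proof
      show "(\<lambda>x. cl (Pi (single i x))) ` H i \<subseteq> (\<lambda>x. cl (Pi (single i x))) ` Z i" using H_Z by blast
      show "(\<lambda>x. cl (Pi (single i x))) ` Z i \<subseteq> (\<lambda>x. cl (Pi (single i x))) ` H i"
      proof
        fix y assume "y \<in> (\<lambda>x. cl (Pi (single i x))) ` Z i"
        then obtain x where x: "x \<in> Z i" "y = cl (Pi (single i x))" by blast
        have "(\<lambda>j. single i x j - single i (P i x) j) = single i (x - P i x)" by (auto simp: single_def)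
        also have "\<dots> \<in> tcar X" using P_X[OF x(1)] vsubspace_0[OF X_subspace] by (auto simp: tcar_def single_def)
        finally have "y = cl (Pi (single i (P i x)))"
          using cl_Pi_eq[OF single_tcar[OF Z_G[OF x(1)]] single_tcar[OF Z_G[OF H_Z[OF P_H[OF x(1)]]]]] x(2) by blast
        then show "y \<in> (\<lambda>x. cl (Pi (single i x))) ` H i" using P_H[OF x(1)] by blast
      qed
    qed
    ultimately show ?thesis by (simp add: image_image coh_grade)
  qed
  show ?thesis
    unfolding dgca_iso_def
  proof (intro conjI ballI allI)
    show "bij_betw (\<lambda>f. cl (Pi f)) (carrier TH) (carrier (cohomology A))"
      unfolding bij_betw_def coh_carrier using inj surj tH by (auto simp: image_iff)
    show "cl (Pi \<one>\<^bsub>TH\<^esub>) = \<one>\<^bsub>cohomology A\<^esub>" by (simp add: coh_one single_def)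
    show "cl (Pi \<zero>\<^bsub>TH\<^esub>) = \<zero>\<^bsub>cohomology A\<^esub>" by (simp add: coh_zero cl_0)
    show "(\<lambda>f. cl (Pi f)) ` grade TH i = grade (cohomology A) i" for i by (rule gr)
    fix x assume "x \<in> carrier TH"
    then have x: "x \<in> tcar H" by simp
    show "cl (Pi (c \<odot>\<^bsub>TH\<^esub> x)) = c \<odot>\<^bsub>cohomology A\<^esub> cl (Pi x)" for c by (simp add: coh_smult[OF tZ[OF tH[OF x]]])
    have "diff TH x = (\<lambda>_. 0)" by (auto split: nat.splits)
    then show "cl (Pi (diff TH x)) = diff (cohomology A) (cl (Pi x))" by (simp only: coh_diff cl_0)
    fix y assume "y \<in> carrier TH"
    then have y: "y \<in> tcar H" by simp
    show "cl (Pi (x \<oplus>\<^bsub>TH\<^esub> y)) = cl (Pi x) \<oplus>\<^bsub>cohomology A\<^esub> cl (Pi y)" by (simp add: coh_add[OF tZ[OF tH[OF x]] tZ[OF tH[OF y]]])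
    show "cl (Pi (x \<otimes>\<^bsub>TH\<^esub> y)) = cl (Pi x) \<otimes>\<^bsub>cohomology A\<^esub> cl (Pi y)" by (rule TH_mult[OF x y])
  qed
qed

end

section \<open>Quasi-isomorphisms between modelled algebras\<close>

text \<open>
  A graded map between typed models that is onto and injective on degreewise cohomology induces a
  quasi-isomorphism of the records.
\<close>

lemma gdga_quasi_iso:
  fixes G :: "nat \<Rightarrow> 'v::real_vector set" and Pi :: "(nat \<Rightarrow> 'v) \<Rightarrow> 'b"
    and M :: "nat \<Rightarrow> 'w::real_vector set" and ka :: "(nat \<Rightarrow> 'w) \<Rightarrow> 'c"
  assumes M: "gdga_model M pm dd e1 C ka" and B: "gdga_model G mu d e B Pi"
    and lin: "\<And>i. linear (phi i)" and phi_G: "\<And>i x. x \<in> M i \<Longrightarrow> phi i x \<in> G i"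
    and phi_m: "\<And>i j x y. x \<in> M i \<Longrightarrow> y \<in> M j \<Longrightarrow> phi (i + j) (pm i j x y) = mu i j (phi i x) (phi j y)"
    and phi_d: "\<And>i x. x \<in> M i \<Longrightarrow> phi (Suc i) (dd i x) = d i (phi i x)" and phi_e: "phi 0 e1 = e"
    and onto: "\<And>i z. z \<in> gdga.Z G d i \<Longrightarrow> \<exists>x\<in>gdga.Z M dd i. z - phi i x \<in> gdga.X G d i"
    and inj: "\<And>i x. x \<in> gdga.Z M dd i \<Longrightarrow> phi i x \<in> gdga.X G d i \<Longrightarrow> x \<in> gdga.X M dd i"
  shows "\<exists>F. quasi_iso class_ring C B F"
proof -
  interpret M: gdga_model M pm dd e1 C ka by (rule M)
  interpret B: gdga_model G mu d e B Pi by (rule B)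
  define ph where "ph = (\<lambda>f i. phi i (f i))"
  define F where "F = (\<lambda>c. Pi (ph (inv_into (tcar M) ka c)))"
  have F: "F (ka f) = Pi (ph f)" if "f \<in> tcar M" for f
  proof -
    have "inj_on ka (tcar M)" using M.Pi_bij by (simp add: bij_betw_def)
    then show ?thesis using that by (simp add: F_def)
  qed
  have fM: "f i \<in> M i" if "f \<in> tcar M" for f i using that by (simp add: tcar_def)
  have ph_K: "ph f \<in> tcar K" if f: "f \<in> tcar L" and K: "\<And>i x. x \<in> L i \<Longrightarrow> phi i x \<in> K i" for f K L
  proof -
    have "{i. ph f i \<noteq> 0} \<subseteq> {i. f i \<noteq> 0}" using linear_0[OF lin] by (auto simp: ph_def)
    then show ?thesis using f K by (auto simp: tcar_def ph_def intro: finite_subset)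
  qed
  have phG: "ph f \<in> tcar G" if "f \<in> tcar M" for f by (rule ph_K[OF that phi_G])
  have phi_Z: "phi i x \<in> B.Z i" if "x \<in> M.Z i" for i x
    using phi_d[OF M.Z_G[OF that]] phi_G[OF M.Z_G[OF that]] M.Z_d[OF that] linear_0[OF lin] by (simp add: B.Z_def)
  have phi_X: "phi i x \<in> B.X i" if x: "x \<in> M.X i" for i x
  proof (cases i)
    case 0 then show ?thesis using x linear_0[OF lin] by (simp add: M.X_def B.X_def)
  next
    case (Suc j)
    then obtain y where "y \<in> M j" "x = dd j y" using x by (auto simp: M.X_Suc)
    then show ?thesis using Suc B.d_X[OF phi_G] by (simp add: phi_d)
  qed
  have ph_add: "ph (\<lambda>i. f i + g i) = (\<lambda>i. ph f i + ph g i)" and ph_diff: "ph (\<lambda>i. f i - g i) = (\<lambda>i. ph f i - ph g i)"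
    and ph_scale: "ph (\<lambda>i. c *\<^sub>R f i) = (\<lambda>i. c *\<^sub>R ph f i)" for f g c
    by (simp_all add: ph_def linear_add[OF lin] linear_diff[OF lin] linear_scale[OF lin])
  have ph_single: "ph (single i x) = single i (phi i x)" for i x
    by (auto simp: ph_def single_def linear_0[OF lin])
  have ph_mult: "ph (f \<otimes>\<^bsub>M.T\<^esub> g) = ph f \<otimes>\<^bsub>B.T\<^esub> ph g" if f: "f \<in> tcar M" and g: "g \<in> tcar M" for f g
  proof
    fix k
    have "(\<Sum>i=0..k. phi k (pm i (k - i) (f i) (g (k - i)))) = (\<Sum>i=0..k. mu i (k - i) (phi i (f i)) (phi (k - i) (g (k - i))))"
    proof (rule sum.cong[OF refl])
      fix i assume "i \<in> {0..k}"
      then show "phi k (pm i (k - i) (f i) (g (k - i))) = mu i (k - i) (phi i (f i)) (phi (k - i) (g (k - i)))"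
        using phi_m[OF fM[OF f, of i] fM[OF g, of "k - i"]] by simp
    qed
    then show "ph (f \<otimes>\<^bsub>M.T\<^esub> g) k = (ph f \<otimes>\<^bsub>B.T\<^esub> ph g) k" by (simp add: ph_def linear_sum[OF lin])
  qed
  have ph_d: "ph (diff M.T f) = diff B.T (ph f)" if f: "f \<in> tcar M" for f
    using phi_d[OF fM[OF f]] linear_0[OF lin] by (auto simp: ph_def fun_eq_iff split: nat.splits)
  have td: "diff M.T f \<in> tcar M" if "f \<in> tcar M" for f using M.tcar_diff[OF that] by simp
  have tm: "f \<otimes>\<^bsub>M.T\<^esub> g \<in> tcar M" if "f \<in> tcar M" "g \<in> tcar M" for f g using M.tcar_mult[OF that] by simp
  have hom: "F \<in> dgca_hom class_ring C B"
    unfolding dgca_hom_def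
  proof (intro CollectI conjI IntI allI ballI)
    show "F \<in> Ring.ring_hom C B"
    proof (rule ring_hom_memI)
      fix x assume "x \<in> carrier C"
      then obtain f where f: "f \<in> tcar M" "x = ka f" by (rule M.Pi_surj)
      show "F x \<in> carrier B" using f F B.Pi_c phG by simp
      fix y assume "y \<in> carrier C"
      then obtain g where g: "g \<in> tcar M" "y = ka g" by (rule M.Pi_surj)
      show "F (x \<otimes>\<^bsub>C\<^esub> y) = F x \<otimes>\<^bsub>B\<^esub> F y"
        by (simp only: f(2) g(2) M.Pi_mult[OF f(1) g(1), symmetric] F tm f(1) g(1) ph_mult B.Pi_mult phG)
      show "F (x \<oplus>\<^bsub>C\<^esub> y) = F x \<oplus>\<^bsub>B\<^esub> F y"
        by (simp only: f(2) g(2) M.Pi_add[OF f(1) g(1), symmetric] F M.tcar_add f(1) g(1) ph_add B.Pi_add phG)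
    next
      show "F \<one>\<^bsub>C\<^esub> = \<one>\<^bsub>B\<^esub>"
        by (simp only: M.Pi_one[symmetric] F M.single_tcar[OF M.e_G] ph_single phi_e B.Pi_one)
    qed
    show "F \<in> LinearCombinations.module_hom class_ring C B"
      unfolding LinearCombinations.module_hom_def
    proof (intro CollectI conjI allI impI Pi_I; (elim conjE)?)
      fix x assume "x \<in> carrier C"
      then obtain f where f: "f \<in> tcar M" "x = ka f" by (rule M.Pi_surj)
      show "F x \<in> carrier B" using f F B.Pi_c phG by simp
      show "F (c \<odot>\<^bsub>C\<^esub> x) = c \<odot>\<^bsub>B\<^esub> F x" for c
        by (simp only: f(2) M.Pi_scale[OF f(1), symmetric] F M.tcar_scale f(1) ph_scale B.Pi_scale phG)
      fix y assume "y \<in> carrier C"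
      then obtain g where g: "g \<in> tcar M" "y = ka g" by (rule M.Pi_surj)
      show "F (x \<oplus>\<^bsub>C\<^esub> y) = F x \<oplus>\<^bsub>B\<^esub> F y"
        by (simp only: f(2) g(2) M.Pi_add[OF f(1) g(1), symmetric] F M.tcar_add f(1) g(1) ph_add B.Pi_add phG)
    qed
    show "F ` grade C i \<subseteq> grade B i" for i
    proof
      fix y assume "y \<in> F ` grade C i"
      then obtain x where x: "x \<in> M i" "y = F (ka (single i x))" by (auto simp: M.Pi_grade)
      then have "y = Pi (single i (phi i x))" by (simp only: F M.single_tcar ph_single)
      then show "y \<in> grade B i" using phi_G[OF x(1)] by (simp add: B.Pi_grade)
    qed
    fix x assume "x \<in> carrier C"
    then obtain f where f: "f \<in> tcar M" "x = ka f" by (rule M.Pi_surj)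
    show "F (diff C x) = diff B (F x)"
      by (simp only: f(2) M.Pi_diff[OF f(1)] F td f(1) ph_d B.Pi_diff phG)
  qed
  have cm: "cohomology_map B F (M.cl (ka f)) = B.cl (Pi (ph f))" if f: "f \<in> tcar M" for f
  proof -
    have "B.cl (F x) = B.cl (Pi (ph f))" if x: "x \<in> M.cl (ka f)" for x
    proof -
      obtain g where g: "g \<in> tcar M" "x = ka g" "(\<lambda>i. g i - f i) \<in> tcar M.X" using M.cl_mem_Pi[OF x f] .
      have "ph (\<lambda>i. g i - f i) \<in> tcar B.X" by (rule ph_K[OF g(3) phi_X])
      then show ?thesis unfolding g(2) F[OF g(1)] ph_diff using B.cl_Pi_eq[OF phG[OF g(1)] phG[OF f]] by blast
    qed
    then show ?thesis unfolding cohomology_map_def using M.cl_self[OF M.Pi_c[OF f]] by blast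
  qed
  have bij: "bij_betw (cohomology_map B F) (carrier (cohomology C)) (carrier (cohomology B))"
    unfolding bij_betw_def
  proof
    show "inj_on (cohomology_map B F) (carrier (cohomology C))"
    proof (rule inj_onI)
      fix u v assume uv: "u \<in> carrier (cohomology C)" "v \<in> carrier (cohomology C)" "cohomology_map B F u = cohomology_map B F v"
      obtain f where f: "f \<in> tcar M.Z" "u = M.cl (ka f)" using uv(1) by (auto simp: M.coh_carrier)
      obtain g where g: "g \<in> tcar M.Z" "v = M.cl (ka g)" using uv(2) by (auto simp: M.coh_carrier)
      have "B.cl (Pi (ph f)) = B.cl (Pi (ph g))"
        using uv(3) unfolding f(2) g(2) cm[OF M.tZ[OF f(1)]] cm[OF M.tZ[OF g(1)]] .
      then have "(\<lambda>i. ph f i - ph g i) \<in> tcar B.X" using B.cl_Pi_eq[OF phG[OF M.tZ[OF f(1)]] phG[OF M.tZ[OF g(1)]]] by blast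
      then have x: "phi i (f i - g i) \<in> B.X i" for i unfolding ph_diff[symmetric] by (simp add: tcar_def ph_def)
      have z: "f i - g i \<in> M.Z i" for i using f(1) g(1) by (auto simp: tcar_def intro: vsubspace_diff[OF M.Z_subspace])
      have "(\<lambda>i. f i - g i) \<in> tcar M.X"
        using M.tcar_diff2[OF M.tZ[OF f(1)] M.tZ[OF g(1)]] inj[OF z x] by (simp add: tcar_def)
      then show "u = v" unfolding f(2) g(2) using M.cl_Pi_eq[OF M.tZ[OF f(1)] M.tZ[OF g(1)]] by blast
    qed
    show "cohomology_map B F ` carrier (cohomology C) = carrier (cohomology B)"
    proof
      show "cohomology_map B F ` carrier (cohomology C) \<subseteq> carrier (cohomology B)"
      proof
        fix y assume "y \<in> cohomology_map B F ` carrier (cohomology C)"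
        then obtain f where f: "f \<in> tcar M.Z" "y = cohomology_map B F (M.cl (ka f))" by (auto simp: M.coh_carrier)
        then show "y \<in> carrier (cohomology B)" unfolding B.coh_carrier using cm[OF M.tZ[OF f(1)]] ph_K[OF f(1) phi_Z] by blast
      qed
      show "carrier (cohomology B) \<subseteq> cohomology_map B F ` carrier (cohomology C)"
      proof
        fix y assume "y \<in> carrier (cohomology B)"
        then obtain z where z: "z \<in> tcar B.Z" "y = B.cl (Pi z)" by (auto simp: B.coh_carrier)
        \<comment> \<open>Preimages of zero are taken to be zero to keep the support finite.\<close>
        have "\<exists>x. x \<in> M.Z i \<and> z i - phi i x \<in> B.X i \<and> (z i = 0 \<longrightarrow> x = 0)" for i
        proof (cases "z i = 0")
          case True
          then show ?thesis using vsubspace_0[OF M.Z_subspace[of i]] vsubspace_0[OF B.X_subspace[of i]] linear_0[OF lin[of i]]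
            by (intro exI[of _ 0]) simp
        next
          case False
          have "z i \<in> B.Z i" using z(1) by (simp add: tcar_def)
          then show ?thesis using onto[of "z i" i] False by blast
        qed
        then have "\<exists>f. \<forall>i. f i \<in> M.Z i \<and> z i - phi i (f i) \<in> B.X i \<and> (z i = 0 \<longrightarrow> f i = 0)" by (intro choice allI)
        then obtain f where f: "\<forall>i. f i \<in> M.Z i \<and> z i - phi i (f i) \<in> B.X i \<and> (z i = 0 \<longrightarrow> f i = 0)" by (elim exE)
        have "{i. f i \<noteq> 0} \<subseteq> {i. z i \<noteq> 0}" using f by auto
        then have fZ: "f \<in> tcar M.Z" using f z(1) by (auto simp: tcar_def intro: finite_subset)
        have "(\<lambda>i. z i - ph f i) \<in> tcar B.X"
          using B.tcar_diff2[OF B.tZ[OF z(1)] phG[OF M.tZ[OF fZ]]] f by (simp add: tcar_def ph_def)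
        then have "y = cohomology_map B F (M.cl (ka f))"
          unfolding z(2) cm[OF M.tZ[OF fZ]] using B.cl_Pi_eq[OF B.tZ[OF z(1)] phG[OF M.tZ[OF fZ]]] by blast
        then show "y \<in> cohomology_map B F ` carrier (cohomology C)" using fZ by (auto simp: M.coh_carrier)
      qed
    qed
  qed
  show ?thesis unfolding quasi_iso_def using M.A_dgca B.A_dgca hom bij by blast
qed

lemma (in gdga) copy_model:
  fixes k :: "(nat \<Rightarrow> 'v) \<Rightarrow> 'c"
  assumes k: "inj_on k (tcar G)"
  shows "\<exists>C. gdga_model G mu d e C k"
proof -
  define g where "g = inv_into (tcar G) k"
  have g: "g (k f) = f" if "f \<in> tcar G" for f using inv_into_f_f[OF k that] by (simp add: g_def)
  define C :: "(real, 'c) dgca" where "C = \<lparr>carrier = k ` tcar G, monoid.mult = (\<lambda>x y. k (g x \<otimes>\<^bsub>T\<^esub> g y)),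
    one = k \<one>\<^bsub>T\<^esub>, zero = k \<zero>\<^bsub>T\<^esub>, add = (\<lambda>x y. k (g x \<oplus>\<^bsub>T\<^esub> g y)), smult = (\<lambda>c x. k (c \<odot>\<^bsub>T\<^esub> g x)),
    grade = (\<lambda>i. k ` grade T i), diff = (\<lambda>x. k (diff T (g x)))\<rparr>"
  have "dgca_iso T C k"
    unfolding dgca_iso_def C_def using k by (simp add: bij_betw_def g)
  then show ?thesis using gdga_axioms by (intro exI[of _ C] gdga_model.intro gdga_model_axioms.intro)
qed

lemma (in gdga_model) harmonic_projection:
  assumes H: "\<And>i. vsubspace (H i)" "\<And>i x. x \<in> H i \<Longrightarrow> x \<in> Z i" "\<And>i x. x \<in> H i \<Longrightarrow> x \<in> X i \<Longrightarrow> x = 0"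
    "\<And>i z. z \<in> Z i \<Longrightarrow> \<exists>h\<in>H i. z - h \<in> X i"
  shows "\<exists>P. harmonic_model G mu d e A Pi H P"
proof -
  have "\<exists>p. linear p \<and> (\<forall>x. x \<in> H i \<longrightarrow> p x = x) \<and> (\<forall>x. x \<in> X i \<longrightarrow> p x = 0) \<and> (\<forall>x. p x \<in> H i)" for i
  proof -
    obtain p where "linear p" "\<And>x. x \<in> H i \<Longrightarrow> p x = x" "\<And>x. x \<in> X i \<Longrightarrow> p x = 0" "\<And>x. p x \<in> H i"
      using exists_projection_along[OF H(1)[of i] X_subspace[of i] H(3)[of _ i]] by metis
    then show ?thesis by blast
  qed
  then have "\<exists>P. \<forall>i. linear (P i) \<and> (\<forall>x. x \<in> H i \<longrightarrow> P i x = x) \<and> (\<forall>x. x \<in> X i \<longrightarrow> P i x = 0) \<and> (\<forall>x. P i x \<in> H i)"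
    by (intro choice allI)
  then obtain P where P: "\<forall>i. linear (P i) \<and> (\<forall>x. x \<in> H i \<longrightarrow> P i x = x) \<and> (\<forall>x. x \<in> X i \<longrightarrow> P i x = 0) \<and> (\<forall>x. P i x \<in> H i)"
    by (elim exE)
  have P1: "linear (P i)" "x \<in> H i \<Longrightarrow> P i x = x" "x \<in> X i \<Longrightarrow> P i x = 0" "P i x \<in> H i" for i x
    using spec[OF P, of i] by simp_all
  have "z - P i z \<in> X i" if z: "z \<in> Z i" for i z
  proof -
    obtain h where h: "h \<in> H i" "z - h \<in> X i" using H(4)[OF z] by blast
    have "P i z = h" using P1(3)[OF h(2)] P1(2)[OF h(1)] linear_diff[OF P1(1)] by simp
    then show ?thesis using h(2) by simp
  qed
  then have "harmonic_model G mu d e A Pi H P"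
    by (intro harmonic_model.intro gdga_model_axioms harmonic_model_axioms.intro) (use H P1 in auto)
  then show ?thesis by blast
qed

lemma (in gdga_model) harmonic_exists: "\<exists>H P. harmonic_model G mu d e A Pi H P"
proof -
  have "\<exists>C. vsubspace C \<and> C \<subseteq> Z i \<and> (\<forall>x. x \<in> X i \<longrightarrow> x \<in> C \<longrightarrow> x = 0) \<and> (\<forall>w\<in>Z i. \<exists>c\<in>C. w - c \<in> X i)" for i
  proof -
    obtain C where "vsubspace C" "C \<subseteq> Z i" "\<And>x. x \<in> X i \<Longrightarrow> x \<in> C \<Longrightarrow> x = 0" "\<And>w. w \<in> Z i \<Longrightarrow> \<exists>c\<in>C. w - c \<in> X i"
      using exists_complement[OF X_subspace[of i] Z_subspace[of i] X_Z[of i]] by metis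
    then show ?thesis by blast
  qed
  then have "\<exists>H. \<forall>i. vsubspace (H i) \<and> H i \<subseteq> Z i \<and> (\<forall>x. x \<in> X i \<longrightarrow> x \<in> H i \<longrightarrow> x = 0) \<and> (\<forall>w\<in>Z i. \<exists>c\<in>H i. w - c \<in> X i)"
    by (intro choice allI)
  then obtain H where H: "\<forall>i. vsubspace (H i) \<and> H i \<subseteq> Z i \<and> (\<forall>x. x \<in> X i \<longrightarrow> x \<in> H i \<longrightarrow> x = 0) \<and> (\<forall>w\<in>Z i. \<exists>c\<in>H i. w - c \<in> X i)"
    by (elim exE)
  have "\<exists>P. harmonic_model G mu d e A Pi H P"
    by (rule harmonic_projection) (use H in blast)+
  then show ?thesis by blast
qed

lemma dgca_gdga_model:
  fixes A :: "(real, 'a) dgca"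
  assumes "dgca class_ring A"
  obtains G :: "nat \<Rightarrow> ('a \<Rightarrow>\<^sub>0 real) set" and m D e Pi where "gdga_model G (\<lambda>_ _. m) (\<lambda>_. D) e A Pi"
proof -
  obtain G :: "nat \<Rightarrow> ('a \<Rightarrow>\<^sub>0 real) set" and m D e Pi where g: "gdga G (\<lambda>_ _. m) (\<lambda>_. D) e \<and> dgca_iso (total G (\<lambda>_ _. m) (\<lambda>_. D) e) A Pi"
    using dgca_model[OF assms] by (elim exE) (rule that)
  show ?thesis by (rule that[OF gdga_model.intro[OF conjunct1[OF g] gdga_model_axioms.intro[OF conjunct2[OF g]]]])
qed

text \<open>
  The cohomology inherits the structure from the harmonic spaces, which form a typed algebra.
\<close>

lemma cohomology_dgca:
  fixes A :: "(real, 'a) dgca"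
  assumes "dgca class_ring A"
  shows "dgca class_ring (cohomology A)"
proof -
  obtain G :: "nat \<Rightarrow> ('a \<Rightarrow>\<^sub>0 real) set" and m D e Pi where g: "gdga_model G (\<lambda>_ _. m) (\<lambda>_. D) e A Pi"
    by (rule dgca_gdga_model[OF assms])
  obtain H P where h: "harmonic_model G (\<lambda>_ _. m) (\<lambda>_. D) e A Pi H P"
    using gdga_model.harmonic_exists[OF g] by (elim exE) (rule that)
  show ?thesis
    by (rule iso_dgca[OF gdga.T_dgca[OF harmonic_model.H_gdga[OF h]] harmonic_model.coh_iso[OF h]])
qed

lemma dgca_iso_trans:
  assumes f: "dgca_iso A B f" and g: "dgca_iso B C g"
  shows "dgca_iso A C (\<lambda>x. g (f x))"
proof -
  have fc: "f x \<in> carrier B" if "x \<in> carrier A" for x using f that by (auto simp: dgca_iso_def bij_betw_def)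
  have "bij_betw (g \<circ> f) (carrier A) (carrier C)"
    by (rule bij_betw_trans[of f _ "carrier B"]) (use f g in \<open>simp_all add: dgca_iso_def\<close>)
  moreover have "(\<lambda>x. g (f x)) ` grade A i = grade C i" for i
  proof -
    have "(\<lambda>x. g (f x)) ` grade A i = g ` f ` grade A i" by (simp add: image_image)
    then show ?thesis using f g by (simp add: dgca_iso_def)
  qed
  ultimately show ?thesis using f g fc by (simp add: dgca_iso_def o_def)
qed

text \<open>
  A homomorphism is only required to map graded pieces into graded pieces; that a bijective one maps
  them onto each other follows from uniqueness of homogeneous decompositions in the target.
\<close>

lemma dgca_hom_bij_iso:
  fixes A :: "(real, 'a) dgca" and B :: "(real, 'b) dgca"
  assumes A: "dgca class_ring A" and B: "dgca class_ring B" and h: "h \<in> dgca_hom class_ring A B"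
    and bij: "bij_betw h (carrier A) (carrier B)"
  shows "dgca_iso A B h"
proof -
  interpret A: dgca class_ring A by fact
  interpret B: dgca class_ring B by fact
  have g: "h x \<in> grade B i" if "x \<in> grade A i" for x i using h that by (auto simp: dgca_hom_def)
  have d: "h (diff A x) = diff B (h x)" if "x \<in> carrier A" for x using h that by (simp add: dgca_hom_def)
  have r: "h \<in> Ring.ring_hom A B" and l: "h \<in> LinearCombinations.module_hom class_ring A B"
    using h by (auto simp: dgca_hom_def)
  have z: "h \<zero>\<^bsub>A\<^esub> = \<zero>\<^bsub>B\<^esub>" by (rule ring_hom_zero[OF r A.A.ring_axioms B.A.ring_axioms])
  have add: "h (x \<oplus>\<^bsub>A\<^esub> y) = h x \<oplus>\<^bsub>B\<^esub> h y" if "x \<in> carrier A" "y \<in> carrier A" for x y by (rule ring_hom_add[OF r that])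
  have hc: "h x \<in> carrier B" if "x \<in> carrier A" for x by (rule ring_hom_closed[OF r that])
  have gr: "h ` grade A i = grade B i" for i
  proof
    show "h ` grade A i \<subseteq> grade B i" using g by blast
    show "grade B i \<subseteq> h ` grade A i"
    proof
      fix y assume y: "y \<in> grade B i"
      then have yc: "y \<in> carrier B" using dgca_grade_sub[OF B] by blast
      then obtain x where x: "x \<in> carrier A" "y = h x" using bij by (auto simp: bij_betw_def)
      obtain f where f: "is_decomposition A f x" using A.direct_sum[OF x(1)] by blast
      have d1: "is_decomposition B (\<lambda>k. h (f k)) y" unfolding x(2)
        by (rule decomposition_transport[OF A.M.abelian_group_axioms B.M.abelian_group_axioms dgca_grade_sub[OF A] bij add z g f])
      have z0: "\<zero>\<^bsub>B\<^esub> \<in> grade B k" for k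
        using B.grade_subspace[of k] submodule.zero_closed[of class_ring "grade B k" B] by (simp add: VectorSpace.subspace_def)
      have S: "{k. (if k = i then y else \<zero>\<^bsub>B\<^esub>) \<noteq> \<zero>\<^bsub>B\<^esub>} = (if y = \<zero>\<^bsub>B\<^esub> then {} else {i})" by auto
      have d2: "is_decomposition B (\<lambda>k. if k = i then y else \<zero>\<^bsub>B\<^esub>) y"
        unfolding is_decomposition_def S using y z0 yc by auto
      have "(\<lambda>k. h (f k)) = (\<lambda>k. if k = i then y else \<zero>\<^bsub>B\<^esub>)" using B.direct_sum[OF yc] d1 d2 by blast
      then have "h (f i) = y" by (simp add: fun_eq_iff)
      moreover have "f i \<in> grade A i" using f by (simp add: is_decomposition_def)
      ultimately show "y \<in> h ` grade A i" by blast
    qed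
  qed
  have sm: "h (c \<odot>\<^bsub>A\<^esub> x) = c \<odot>\<^bsub>B\<^esub> h x" if "x \<in> carrier A" for c x
    using LinearCombinations.module_hom_smult[OF l _ that, of c] by simp
  show ?thesis unfolding dgca_iso_def
    using bij add ring_hom_mult[OF r] ring_hom_one[OF r] z sm gr d by simp
qed

section \<open>Transport of the Poincare hypotheses\<close>

text \<open>
  The elements whose image lies in the span of the images of \<open>A\<close> form a submodule containing \<open>A\<close>.
\<close>

lemma span_transfer:
  fixes V :: "(real, 'b, 'e) module_scheme" and pr :: "'b \<Rightarrow> 'v::real_vector"
  assumes V: "Module.module class_ring V"
    and add: "\<And>x y. x \<in> carrier V \<Longrightarrow> y \<in> carrier V \<Longrightarrow> pr (x \<oplus>\<^bsub>V\<^esub> y) = pr x + pr y"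
    and scale: "\<And>c x. x \<in> carrier V \<Longrightarrow> pr (c \<odot>\<^bsub>V\<^esub> x) = c *\<^sub>R pr x"
    and A: "A \<subseteq> carrier V" and gen: "carrier V \<subseteq> LinearCombinations.module.span class_ring V A"
  shows "pr ` carrier V \<subseteq> span (pr ` A)"
proof -
  interpret V: Module.module class_ring V by fact
  let ?N = "{x \<in> carrier V. pr x \<in> span (pr ` A)}"
  have "pr \<zero>\<^bsub>V\<^esub> + pr \<zero>\<^bsub>V\<^esub> = pr \<zero>\<^bsub>V\<^esub>" using add[of "\<zero>\<^bsub>V\<^esub>" "\<zero>\<^bsub>V\<^esub>"] by simp
  then have z: "pr \<zero>\<^bsub>V\<^esub> = 0" by simp
  have "submodule class_ring ?N V"
  proof (rule submodule.intro[OF V])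
    show "c \<odot>\<^bsub>V\<^esub> v \<in> ?N" if "c \<in> carrier class_ring" "v \<in> ?N" for c v
      using that V.smult_closed[of c v] by (simp add: scale real_vector.span_scale)
  qed (auto simp: z add real_vector.span_zero intro: real_vector.span_add)
  then have "V.span A \<subseteq> ?N" by (intro V.span_is_subset) (use A in \<open>auto intro: real_vector.span_base\<close>)
  then show ?thesis using gen by blast
qed

lemma span_transfer_back:
  fixes V :: "(real, 'b, 'e) module_scheme" and q :: "'v::real_vector \<Rightarrow> 'b"
  assumes V: "Module.module class_ring V"
    and add: "\<And>x y. x \<in> span T \<Longrightarrow> y \<in> span T \<Longrightarrow> q (x + y) = q x \<oplus>\<^bsub>V\<^esub> q y"
    and scale: "\<And>c x. x \<in> span T \<Longrightarrow> q (c *\<^sub>R x) = c \<odot>\<^bsub>V\<^esub> q x"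
    and qc: "\<And>x. x \<in> span T \<Longrightarrow> q x \<in> carrier V"
  shows "q ` span T \<subseteq> LinearCombinations.module.span class_ring V (q ` T)"
proof -
  interpret V: Module.module class_ring V by fact
  have T: "q ` T \<subseteq> carrier V" using qc real_vector.span_base by blast
  have sub: "submodule class_ring (V.span (q ` T)) V" by (rule V.span_is_submodule[OF T])
  have "q 0 = \<zero>\<^bsub>V\<^esub>" using scale[OF real_vector.span_zero, of 0] V.smult_l_null[OF qc[OF real_vector.span_zero]] by simp
  then have "vsubspace {x \<in> span T. q x \<in> V.span (q ` T)}"
    using submodule.zero_closed[OF sub] submodule.m_closed[OF sub] submodule.smult_closed[OF sub]
    by (auto simp: real_vector.subspace_def add scale real_vector.span_zero real_vector.span_add real_vector.span_scale)
  then have "span T \<subseteq> {x \<in> span T. q x \<in> V.span (q ` T)}"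
    by (intro real_vector.span_minimal) (use V.in_own_span[OF T] real_vector.span_base in auto)
  then show ?thesis by blast
qed

text \<open>
  \<open>B\<close> is the algebra to be shown formal, and \<open>CA\<close> stands for the cohomology of the given Poincare DGCA.
  It is identified with the harmonic spaces of \<open>B\<close> by \<open>Phi\<close>, and the Poincare hypotheses are stated for \<open>CA\<close>.
\<close>

locale poincare_transport = harmonic_model G "\<lambda>_ _. m" "\<lambda>_. D" e B Pi H P
  for G :: "nat \<Rightarrow> 'v::real_vector set" and m :: "'v \<Rightarrow> 'v \<Rightarrow> 'v" and D :: "'v \<Rightarrow> 'v" and e :: 'v
    and B :: "(real, 'b) dgca" and Pi :: "(nat \<Rightarrow> 'v) \<Rightarrow> 'b" and H P +
  fixes r :: nat and CA :: "(real, 'c) dgca" and intg :: "'c \<Rightarrow> real" and phi :: 'c and Phi :: "(nat \<Rightarrow> 'v) \<Rightarrow> 'c"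
  assumes r: "2 \<le> r" and Phi: "dgca_iso TH CA Phi"
    and above: "4 * r - 1 < i \<Longrightarrow> grade CA i = {\<zero>\<^bsub>CA\<^esub>}"
    and fd: "vectorspace.fin_dim class_ring CA"
    and intg_add: "a \<in> grade CA (4 * r - 1) \<Longrightarrow> b \<in> grade CA (4 * r - 1) \<Longrightarrow> intg (a \<oplus>\<^bsub>CA\<^esub> b) = intg a + intg b"
    and intg_scale: "a \<in> grade CA (4 * r - 1) \<Longrightarrow> intg (c \<odot>\<^bsub>CA\<^esub> a) = c * intg a"
    and nondeg: "a \<in> carrier CA \<Longrightarrow> (\<And>b. b \<in> carrier CA \<Longrightarrow> poincare_pairing class_ring CA (4 * r - 1) intg a b = 0) \<Longrightarrow> a = \<zero>\<^bsub>CA\<^esub>"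
    and unit: "bij_betw (\<lambda>c. c \<odot>\<^bsub>CA\<^esub> \<one>\<^bsub>CA\<^esub>) UNIV (grade CA 0)"
    and connected: "0 < i \<Longrightarrow> i < r \<Longrightarrow> grade CA i = {\<zero>\<^bsub>CA\<^esub>}"
    and betti_le: "vectorspace.dim class_ring (CA\<lparr>carrier := grade CA r\<rparr>) \<le> 3"
    and phi: "phi \<in> grade CA (2 * r - 1)" and phi_inj_on: "inj_on (\<lambda>x. phi \<otimes>\<^bsub>CA\<^esub> x) (grade CA r)"
begin

interpretation c: gdga_model H hmu "\<lambda>_ _. 0" e CA Phi
  by (intro gdga_model.intro H_gdga gdga_model_axioms.intro Phi)

text \<open>
  The cohomology class that corresponds to a harmonic element of degree \<open>i\<close>.
\<close>

definition "p i x = Phi (single i x)"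

lemma p_add: assumes "x \<in> H i" "y \<in> H i" shows "p i (x + y) = p i x \<oplus>\<^bsub>CA\<^esub> p i y"
proof -
  have "single i (x + y) = (\<lambda>j. single i x j + single i y j)" by (auto simp: single_def)
  then show ?thesis unfolding p_def by (simp only: c.Pi_add[OF c.single_tcar[OF assms(1)] c.single_tcar[OF assms(2)]])
qed

lemma p_scale: assumes "x \<in> H i" shows "p i (c *\<^sub>R x) = c \<odot>\<^bsub>CA\<^esub> p i x"
proof -
  have "single i (c *\<^sub>R x) = (\<lambda>j. c *\<^sub>R single i x j)" by (auto simp: single_def)
  then show ?thesis unfolding p_def by (simp only: c.Pi_scale[OF c.single_tcar[OF assms]])
qed

lemma p_mult: assumes x: "x \<in> H i" and y: "y \<in> H j" shows "p i x \<otimes>\<^bsub>CA\<^esub> p j y = p (i + j) (P (i + j) (m x y))"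
proof -
  have "p i x \<otimes>\<^bsub>CA\<^esub> p j y = Phi (single (i + j) (hmu i j x y))"
    unfolding p_def c.Pi_mult[OF c.single_tcar[OF x] c.single_tcar[OF y], symmetric] c.T_mult_single[OF x y] ..
  then show ?thesis by (simp only: hmu_def p_def)
qed

lemma p_grade: "grade CA i = p i ` H i"
  unfolding p_def by (rule c.Pi_grade)

lemma p_0: "p i 0 = \<zero>\<^bsub>CA\<^esub>"
proof -
  have "single i (0::'v) = (\<lambda>_. 0)" by (auto simp: single_def)
  then show ?thesis unfolding p_def by (simp only: c.Pi_0)
qed

lemma p_inj: assumes "x \<in> H i" "y \<in> H i" "p i x = p i y" shows "x = y"
proof -
  have "single i x = single i y" using assms(3) unfolding p_def by (simp only: c.Pi_eq c.single_tcar assms(1,2))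
  then show ?thesis by (simp add: single_def fun_eq_iff split: if_splits)
qed

lemma H_0: "0 \<in> H i" by (rule vsubspace_0[OF H_subspace])

lemma p_c: "x \<in> H i \<Longrightarrow> p i x \<in> carrier CA"
  unfolding p_def by (rule c.Pi_c[OF c.single_tcar])

lemma component_grade: assumes "a \<in> carrier CA" shows "component CA i a \<in> grade CA i"
  using theI'[OF c.A.direct_sum[OF assms]] by (simp add: component_def is_decomposition_def)

lemma component_p: assumes x: "x \<in> H i" shows "component CA k (p i x) = (if k = i then p i x else \<zero>\<^bsub>CA\<^esub>)"
proof -
  let ?f = "\<lambda>k. if k = i then p i x else \<zero>\<^bsub>CA\<^esub>"
  have S: "{k. ?f k \<noteq> \<zero>\<^bsub>CA\<^esub>} = (if p i x = \<zero>\<^bsub>CA\<^esub> then {} else {i})" by auto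
  have z: "\<zero>\<^bsub>CA\<^esub> \<in> grade CA k" for k using p_0[of k] H_0[of k] by (auto simp: p_grade image_iff) metis
  have "is_decomposition CA ?f (p i x)"
    unfolding is_decomposition_def S using z x p_c[OF x] by (auto simp: p_grade)
  then have "(THE f. is_decomposition CA f (p i x)) = ?f" using c.A.direct_sum[OF p_c[OF x]] by (intro the1_equality)
  then show ?thesis by (simp add: component_def)
qed

lemma Z_X_iff: assumes "z \<in> Z i" "P i z = 0" shows "z \<in> X i"
  using P_X[OF assms(1)] assms(2) by simp

lemma fin_H: "\<exists>T. finite T \<and> T \<subseteq> H i \<and> H i \<subseteq> span T"
proof -
  have V: "Module.module class_ring CA" by (rule c.A.module_axioms)
  obtain A where A: "finite A" "A \<subseteq> carrier CA" "carrier CA \<subseteq> LinearCombinations.module.span class_ring CA A"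
    using fd unfolding c.A.fin_dim_def by blast
  define pr where "pr = (\<lambda>a. inv_into (tcar H) Phi a i)"
  have pr: "pr (Phi f) = f i" if "f \<in> tcar H" for f
  proof -
    have "inj_on Phi (tcar H)" using c.Pi_bij by (simp add: bij_betw_def)
    then show ?thesis using that by (simp add: pr_def)
  qed
  have "pr ` carrier CA \<subseteq> span (pr ` A)"
  proof (rule span_transfer[OF V _ _ A(2,3)])
    fix x assume "x \<in> carrier CA"
    then obtain f where f: "f \<in> tcar H" "x = Phi f" by (rule c.Pi_surj)
    show "pr (c \<odot>\<^bsub>CA\<^esub> x) = c *\<^sub>R pr x" for c
      unfolding f(2) c.Pi_scale[OF f(1), symmetric] pr[OF c.tcar_scale[OF f(1)]] pr[OF f(1)] ..
    fix y assume "y \<in> carrier CA"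
    then obtain g where g: "g \<in> tcar H" "y = Phi g" by (rule c.Pi_surj)
    show "pr (x \<oplus>\<^bsub>CA\<^esub> y) = pr x + pr y"
      unfolding f(2) g(2) c.Pi_add[OF f(1) g(1), symmetric] pr[OF c.tcar_add[OF f(1) g(1)]] pr[OF f(1)] pr[OF g(1)] ..
  qed
  moreover have "H i \<subseteq> pr ` carrier CA"
  proof
    fix x assume x: "x \<in> H i"
    have "x = pr (p i x)" unfolding p_def pr[OF c.single_tcar[OF x]] by (simp add: single_def)
    then show "x \<in> pr ` carrier CA" using p_c[OF x] by blast
  qed
  moreover have "pr ` A \<subseteq> H i"
  proof
    fix x assume "x \<in> pr ` A"
    then obtain a where a: "a \<in> A" "x = pr a" by blast
    then obtain f where f: "f \<in> tcar H" "a = Phi f" using A(2) c.Pi_surj by blast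
    then show "x \<in> H i" using a pr[OF f(1)] by (auto simp: tcar_def)
  qed
  ultimately show ?thesis using A(1) by (intro exI[of _ "pr ` A"]) blast
qed

text \<open>
  The dimension of the record is the least size of a generating set and has no meaning before a finite
  generating set is known; that is provided by \<open>fin_H\<close>.
\<close>

lemma betti_H: "\<exists>T. finite T \<and> card T \<le> 3 \<and> T \<subseteq> H r \<and> H r \<subseteq> span T"
proof -
  define W where "W = CA\<lparr>carrier := grade CA r\<rparr>"
  have sub: "submodule class_ring (grade CA r) CA" using c.A.grade_subspace[of r] by (simp add: VectorSpace.subspace_def)
  have W: "Module.module class_ring W" unfolding W_def by (rule c.A.submodule_is_module[OF sub])
  interpret W: vectorspace class_ring W by (rule vectorspace.intro[OF W class_field])
  have Wc: "carrier W = p r ` H r" by (simp add: W_def p_grade)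
  obtain T where T: "finite T" "T \<subseteq> H r" "H r \<subseteq> span T" using fin_H[of r] by blast
  have "span T \<subseteq> H r" by (rule real_vector.span_minimal[OF T(2) H_subspace])
  then have HT: "span T = H r" using T(3) by blast
  have "p r ` span T \<subseteq> W.span (p r ` T)"
  proof (rule span_transfer_back[OF W])
    show "p r (x + y) = p r x \<oplus>\<^bsub>W\<^esub> p r y" if "x \<in> span T" "y \<in> span T" for x y
      using p_add that by (simp add: HT W_def)
    show "p r (c *\<^sub>R x) = c \<odot>\<^bsub>W\<^esub> p r x" if "x \<in> span T" for c x using p_scale that by (simp add: HT W_def)
    show "p r x \<in> carrier W" if "x \<in> span T" for x using that by (simp add: HT Wc)
  qed
  then have gen: "carrier W \<subseteq> W.span (p r ` T)" by (simp add: HT Wc)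
  have TW: "p r ` T \<subseteq> carrier W" using T(2) by (auto simp: Wc)
  have "W.span (p r ` T) = carrier W" using gen W.span_is_subset2[OF TW] by blast
  then have ex: "\<exists>n A. finite A \<and> card A = n \<and> A \<subseteq> carrier W \<and> W.gen_set A"
    using T(1) TW by (intro exI[of _ "card (p r ` T)"] exI[of _ "p r ` T"]) simp
  obtain A where A: "finite A" "card A = W.dim" "A \<subseteq> carrier W" "W.gen_set A"
    using LeastI_ex[OF ex] unfolding W.dim_def[symmetric] by blast
  define pr where "pr = inv_into (H r) (p r)"
  have inj: "inj_on (p r) (H r)" by (rule inj_onI) (rule p_inj)
  have pr: "pr (p r x) = x" if "x \<in> H r" for x using inj that by (simp add: pr_def)
  have "pr ` carrier W \<subseteq> span (pr ` A)"
  proof (rule span_transfer[OF W _ _ A(3)])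
    show "carrier W \<subseteq> W.span A" using A(4) by simp
    fix x assume "x \<in> carrier W"
    then obtain f where f: "f \<in> H r" "x = p r f" by (auto simp: Wc)
    show "pr (c \<odot>\<^bsub>W\<^esub> x) = c *\<^sub>R pr x" for c
      using pr[OF vsubspace_scale[OF H_subspace f(1)]] pr[OF f(1)] p_scale[OF f(1)] f(2) by (simp add: W_def)
    fix y assume "y \<in> carrier W"
    then obtain g where g: "g \<in> H r" "y = p r g" by (auto simp: Wc)
    show "pr (x \<oplus>\<^bsub>W\<^esub> y) = pr x + pr y"
      using pr[OF vsubspace_add[OF H_subspace f(1) g(1)]] pr[OF f(1)] pr[OF g(1)] p_add[OF f(1) g(1)] f(2) g(2) by (simp add: W_def)
  qed
  moreover have "pr ` carrier W = H r" using pr by (auto simp: Wc image_iff)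
  moreover have "card (pr ` A) \<le> 3" using card_image_le[OF A(1), of pr] A(2) betti_le by (simp add: W_def)
  ultimately show ?thesis using A(1,3) by (intro exI[of _ "pr ` A"]) auto
qed

text \<open>
  Integration on the model is the given functional composed with the harmonic projection, extended
  linearly to the ambient space. Against a homogeneous class only one summand of the Poincare pairing
  survives, so nondegeneracy of the pairing becomes duality between complementary degrees.
\<close>

lemma typed_poincare_exists: "\<exists>lam ph. typed_poincare G m D e r lam ph"
proof -
  let ?n = "4 * r - 1"
  obtain g where g: "linear g" "\<And>x. x \<in> H ?n \<Longrightarrow> g x = intg (p ?n x)"
  proof (rule linear_extension[OF H_subspace[of ?n], of "\<lambda>x. intg (p ?n x)"])
    show "intg (p ?n (x + y)) = intg (p ?n x) + intg (p ?n y)" if "x \<in> H ?n" "y \<in> H ?n" for x y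
      using that intg_add by (simp add: p_add p_grade)
    show "intg (p ?n (c *\<^sub>R x)) = c *\<^sub>R intg (p ?n x)" if "x \<in> H ?n" for c x
      using that intg_scale by (simp add: p_scale p_grade)
    fix g assume "linear g" "\<And>x. x \<in> H ?n \<Longrightarrow> g x = intg (p ?n x)"
    then show ?thesis by (rule that)
  qed
  define lam where "lam = (\<lambda>x. g (P ?n x))"
  have lam: "linear lam" unfolding lam_def using linear_compose[OF P_linear g(1)] by (simp add: o_def)
  have lam_exact: "lam x = 0" if "x \<in> X ?n" for x using P_exact[OF that] linear_0[OF g(1)] by (simp add: lam_def)
  obtain ph where ph: "ph \<in> H (2 * r - 1)" "phi = p (2 * r - 1) ph" using phi by (auto simp: p_grade)
  have PD: "x = 0" if ij: "i + j = ?n" and x: "x \<in> H i" and l: "\<And>y. y \<in> H j \<Longrightarrow> lam (m x y) = 0" for i j x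
  proof -
    have key: "intg (component CA i' (p i x) \<otimes>\<^bsub>CA\<^esub> component CA j' b) = 0"
      if b: "b \<in> carrier CA" and ij': "i' + j' = ?n" for b i' j'
    proof -
      obtain y where y: "y \<in> H j'" "component CA j' b = p j' y" using component_grade[OF b, of j'] by (auto simp: p_grade)
      show ?thesis
      proof (cases "i' = i")
        case True
        then have "j' = j" using ij ij' by simp
        have z: "m x y \<in> Z ?n" using mu_Z[OF H_Z[OF x] H_Z[OF y(1)]] ij' True by simp
        have "intg (p i x \<otimes>\<^bsub>CA\<^esub> p j' y) = lam (m x y)"
          using p_mult[OF x y(1)] ij' True g(2)[OF P_H[OF z]] by (simp add: lam_def)
        also have "\<dots> = 0" using l y(1) \<open>j' = j\<close> by simp
        finally show ?thesis unfolding y(2) using True by (simp add: component_p[OF x])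
      next
        case False
        have "intg \<zero>\<^bsub>CA\<^esub> = 0" using g(2)[OF H_0] linear_0[OF g(1)] by (simp add: p_0)
        then show ?thesis using False p_c[OF y(1)] by (simp add: y(2) component_p[OF x])
      qed
    qed
    have am: "abelian_monoid (class_ring :: real ring)"
      using class_cring.cring_axioms by (auto simp: cring_def ring_def abelian_group_def)
    have "p i x = \<zero>\<^bsub>CA\<^esub>"
    proof (rule nondeg[OF p_c[OF x]])
      fix b assume b: "b \<in> carrier CA"
      have t: "(if i' + j' = ?n then intg (component CA i' (p i x) \<otimes>\<^bsub>CA\<^esub> component CA j' b) else \<zero>\<^bsub>class_ring\<^esub>) = \<zero>\<^bsub>class_ring\<^esub>"
        for i' j' using key[OF b] by simp
      have "poincare_pairing class_ring CA ?n intg (p i x) b = \<zero>\<^bsub>(class_ring :: real ring)\<^esub>"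
        unfolding poincare_pairing_def t abelian_monoid.finsum_zero[OF am] ..
      then show "poincare_pairing class_ring CA ?n intg (p i x) b = 0" by simp
    qed
    then show "x = 0" using p_inj[OF x H_0] p_0 by simp
  qed
  have "typed_poincare G m D e r lam ph"
  proof (intro typed_poincare.intro integrated_gdga.intro gdga_axioms integrated_gdga_axioms.intro typed_poincare_axioms.intro)
    show "2 \<le> r" by (rule r)
    show "linear lam" by (rule lam)
    show "lam (D x) = 0" if "x \<in> G (4 * r - 2)" for x
    proof (rule lam_exact)
      have "Suc (4 * r - 2) = ?n" using r by simp
      then show "D x \<in> X ?n" using d_X[OF that] by simp
    qed
    have one: "p 0 e = \<one>\<^bsub>CA\<^esub>" unfolding p_def by (rule c.Pi_one)
    have cu: "p 0 (c *\<^sub>R e) = c \<odot>\<^bsub>CA\<^esub> \<one>\<^bsub>CA\<^esub>" for c using p_scale[OF e_H] one by simp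
    show "e \<noteq> 0"
    proof
      assume "e = 0"
      then have "0 \<odot>\<^bsub>CA\<^esub> \<one>\<^bsub>CA\<^esub> = 1 \<odot>\<^bsub>CA\<^esub> \<one>\<^bsub>CA\<^esub>" using cu[of 0] cu[of 1] by simp
      then have "(0::real) = 1" using unit by (auto simp: bij_betw_def dest: injD)
      then show False by simp
    qed
    show "\<exists>c. z = c *\<^sub>R e" if z: "z \<in> Z 0" for z
    proof -
      have "z = P 0 z" using P_X[OF z] by (simp add: X_def)
      then have zH: "z \<in> H 0" using P_H[OF z] by simp
      then have "p 0 z \<in> grade CA 0" by (simp add: p_grade)
      then obtain c where "p 0 z = c \<odot>\<^bsub>CA\<^esub> \<one>\<^bsub>CA\<^esub>" using unit by (auto simp: bij_betw_def)
      then have "z = c *\<^sub>R e" using p_inj[OF zH vsubspace_scale[OF H_subspace e_H]] cu by simp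
      then show ?thesis by blast
    qed
    have van: "z \<in> X i" if "grade CA i = {\<zero>\<^bsub>CA\<^esub>}" and z: "z \<in> Z i" for i z
    proof (rule Z_X_iff[OF z])
      have "p i (P i z) = \<zero>\<^bsub>CA\<^esub>" using that(1) P_H[OF z] by (auto simp: p_grade)
      then show "P i z = 0" using p_inj[OF P_H[OF z] H_0] p_0 by simp
    qed
    show "0 < i \<Longrightarrow> i < r \<Longrightarrow> z \<in> Z i \<Longrightarrow> z \<in> X i" for i z by (rule van[OF connected])
    show "i > ?n \<Longrightarrow> z \<in> Z i \<Longrightarrow> z \<in> X i" for i z by (rule van[OF above])
    show "z \<in> X i" if ij: "i + j = ?n" and z: "z \<in> Z i" and l: "\<And>y. y \<in> Z j \<Longrightarrow> lam (m z y) = 0" for i j z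
    proof (rule Z_X_iff[OF z], rule PD[OF ij P_H[OF z]])
      fix y assume y: "y \<in> H j"
      have "m (z - P i z) y \<in> X ?n" using mu_X_left[OF P_X[OF z] H_Z[OF y]] ij by simp
      then have "lam (m z y - m (P i z) y) = 0" using lam_exact by (simp add: mu_diff_left)
      then show "lam (m (P i z) y) = 0" using l[OF H_Z[OF y]] by (simp add: linear_diff[OF lam])
    qed
    show "\<exists>T. finite T \<and> T \<subseteq> Z i \<and> (\<forall>z\<in>Z i. \<exists>t\<in>span T. z - t \<in> X i)" for i
    proof -
      obtain T where "finite T" "T \<subseteq> H i" "H i \<subseteq> span T" using fin_H[of i] by blast
      then show ?thesis using H_Z P_H P_X by (intro exI[of _ T]) blast
    qed
    show "\<exists>T. finite T \<and> card T \<le> 3 \<and> T \<subseteq> Z r \<and> (\<forall>z\<in>Z r. \<exists>t\<in>span T. z - t \<in> X r)"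
    proof -
      obtain T where "finite T" "card T \<le> 3" "T \<subseteq> H r" "H r \<subseteq> span T" using betti_H by blast
      then show ?thesis using H_Z P_H P_X by (intro exI[of _ T]) blast
    qed
    show "ph \<in> Z (2 * r - 1)" by (rule H_Z[OF ph(1)])
    show "z \<in> X r" if z: "z \<in> Z r" and x: "m ph z \<in> X (3 * r - 1)" for z
    proof (rule Z_X_iff[OF z])
      have n: "2 * r - 1 + r = 3 * r - 1" using r by simp
      have "m ph (z - P r z) \<in> X (3 * r - 1)" using mu_X_right[OF H_Z[OF ph(1)] P_X[OF z]] n by simp
      then have "m ph z - m ph (z - P r z) \<in> X (3 * r - 1)" by (rule vsubspace_diff[OF X_subspace x])
      then have "P (3 * r - 1) (m ph (P r z)) = 0" using P_exact by (simp add: mu_diff_right)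
      then have "phi \<otimes>\<^bsub>CA\<^esub> p r (P r z) = \<zero>\<^bsub>CA\<^esub>" using p_mult[OF ph(1) P_H[OF z]] n ph(2) p_0 by simp
      moreover have "phi \<otimes>\<^bsub>CA\<^esub> p r 0 = \<zero>\<^bsub>CA\<^esub>" using p_c[OF ph(1)] ph(2) p_0 by simp
      moreover have "p r (P r z) \<in> grade CA r" "p r 0 \<in> grade CA r" using P_H[OF z] H_0 by (simp_all add: p_grade)
      ultimately have "p r (P r z) = p r 0" using phi_inj_on by (auto simp: inj_on_def)
      then show "P r z = 0" by (rule p_inj[OF P_H[OF z] H_0])
    qed
  qed
  then show ?thesis by blast
qed

end

section \<open>Intrinsic formality\<close>

text \<open>
  An injection of the reals makes the type \<open>'b\<close> at least as large as
  \<open>nat \<times> ('b + nat) \<times> real\<close>, and a sequence of pairs of finitely supported functions is determined by its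
  graph in that product.
\<close>

lemma graded_injection:
  fixes j :: "real \<Rightarrow> 'b"
  assumes j: "inj j"
  shows "\<exists>k :: (nat \<Rightarrow> ('b \<Rightarrow>\<^sub>0 real) \<times> (nat \<Rightarrow>\<^sub>0 real)) \<Rightarrow> 'b set. inj k"
proof -
  let ?U = "UNIV :: 'b set"
  have inf: "infinite ?U"
  proof
    assume "finite ?U"
    then have "finite (range j)" by (rule finite_subset[rotated]) simp
    then show False using finite_imageD[OF _ j] infinite_UNIV_char_0[where 'a = real] by blast
  qed
  have re: "(card_of (UNIV :: real set), card_of ?U) \<in> ordLeq" using j by (intro card_of_ordLeqI[of j]) auto
  have na: "(card_of (UNIV :: nat set), card_of ?U) \<in> ordLeq" using inf infinite_iff_card_of_nat by blast
  have field: "infinite (Field (card_of ?U))" using inf by (simp only: Field_card_of not_False_eq_True)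
  note leq = card_of_Plus_ordLeq_infinite_Field[OF field _ _ card_of_Card_order]
    card_of_Times_ordLeq_infinite_Field[OF field _ _ card_of_Card_order]
  have "(card_of (?U <+> (UNIV :: nat set)), card_of ?U) \<in> ordLeq"
    by (rule leq(1)[OF ordLeq_reflexive[OF card_of_Well_order] na])
  then have su: "(card_of (UNIV :: ('b + nat) set), card_of ?U) \<in> ordLeq" by (simp only: UNIV_Plus_UNIV)
  have "(card_of ((UNIV :: nat set) \<times> (UNIV :: ('b + nat) set) \<times> (UNIV :: real set)), card_of ?U) \<in> ordLeq"
    by (intro leq(2) na su re)
  then have "(card_of (UNIV :: (nat \<times> ('b + nat) \<times> real) set), card_of ?U) \<in> ordLeq" by (simp only: UNIV_Times_UNIV)
  then obtain i :: "nat \<times> ('b + nat) \<times> real \<Rightarrow> 'b" where i: "inj i" unfolding card_of_ordLeq[symmetric] by blast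
  define val where "val = (\<lambda>(f :: nat \<Rightarrow> ('b \<Rightarrow>\<^sub>0 real) \<times> (nat \<Rightarrow>\<^sub>0 real)) n u.
    case u of Inl b \<Rightarrow> Poly_Mapping.lookup (fst (f n)) b | Inr l \<Rightarrow> Poly_Mapping.lookup (snd (f n)) l)"
  have "inj (\<lambda>f. i ` {(n, u, t). t = val f n u})"
  proof (rule injI)
    fix f g assume "i ` {(n, u, t). t = val f n u} = i ` {(n, u, t). t = val g n u}"
    then have "{(n, u, t). t = val f n u} = {(n, u, t). t = val g n u}" using i by (simp only: inj_image_eq_iff)
    then have v: "val f n u = val g n u" for n u by blast
    show "f = g"
    proof
      fix n
      show "f n = g n"
      proof (rule prod_eqI; rule poly_mapping_eqI)
        show "Poly_Mapping.lookup (fst (f n)) b = Poly_Mapping.lookup (fst (g n)) b" for b using v[of n "Inl b"] by (simp add: val_def)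
        show "Poly_Mapping.lookup (snd (f n)) b = Poly_Mapping.lookup (snd (g n)) b" for b using v[of n "Inr b"] by (simp add: val_def)
      qed
    qed
  qed
  then show ?thesis by (rule exI[of inj])
qed

text \<open>
  The zigzag consists of the projection to the first component, from the intermediate algebra to \<open>B\<close>,
  and of \<open>psi\<close>, from the intermediate algebra to the cohomology of \<open>B\<close>. The multiples of the unit provide
  the injection of the reals needed to copy the intermediate algebra into \<open>'b set\<close>.
\<close>

lemma typed_poincare_formal:
  fixes G :: "nat \<Rightarrow> ('b \<Rightarrow>\<^sub>0 real) set" and B :: "(real, 'b) dgca"
    and Pi :: "(nat \<Rightarrow> 'b \<Rightarrow>\<^sub>0 real) \<Rightarrow> 'b"
  assumes B: "gdga_model G (\<lambda>_ _. m) (\<lambda>_. D) e B Pi" and T: "typed_poincare G m D e r lam ph"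
  shows "formal class_ring B"
proof -
  interpret B: gdga_model G "\<lambda>_ _. m" "\<lambda>_. D" e B Pi by (rule B)
  obtain H cc rho ev S Gam sig w Y N tau where F: "formality_data G m D e r lam H cc rho ev S Gam sig w Y N tau"
    by (rule typed_poincare.formality_data_ex[OF T])
  interpret F: formality_data G m D e r lam H cc rho ev S Gam sig w Y N tau by (rule F)
  have "\<exists>P. harmonic_model G (\<lambda>_ _. m) (\<lambda>_. D) e B Pi H P"
    by (rule B.harmonic_projection) (rule F.H_subspace, erule F.H_Z, erule (1) F.H_X, erule F.H_dec)
  then obtain P where h: "harmonic_model G (\<lambda>_ _. m) (\<lambda>_. D) e B Pi H P" by (elim exE) (rule that)
  interpret h: harmonic_model G "\<lambda>_ _. m" "\<lambda>_. D" e B Pi H P by (rule h)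
  have "inj (\<lambda>c. Pi (single 0 (c *\<^sub>R e)))"
  proof (rule injI)
    fix a b assume "Pi (single 0 (a *\<^sub>R e)) = Pi (single 0 (b *\<^sub>R e))"
    then have "single 0 (a *\<^sub>R e) = single 0 (b *\<^sub>R e)"
      using B.Pi_eq[OF B.single_tcar[OF vsubspace_scale[OF B.G_subspace B.e_G]] B.single_tcar[OF vsubspace_scale[OF B.G_subspace B.e_G]]] by blast
    then have "single 0 (a *\<^sub>R e) 0 = single 0 (b *\<^sub>R e) 0" by (rule fun_cong)
    then have "a *\<^sub>R e = b *\<^sub>R e" by (simp add: single_def)
    then show "a = b" using typed_poincare.e_nz[OF T] by simp
  qed
  then obtain k :: "(nat \<Rightarrow> ('b \<Rightarrow>\<^sub>0 real) \<times> (nat \<Rightarrow>\<^sub>0 real)) \<Rightarrow> 'b set" where k: "inj k"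
    using graded_injection by blast
  have "inj_on k (tcar F.M)" by (rule inj_on_subset[OF k]) simp
  then obtain C where C: "gdga_model F.M F.pm F.dd (e, punit r) C k"
    using gdga.copy_model[OF F.M_gdga] by blast
  interpret c: gdga_model F.M F.pm F.dd "(e, punit r)" C k by (rule C)
  have fst_lin: "linear fst" by (rule linear_fst)
  have fst_X: "fst x \<in> B.X i" if x: "x \<in> c.X i" for i x
  proof (cases i)
    case 0 then show ?thesis using x by (simp add: c.X_def B.X_def)
  next
    case (Suc j)
    then obtain y where y: "y \<in> F.M j" "x = F.dd j y" using x by (auto simp: c.X_Suc)
    have "fst y \<in> G j" using F.M_sub[OF y(1)] by auto
    then show ?thesis using Suc B.d_X y(2) by (simp add: pd_def)
  qed
  have psi_X: "F.psi i x = 0" if x: "x \<in> c.X i" for i x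
  proof (cases i)
    case 0 then show ?thesis using x linear_0[OF F.psi_linear] by (simp add: c.X_def)
  next
    case (Suc j)
    then obtain y where y: "y \<in> F.M j" "x = F.dd j y" using x by (auto simp: c.X_Suc)
    then show ?thesis using F.psi_dd[OF y(1)] Suc by simp
  qed
  have exact: "x \<in> c.X i" if "x - F.iota i h \<in> c.X i" "h = 0" for x i h
    using that linear_0[OF F.iota_linear] by simp
  have Q1: "\<exists>f. quasi_iso class_ring C B f"
  proof (rule gdga_quasi_iso[OF C B, where phi = "\<lambda>_. fst"])
    show "fst x \<in> G i" if "x \<in> F.M i" for i x using F.M_sub[OF that] by auto
    show "\<exists>x\<in>c.Z i. z - fst x \<in> B.X i" if z: "z \<in> B.Z i" for i z
    proof -
      obtain h where hh: "h \<in> H i" "z - h \<in> B.X i" using F.H_dec[OF z] by blast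
      then show ?thesis using F.iota_Z[OF hh(1)] by (intro bexI[of _ "F.iota i h"]) (simp_all add: F.iota_def)
    qed
    show "x \<in> c.X i" if x: "x \<in> c.Z i" "fst x \<in> B.X i" for i x
    proof -
      obtain h where hh: "h \<in> H i" "x - F.iota i h \<in> c.X i" using F.M_closed[OF x(1)] by blast
      have "fst x - h \<in> B.X i" using fst_X[OF hh(2)] by (simp add: F.iota_def)
      then have "fst x - (fst x - h) \<in> B.X i" by (rule vsubspace_diff[OF B.X_subspace x(2)])
      then have "h = 0" using F.H_X[OF hh(1)] by simp
      then show ?thesis by (rule exact[OF hh(2)])
    qed
  qed (simp_all add: pmu_def pd_def fst_lin)
  have Hm: "gdga_model H h.hmu (\<lambda>_ _. 0) e (cohomology B) (\<lambda>f. B.cl (Pi f))"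
    by (intro gdga_model.intro h.H_gdga gdga_model_axioms.intro h.coh_iso)
  interpret t: gdga_model H h.hmu "\<lambda>_ _. 0" e "cohomology B" "\<lambda>f. B.cl (Pi f)" by (rule Hm)
  have tX: "x \<in> t.X i \<longleftrightarrow> x = 0" for x i
    using vsubspace_0[OF F.H_subspace] by (auto simp: t.X_def split: nat.splits)
  have tZ: "x \<in> t.Z i \<longleftrightarrow> x \<in> H i" for x i by (simp add: t.Z_def)
  have Q2: "\<exists>f. quasi_iso class_ring C (cohomology B) f"
  proof (rule gdga_quasi_iso[OF C Hm, where phi = F.psi])
    show "linear (F.psi i)" for i by (rule F.psi_linear)
    show "F.psi i x \<in> H i" if "x \<in> F.M i" for i x by (rule F.psi_H[OF that])
    show "F.psi (i + j) (F.pm i j x y) = h.hmu i j (F.psi i x) (F.psi j y)" if x: "x \<in> F.M i" and y: "y \<in> F.M j" for i j x y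
      using h.P_eq[OF F.psi_mult[OF x y]] h.P_id[OF F.psi_H[OF c.mu_G[OF x y]]] by (simp add: h.hmu_def)
    show "F.psi (Suc i) (F.dd i x) = 0" if "x \<in> F.M i" for i x by (rule F.psi_dd[OF that])
    show "F.psi 0 (e, punit r) = e" using F.r2 by (simp add: F.psi_def)
    show "\<exists>x\<in>c.Z i. z - F.psi i x \<in> t.X i" if z: "z \<in> t.Z i" for i z
      using F.iota_Z[of z i] F.psi_iota[of z i] z unfolding tZ tX by (intro bexI[of _ "F.iota i z"]) simp_all
    show "x \<in> c.X i" if x: "x \<in> c.Z i" "F.psi i x \<in> t.X i" for i x
    proof -
      obtain h where hh: "h \<in> H i" "x - F.iota i h \<in> c.X i" using F.M_closed[OF x(1)] by blast
      have "F.psi i x = h" using psi_X[OF hh(2)] F.psi_iota[OF hh(1)] by (simp add: linear_diff[OF F.psi_linear])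
      then have "h = 0" using x(2) by (simp add: tX)
      then show ?thesis by (rule exact[OF hh(2)])
    qed
  qed
  have "qi_linked class_ring B C" "qi_linked class_ring C (cohomology B)" using Q1 Q2 by (auto simp: qi_linked_def)
  then show ?thesis unfolding formal_def by blast
qed

theorem theorem5p1:
  fixes A :: "(real, 'a) dgca" and r :: nat and intg :: "'a set \<Rightarrow> real" and \<phi> :: "'a set"
  assumes "2 \<le> r"
    and "poincare_dgca class_ring A (4 * r - 1) intg"
    and "cohomologically_connected class_ring (r - 1) A"
    and "betti class_ring A r \<le> 3"
    and "\<phi> \<in> grade (cohomology A) (2 * r - 1)"
    and "bij_betw (\<lambda>x. \<phi> \<otimes>\<^bsub>cohomology A\<^esub> x)
           (grade (cohomology A) r) (grade (cohomology A) (3 * r - 1))"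
  shows "intrinsically_formal TYPE('b) class_ring A"
  unfolding intrinsically_formal_def
proof (intro allI impI)
  interpret A: poincare_dgca class_ring A "4 * r - 1" intg by fact
  fix B :: "(real, 'b) dgca"
  assume "dgca class_ring B \<and> cohomology_isomorphic class_ring B A"
  then have B: "dgca class_ring B" and iso: "cohomology_isomorphic class_ring B A" by auto
  have A: "dgca class_ring A" by (rule A.dgca_axioms)
  note cA = cohomology_dgca[OF A] and cB = cohomology_dgca[OF B]
  interpret cA: dgca class_ring "cohomology A" by (rule cA)
  obtain h where h: "dgca_iso (cohomology B) (cohomology A) h"
    using iso dgca_hom_bij_iso[OF cB cA] unfolding cohomology_isomorphic_def by blast
  \<comment> \<open>A model of \<open>A\<close> itself is only needed to describe the graded pieces of its cohomology above the
    top degree.\<close>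
  obtain GA :: "nat \<Rightarrow> ('a \<Rightarrow>\<^sub>0 real) set" and mA DA eA PiA where "gdga_model GA (\<lambda>_ _. mA) (\<lambda>_. DA) eA A PiA"
    by (rule dgca_gdga_model[OF A])
  then interpret a: gdga_model GA "\<lambda>_ _. mA" "\<lambda>_. DA" eA A PiA .
  obtain G :: "nat \<Rightarrow> ('b \<Rightarrow>\<^sub>0 real) set" and m D e Pi where b: "gdga_model G (\<lambda>_ _. m) (\<lambda>_. D) e B Pi"
    by (rule dgca_gdga_model[OF B])
  obtain H P where "harmonic_model G (\<lambda>_ _. m) (\<lambda>_. D) e B Pi H P"
    using gdga_model.harmonic_exists[OF b] by (elim exE) (rule that)
  then interpret b: harmonic_model G "\<lambda>_ _. m" "\<lambda>_. D" e B Pi H P .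
  have above: "grade (cohomology A) i = {\<zero>\<^bsub>cohomology A\<^esub>}" if i: "4 * r - 1 < i" for i
  proof -
    have x0: "a.cl (PiA (single i x)) = coboundaries A" if x: "x \<in> a.Z i" for x
    proof -
      have "PiA (single i x) \<in> grade A i" unfolding a.Pi_grade using a.Z_G[OF x] by (rule imageI)
      then have "PiA (single i x) = PiA (\<lambda>_. 0)" using A.degree_bound[OF i] by (simp add: a.Pi_0)
      then show ?thesis by (simp only: a.cl_0)
    qed
    have "grade (cohomology A) i = (\<lambda>_. coboundaries A) ` a.Z i"
      unfolding a.coh_grade by (rule image_cong[OF refl x0])
    also have "\<dots> = {coboundaries A}" using vsubspace_0[OF a.Z_subspace[of i]] by (rule image_constant)
    finally show ?thesis by (simp only: a.coh_zero)
  qed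
  have "poincare_transport G m D e B Pi H P r (cohomology A) intg \<phi> (\<lambda>f. h (b.cl (Pi f)))"
  proof (intro poincare_transport.intro b.harmonic_model_axioms poincare_transport_axioms.intro)
    show "dgca_iso b.TH (cohomology A) (\<lambda>f. h (b.cl (Pi f)))" by (rule dgca_iso_trans[OF b.coh_iso h])
    show "vectorspace.fin_dim class_ring (cohomology A)" by (rule A.cohomology_fin_dim)
    show "intg (x \<oplus>\<^bsub>cohomology A\<^esub> y) = intg x + intg y"
      if "x \<in> grade (cohomology A) (4 * r - 1)" "y \<in> grade (cohomology A) (4 * r - 1)" for x y
      using A.intg_add[OF that] by simp
    show "intg (c \<odot>\<^bsub>cohomology A\<^esub> x) = c * intg x" if "x \<in> grade (cohomology A) (4 * r - 1)" for c x
      using A.intg_smult[OF _ that, of c] by simp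
    show "x = \<zero>\<^bsub>cohomology A\<^esub>" if "x \<in> carrier (cohomology A)"
      "\<And>y. y \<in> carrier (cohomology A) \<Longrightarrow> poincare_pairing class_ring (cohomology A) (4 * r - 1) intg x y = 0" for x
    proof (rule A.nondegenerate_left[OF that(1)])
      fix y assume "y \<in> carrier (cohomology A)"
      from that(2)[OF this] show "poincare_pairing class_ring (cohomology A) (4 * r - 1) intg x y = \<zero>\<^bsub>(class_ring :: real ring)\<^esub>"
        by simp
    qed
    show "bij_betw (\<lambda>c. c \<odot>\<^bsub>cohomology A\<^esub> \<one>\<^bsub>cohomology A\<^esub>) UNIV (grade (cohomology A) 0)"
      using assms(3) by (simp add: cohomologically_connected_def)
    show "0 < i \<Longrightarrow> i < r \<Longrightarrow> grade (cohomology A) i = {\<zero>\<^bsub>cohomology A\<^esub>}" for i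
      using assms(3) by (simp add: cohomologically_connected_def)
    show "vectorspace.dim class_ring (cohomology A\<lparr>carrier := grade (cohomology A) r\<rparr>) \<le> 3"
      using assms(4) by (simp add: betti_def)
    show "inj_on (\<lambda>x. \<phi> \<otimes>\<^bsub>cohomology A\<^esub> x) (grade (cohomology A) r)" using assms(6) by (simp add: bij_betw_def)
  qed (use assms above in auto)
  from poincare_transport.typed_poincare_exists[OF this]
  obtain lam ph where "typed_poincare G m D e r lam ph" by (elim exE) (rule that)
  then show "formal class_ring B" by (rule typed_poincare_formal[OF b])
qed

end
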